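(* For the dihedral Enneper surface $\Sigma_1^5$ of order $5$: (1) $\mathrm{ind}_c(\Sigma_1^5)=9$, and (2) $\mathrm{ind}_b(\Sigma_1^5)=11$.
   Context: The dihedral Enneper surface $\Sigma_1^n(R)$ of order $n$ and radius $R>0$ is the immersed minimal surface with patch $$\sigma(u,v)=\left(\frac{u\beta\cos v-u^{\beta}\cos(\beta v)}{2\beta},\ \frac{-u\beta\sin v-u^{\beta}\sin(\beta v)}{2\beta},\ \frac{u^{n+1}\cos((n+1)v)}{n+1}\right),\qquad \beta=2n+1,$$ where $(u,v)$ are polar coordinates, $0<u<R$, $v\in[0,2\pi)$, on the disc $\Omega(R)$ of radius $R$ (functions on $\Omega(R)$ are $2\pi$-periodic in $v$). Let $g=(g_{ij})$ be the induced metric in the coordinates $(u,v)$, $(g^{ij})$ its inverse, $|g|=\det(g_{ij})$, $\kappa$ the Gaussian curvature; subscripts on $\varphi$ denote partial derivatives in $(u,v)$ and repeated indices are summed. The second variation of area in the direction of the normal variation $\sigma+t\varphi\mathbf N$ ($\mathbf N$ the unit normal) is $$Q(\varphi)=\int_{\Omega(R)}\left(g^{ij}\varphi_i\varphi_j+2\kappa\varphi^2\right)\sqrt{|g|}\,du\,dv .$$ $\mathrm{ind}_c(\Sigma_1^n(R))$ is the maximal dimension of a linear subspace of $\mathcal H^1_0(\Omega(R))$ (the Sobolev space of the disc) on which $Q$ is negative definite. $\mathcal F(\Omega(R))$ is the set of functions, smooth in $(u,v)$ for $0<u<R$, lying in the Sobolev space $\mathcal H^1$ of the disc $\Omega(R)$,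 whose partial derivatives of order at most $2$ in $(u,v)$ are bounded; $\mathrm{ind}_b(\Sigma_1^n(R))$ is the maximal dimension of a linear subspace of $\mathcal F(\Omega(R))$ on which $Q$ is negative definite. Finally $$\mathrm{ind}_c(\Sigma_1^n):=\lim_{R\to\infty}\mathrm{ind}_c(\Sigma_1^n(R)),\qquad \mathrm{ind}_b(\Sigma_1^n):=\lim_{R\to\infty}\mathrm{ind}_b(\Sigma_1^n(R)).$$ *)

theory Defs
  imports "HOL-Analysis.Analysis" "HOL-Library.Function_Algebras"
begin

section \<open>Partial derivatives and smooth functions in the plane\<close>

text \<open>The plane is \<open>real \<times> real\<close>; coordinate directions are indexed by the two-element
  type \<open>2\<close>, so that index expressions such as \<open>g\<^sub>i\<^sub>j\<close> become sums over \<open>UNIV :: 2 set\<close>.\<close>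

definition coord_dir :: "2 \<Rightarrow> real \<times> real" where
  "coord_dir i = (if i = 1 then (1, 0) else (0, 1))"

definition pd :: "2 \<Rightarrow> (real \<times> real \<Rightarrow> 'a::real_normed_vector) \<Rightarrow> real \<times> real \<Rightarrow> 'a" where
  "pd i f p = vector_derivative (\<lambda>t. f (p + t *\<^sub>R coord_dir i)) (at 0)"

text \<open>\<open>Ck_on k S f\<close> and \<open>smooth_on S f\<close> are meant for open \<open>S\<close>.\<close>

primrec Ck_on :: "nat \<Rightarrow> (real \<times> real) set \<Rightarrow> (real \<times> real \<Rightarrow> real) \<Rightarrow> bool" where
  "Ck_on 0 S f \<longleftrightarrow> continuous_on S f"
| "Ck_on (Suc k) S f \<longleftrightarrow> (\<forall>p\<in>S. f differentiable (at p)) \<and> (\<forall>i. Ck_on k S (pd i f))"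

definition smooth_on :: "(real \<times> real) set \<Rightarrow> (real \<times> real \<Rightarrow> real) \<Rightarrow> bool" where
  "smooth_on S f \<longleftrightarrow> (\<forall>k. Ck_on k S f)"

definition test_fun :: "(real \<times> real) set \<Rightarrow> (real \<times> real \<Rightarrow> real) set" where
  "test_fun S = {\<psi>. smooth_on UNIV \<psi> \<and> compact (closure {p. \<psi> p \<noteq> 0}) \<and> closure {p. \<psi> p \<noteq> 0} \<subseteq> S}"


section \<open>Weak derivatives and Sobolev spaces on an open set\<close>

text \<open>Elements of the Sobolev spaces are represented by functions on the whole plane, of which only
  the restriction to \<open>S\<close> matters, and which are not identified when they agree almost
  everywhere on \<open>S\<close>; see \<open>neg_index\<close> below for why this is harmless.\<close>

definition locally_integrable :: "(real \<times> real) set \<Rightarrow> (real \<times> real \<Rightarrow> real) \<Rightarrow> bool" where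
  "locally_integrable S f \<longleftrightarrow> (\<forall>K. compact K \<and> K \<subseteq> S \<longrightarrow> set_integrable lborel K f)"

definition is_weak_pd ::
    "2 \<Rightarrow> (real \<times> real) set \<Rightarrow> (real \<times> real \<Rightarrow> real) \<Rightarrow> (real \<times> real \<Rightarrow> real) \<Rightarrow> bool" where
  "is_weak_pd i S f g \<longleftrightarrow> locally_integrable S f \<and> locally_integrable S g \<and>
     (\<forall>\<psi>\<in>test_fun S. (LINT p:S|lborel. f p * pd i \<psi> p) = - (LINT p:S|lborel. g p * \<psi> p))"

text \<open>The weak derivative is unique up to null sets, so the choice is immaterial under integrals.\<close>

definition weak_pd :: "2 \<Rightarrow> (real \<times> real) set \<Rightarrow> (real \<times> real \<Rightarrow> real) \<Rightarrow> real \<times> real \<Rightarrow> real" where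
  "weak_pd i S f = (SOME g. is_weak_pd i S f g)"

definition L2_on :: "(real \<times> real) set \<Rightarrow> (real \<times> real \<Rightarrow> real) set" where
  "L2_on S = {f. set_borel_measurable lborel S f \<and> set_integrable lborel S (\<lambda>p. (f p)\<^sup>2)}"

definition H1 :: "(real \<times> real) set \<Rightarrow> (real \<times> real \<Rightarrow> real) set" where
  "H1 S = {f \<in> L2_on S. \<forall>i. \<exists>g\<in>L2_on S. is_weak_pd i S f g}"

definition H1_norm :: "(real \<times> real) set \<Rightarrow> (real \<times> real \<Rightarrow> real) \<Rightarrow> real" where
  "H1_norm S f =
     sqrt ((LINT p:S|lborel. (f p)\<^sup>2) + (\<Sum>i\<in>UNIV. LINT p:S|lborel. (weak_pd i S f p)\<^sup>2))"

definition H10 :: "(real \<times> real) set \<Rightarrow> (real \<times> real \<Rightarrow> real) set" where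
  "H10 S = {f \<in> H1 S. \<exists>\<psi> :: nat \<Rightarrow> real \<times> real \<Rightarrow> real.
     (\<forall>k. \<psi> k \<in> test_fun S) \<and> (\<lambda>k. H1_norm S (f - \<psi> k)) \<longlonglongrightarrow> 0}"


section \<open>Index of a quadratic form on a space of functions\<close>

global_interpretation fun_vs: vector_space "\<lambda>(c::real) (f::real \<times> real \<Rightarrow> real) p. c * f p"
  by unfold_locales (auto simp: fun_eq_iff algebra_simps)

definition negative_definite_on ::
    "(real \<times> real \<Rightarrow> real) set \<Rightarrow> ((real \<times> real \<Rightarrow> real) \<Rightarrow> real) \<Rightarrow> bool" where
  "negative_definite_on W Q \<longleftrightarrow> (\<forall>f\<in>W. f \<noteq> 0 \<longrightarrow> Q f < 0)"

text \<open>The maximal dimension of a linear subspace \<open>W\<close> of \<open>V\<close> on which \<open>Q\<close> is negative definite,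
  with value \<open>\<infinity>\<close> if there are such subspaces of arbitrarily large finite dimension. Finite-dimensional
  subspaces are given by a finite basis \<open>B\<close>, because \<open>dim\<close> is 0 in infinite dimension.
  If \<open>Q\<close> depends only on the almost-everywhere class of \<open>f\<close>, then \<open>Q\<close> vanishes on functions that are
  0 almost everywhere; hence distinct elements of such a \<open>W\<close> lie in distinct classes, and the
  value is the same as for the space of classes.\<close>

definition neg_index ::
    "(real \<times> real \<Rightarrow> real) set \<Rightarrow> ((real \<times> real \<Rightarrow> real) \<Rightarrow> real) \<Rightarrow> enat" where
  "neg_index V Q = Sup {enat (fun_vs.dim W) | W.
     fun_vs.subspace W \<and> (\<exists>B. finite B \<and> fun_vs.independent B \<and> fun_vs.span B = W) \<and>
     W \<subseteq> V \<and> negative_definite_on W Q}"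


section \<open>The dihedral Enneper surface\<close>

definition enneper :: "nat \<Rightarrow> real \<times> real \<Rightarrow> real^3" where
  "enneper n = (\<lambda>(u, v). let \<beta> = 2 * n + 1 in
     vector [(u * real \<beta> * cos v - u ^ \<beta> * cos (real \<beta> * v)) / (2 * real \<beta>),
             (- u * real \<beta> * sin v - u ^ \<beta> * sin (real \<beta> * v)) / (2 * real \<beta>),
             (u ^ (n + 1) * cos (real (n + 1) * v)) / real (n + 1)])"

definition metric :: "nat \<Rightarrow> real \<times> real \<Rightarrow> real^2^2" where
  "metric n p = (\<chi> i j. pd i (enneper n) p \<bullet> pd j (enneper n) p)"

definition unit_normal :: "nat \<Rightarrow> real \<times> real \<Rightarrow> real^3" where
  "unit_normal n p = sgn (cross3 (pd 1 (enneper n) p) (pd 2 (enneper n) p))"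

definition second_ff :: "nat \<Rightarrow> real \<times> real \<Rightarrow> real^2^2" where
  "second_ff n p = (\<chi> i j. pd i (pd j (enneper n)) p \<bullet> unit_normal n p)"

definition gauss_curvature :: "nat \<Rightarrow> real \<times> real \<Rightarrow> real" where
  "gauss_curvature n p = det (second_ff n p) / det (metric n p)"


section \<open>Second variation of area and the two indices\<close>

definition disc :: "real \<Rightarrow> (real \<times> real) set" where
  "disc R = ball (0, 0) R"

definition polar :: "real \<times> real \<Rightarrow> real \<times> real" where
  "polar = (\<lambda>(u, v). (u * cos v, u * sin v))"

text \<open>Functions on the disc are functions \<open>f\<close> of the Cartesian coordinates; \<open>f \<circ> polar\<close> is the
  corresponding \<open>2\<pi>\<close>-periodic function of \<open>(u, v)\<close>, living on the following strip.\<close>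

definition strip :: "real \<Rightarrow> (real \<times> real) set" where
  "strip R = {0<..<R} \<times> UNIV"

text \<open>The derivatives with respect to \<open>(u, v)\<close> are weak derivatives on the strip; for functions smooth
  in \<open>(u, v)\<close> they agree almost everywhere with the classical ones.\<close>

definition second_variation :: "nat \<Rightarrow> real \<Rightarrow> (real \<times> real \<Rightarrow> real) \<Rightarrow> real" where
  "second_variation n R f =
     (let \<phi> = f \<circ> polar; d\<phi> = (\<lambda>i. weak_pd i (strip R) \<phi>) in
      LINT p:{0<..<R} \<times> {0..<2 * pi}|lborel.
        ((\<Sum>i\<in>UNIV. \<Sum>j\<in>UNIV. matrix_inv (metric n p) $ i $ j * d\<phi> i p * d\<phi> j p)
          + 2 * gauss_curvature n p * (\<phi> p)\<^sup>2) * sqrt (det (metric n p)))"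

definition bounded_class :: "real \<Rightarrow> (real \<times> real \<Rightarrow> real) set" where
  "bounded_class R = {f \<in> H1 (disc R). let \<phi> = f \<circ> polar in
     smooth_on (strip R) \<phi> \<and> bounded (\<phi> ` strip R) \<and>
     (\<forall>i. bounded (pd i \<phi> ` strip R)) \<and>
     (\<forall>i j. bounded (pd i (pd j \<phi>) ` strip R))}"

definition ind_c :: "nat \<Rightarrow> real \<Rightarrow> enat" where
  "ind_c n R = neg_index (H10 (disc R)) (second_variation n R)"

definition ind_b :: "nat \<Rightarrow> real \<Rightarrow> enat" where
  "ind_b n R = neg_index (bounded_class R) (second_variation n R)"

end

theory Submission
  imports Defs
begin

text \<open>The parametrisation is conformal, so for \<open>n = 5\<close> the second variation is
  \<open>\<integral> u \<phi>\<^sub>u\<^sup>2 + \<phi>\<^sub>v\<^sup>2 / u - 200 u^9 / (1 + u^10)\<^sup>2 \<phi>\<^sup>2\<close>, which splits over the Fourier modes in \<open>v\<close>.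
  The regular radial Jacobi field of mode \<open>k \<ge> 0\<close> is \<open>u^k ((k + 5) + (k - 5) u^10) / (1 + u^10)\<close>. It has one
  positive zero if \<open>k \<le> 4\<close> and none if \<open>k \<ge> 5\<close>, and its boundary term at \<open>R\<close> is nonnegative for large \<open>R\<close>
  except for \<open>k = 5\<close>, where it is negative.

  Upper bounds: the Riccati (Picone) substitution by the logarithmic derivative of the Jacobi field shows that
  the form is nonnegative on every function whose coefficients of modes \<open>\<bar>k\<bar> \<le> 4\<close> vanish at the zero of the Jacobi
  field and whose coefficients of modes \<open>\<bar>k\<bar> = 5\<close> vanish at the boundary. These are \<open>9 + 2\<close> linear conditions,
  and the last two hold automatically for functions with compact support. Point values do not make sense on \<open>H10\<close>,
  so there they are imposed on approximating test functions and the coefficient vectors pass to the limit by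
  compactness.

  Lower bounds: on the modes \<open>u^k / (1 + u^10)\<close> with \<open>k \<le> 5\<close> the form is negative, because of the boundary term if
  \<open>k = 5\<close>, and because of a definite amount in the interior if \<open>k \<le> 4\<close>, which survives a slow cut-off.\<close>

section \<open>Calculus of smooth functions in the plane\<close>

text \<open>The Gauss map is z^5 in a stereographic coordinate, so by conformality the form is that
  of the Laplacian plus 2 on the unit sphere, pulled back by a five-fold branched cover. With s =
  u^5 and \<mu> = k/5 the Jacobi fields are the degree-one Legendre functions s^\<mu> ((\<mu> + 1) +
  (\<mu> - 1) s^2) / (1 + s^2), elementary for every \<mu>; at k = 5 this is a horizontal component
  of the normal, which makes that mode the borderline.

  The obstacle is regularity at the two ends of the radius interval: functions of the bounded class
  are controlled only through their derivatives in (u, v). All mode computations therefore take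
  place on annuli, and the ends are reached by a limit. Infinite Fourier series are avoided: the
  modes of absolute value at least 6 enter through one remainder, treated with the field of mode 6.

  The functions u^k / (1 + u^10) of the lower bounds are explicit subsolutions of the Jacobi
  equation. Times trigonometric functions they are smooth across the centre, and for k at most 4
  they decay fast enough for a cut-off in u^2 to be cheap.\<close>

lemma coord_dir_simps [simp]: "coord_dir 1 = (1, 0)" "coord_dir 2 = (0, 1)"
  by (auto simp: coord_dir_def)

lemma pd_has_derivative:
  assumes "(f has_derivative f') (at p)"
  shows "pd i f p = f' (coord_dir i)"
proof -
  have "((\<lambda>t. p + t *\<^sub>R coord_dir i) has_derivative (\<lambda>t. t *\<^sub>R coord_dir i)) (at (0::real))"
    by (auto intro!: derivative_eq_intros)
  from has_derivative_compose[OF this, of f f'] assms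
  have "((\<lambda>t. f (p + t *\<^sub>R coord_dir i)) has_derivative (\<lambda>t. f' (t *\<^sub>R coord_dir i))) (at 0)"
    by simp
  moreover have "f' (t *\<^sub>R coord_dir i) = t *\<^sub>R f' (coord_dir i)" for t
    using assms has_derivative_linear linear_cmul by blast
  ultimately show ?thesis
    unfolding pd_def
    by (intro vector_derivative_at) (simp add: has_vector_derivative_def)
qed

lemma pd_cong:
  assumes "open S" "p \<in> S" "\<And>q. q \<in> S \<Longrightarrow> f q = g q"
  shows "pd i f p = pd i g p"
proof -
  have "((\<lambda>t. p + t *\<^sub>R coord_dir i) \<longlongrightarrow> p + 0 *\<^sub>R coord_dir i) (nhds (0::real))"
    by (intro tendsto_add tendsto_scaleR tendsto_const filterlim_ident)
  then have "eventually (\<lambda>t. p + t *\<^sub>R coord_dir i \<in> S) (nhds (0::real))"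
    using assms(1,2) by (auto dest: topological_tendstoD)
  then show ?thesis unfolding pd_def
    by (intro vector_derivative_cong_eq) (auto elim!: eventually_mono simp: assms(3))
qed

lemma has_derivative_pd:
  fixes f :: "real \<times> real \<Rightarrow> 'a::real_normed_vector"
  assumes "f differentiable (at p)"
  shows "(f has_derivative (\<lambda>h. fst h *\<^sub>R pd 1 f p + snd h *\<^sub>R pd 2 f p)) (at p)"
proof -
  obtain f' where f': "(f has_derivative f') (at p)" using assms by (auto simp: differentiable_def)
  interpret linear f' using f' by (rule has_derivative_linear)
  have "f' h = fst h *\<^sub>R pd 1 f p + snd h *\<^sub>R pd 2 f p" for h
  proof -
    have "f' h = f' (fst h *\<^sub>R (1,0)) + f' (snd h *\<^sub>R (0,1))"
      by (subst add[symmetric]) (cases h, simp)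
    then show ?thesis using pd_has_derivative[OF f'] by (simp only: scale coord_dir_simps)
  qed
  then have "f' = (\<lambda>h. fst h *\<^sub>R pd 1 f p + snd h *\<^sub>R pd 2 f p)" by auto
  then show ?thesis using f' by simp
qed

lemma differentiable_cong_open:
  assumes "open S" "p \<in> S" "\<And>q. q \<in> S \<Longrightarrow> f q = g q" "f differentiable (at p)"
  shows "g differentiable (at p)"
  using assms unfolding differentiable_def
  by (meson has_derivative_transform_within_open)

section \<open>Closure of the classes C^k under algebraic operations and composition\<close>

lemma Ck_on_cong:
  assumes "open S" "\<And>q. q \<in> S \<Longrightarrow> f q = g q" "Ck_on k S f"
  shows "Ck_on k S g"
  using assms(2,3)
proof (induction k arbitrary: f g)
  case 0
  have "continuous_on S f = continuous_on S g" by (rule continuous_on_cong[OF refl 0(1)])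
  with 0(2) show ?case by simp
next
  case (Suc k)
  have *: "(\<forall>p\<in>S. f differentiable (at p)) \<and> (\<forall>i. Ck_on k S (pd i f))"
    using Suc.prems(2) by simp
  have "Ck_on k S (pd i g)" for i
  proof (rule Suc.IH)
    show "Ck_on k S (pd i f)" using * by blast
    show "pd i f q = pd i g q" if "q \<in> S" for q by (rule pd_cong[OF assms(1) that Suc.prems(1)])
  qed
  moreover have "\<forall>p\<in>S. g differentiable (at p)"
    using * differentiable_cong_open[OF assms(1), of _ f g] Suc.prems(1) by blast
  ultimately show ?case by simp
qed

lemma Ck_on_subset: "Ck_on k T f \<Longrightarrow> S \<subseteq> T \<Longrightarrow> Ck_on k S f"
  by (induction k arbitrary: f) (auto intro: continuous_on_subset)

lemma Ck_on_lower: "Ck_on (Suc k) S f \<Longrightarrow> Ck_on k S f"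
proof (induction k arbitrary: f)
  case 0
  then show ?case
    by (auto intro!: continuous_at_imp_continuous_on differentiable_imp_continuous_within)
next
  case (Suc k)
  have p: "(\<forall>p\<in>S. f differentiable (at p)) \<and> (\<forall>i. Ck_on (Suc k) S (pd i f))"
    using Suc.prems by (rule iffD1[OF Ck_on.simps(2)])
  then have "\<forall>i. Ck_on k S (pd i f)" using Suc.IH by blast
  moreover have "\<forall>p\<in>S. f differentiable (at p)" using p by blast
  ultimately show ?case by simp
qed

lemma Ck_on_le: "Ck_on k S f \<Longrightarrow> j \<le> k \<Longrightarrow> Ck_on j S f"
  by (induction k) (metis Ck_on_lower le_Suc_eq le_zero_eq)+

lemma Ck_on_continuous: "Ck_on k S f \<Longrightarrow> continuous_on S f"
  using Ck_on_le[of k S f 0] by simp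

lemma Ck_on_const: "Ck_on k S (\<lambda>_. c)"
proof (induction k arbitrary: c)
  case (Suc k)
  have "pd i (\<lambda>_. c) = (\<lambda>_. 0::real)" for i
    by (rule ext, rule pd_has_derivative[of _ "\<lambda>_. 0"]) auto
  with Suc show ?case by simp
qed simp

lemma pd_add:
  assumes "f differentiable (at p)" "g differentiable (at p)"
  shows "pd i (\<lambda>p. f p + g p) p = pd i f p + pd i g p"
proof -
  obtain f' g' where fg: "(f has_derivative f') (at p)" "(g has_derivative g') (at p)"
    using assms by (auto simp: differentiable_def)
  show ?thesis
    using pd_has_derivative[OF has_derivative_add[OF fg], of i] pd_has_derivative[OF fg(1), of i] pd_has_derivative[OF fg(2), of i]
    by simp
qed

lemma pd_mult:
  fixes f g :: "real \<times> real \<Rightarrow> real"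
  assumes "f differentiable (at p)" "g differentiable (at p)"
  shows "pd i (\<lambda>p. f p * g p) p = pd i f p * g p + f p * pd i g p"
proof -
  obtain f' g' where fg: "(f has_derivative f') (at p)" "(g has_derivative g') (at p)"
    using assms by (auto simp: differentiable_def)
  show ?thesis
    using pd_has_derivative[OF has_derivative_mult[OF fg], of i] pd_has_derivative[OF fg(1), of i] pd_has_derivative[OF fg(2), of i]
    by simp
qed

lemma pd_cmult:
  fixes f :: "real \<times> real \<Rightarrow> real"
  assumes "f differentiable (at p)"
  shows "pd i (\<lambda>p. c * f p) p = c * pd i f p"
  using pd_mult[of "\<lambda>_. c" p f i] pd_has_derivative[of "\<lambda>_. c" "\<lambda>_. 0" p i] assms by simp

lemma pd_compose_real:
  assumes "(h has_real_derivative h') (at (g p))" "g differentiable (at p)"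
  shows "pd i (\<lambda>p. h (g p)) p = h' * pd i g p"
proof -
  obtain g' where g: "(g has_derivative g') (at p)"
    using assms by (auto simp: differentiable_def)
  show ?thesis
    using pd_has_derivative[OF has_derivative_compose[OF g assms(1)[unfolded has_field_derivative_def]], of i]
      pd_has_derivative[OF g, of i] by simp
qed

lemma Ck_on_add:
  assumes "open S"
  shows "Ck_on k S f \<Longrightarrow> Ck_on k S g \<Longrightarrow> Ck_on k S (\<lambda>p. f p + g p)"
proof (induction k arbitrary: f g)
  case (Suc k)
  have "Ck_on k S (pd i (\<lambda>p. f p + g p))" for i
    by (rule Ck_on_cong[OF assms _ Suc.IH[of "pd i f" "pd i g"]]) (use Suc.prems in \<open>auto simp: pd_add\<close>)
  with Suc.prems show ?case by auto
qed (auto intro: continuous_intros)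

lemma Ck_on_mult:
  assumes "open S"
  shows "Ck_on k S f \<Longrightarrow> Ck_on k S g \<Longrightarrow> Ck_on k S (\<lambda>p. f p * g p)"
proof (induction k arbitrary: f g)
  case (Suc k)
  have "Ck_on k S (pd i (\<lambda>p. f p * g p))" for i
  proof (rule Ck_on_cong[OF assms])
    show "Ck_on k S (\<lambda>p. pd i f p * g p + f p * pd i g p)"
      using Suc.prems Ck_on_lower[OF Suc.prems(1)] Ck_on_lower[OF Suc.prems(2)]
      by (intro Ck_on_add[OF assms] Suc.IH) auto
  qed (use Suc.prems in \<open>auto simp: pd_mult\<close>)
  with Suc.prems show ?case by auto
qed (auto intro: continuous_intros)

lemma Ck_on_sum:
  assumes "open S" "\<And>j. j \<in> J \<Longrightarrow> Ck_on k S (f j)"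
  shows "Ck_on k S (\<lambda>p. \<Sum>j\<in>J. f j p)"
  using assms(2) by (induction J rule: infinite_finite_induct)
    (auto intro!: Ck_on_const Ck_on_add[OF assms(1)])

text \<open>The outer function is given as the whole sequence \<open>D\<close> of its successive
  derivatives, so the induction on \<open>k\<close> can move from \<open>D j\<close> to
  \<open>D (Suc j)\<close>. The set \<open>T\<close> restricts where these derivatives are valid,
  which covers functions such as 1/t.\<close>

lemma Ck_on_compose_real:
  assumes "open S" and D: "\<And>j t. t \<in> T \<Longrightarrow> (D j has_real_derivative D (Suc j) t) (at t)"
    and gT: "\<And>p. p \<in> S \<Longrightarrow> g p \<in> T"
  shows "Ck_on k S g \<Longrightarrow> Ck_on k S (\<lambda>p. D j (g p))"
proof (induction k arbitrary: j)
  case 0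
  have "continuous_on T (D j)"
    using D by (intro continuous_at_imp_continuous_on) (auto intro: DERIV_isCont)
  with 0 gT show ?case by (auto intro: continuous_on_compose2)
next
  case (Suc k)
  have "Ck_on k S (pd i (\<lambda>p. D j (g p)))" for i
  proof (rule Ck_on_cong[OF assms(1)])
    show "Ck_on k S (\<lambda>p. D (Suc j) (g p) * pd i g p)"
      using Suc.prems Ck_on_lower[OF Suc.prems] by (intro Ck_on_mult[OF assms(1)] Suc.IH) auto
    fix p assume "p \<in> S"
    then show "D (Suc j) (g p) * pd i g p = pd i (\<lambda>p. D j (g p)) p"
      using Suc.prems gT by (subst pd_compose_real[OF D]) auto
  qed
  moreover have "(\<lambda>p. D j (g p)) differentiable (at p)" if "p \<in> S" for p
    using has_derivative_compose[OF has_derivative_pd[of g p] D[OF gT[OF that], unfolded has_field_derivative_def]]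
      Suc.prems that by (auto simp: differentiable_def)
  ultimately show ?case by auto
qed

lemma pd_fst: "pd i (\<lambda>p. fst p) = (\<lambda>p. fst (coord_dir i))"
  by (rule ext, rule pd_has_derivative) (auto intro!: derivative_eq_intros)

lemma pd_snd: "pd i (\<lambda>p. snd p) = (\<lambda>p. snd (coord_dir i))"
  by (rule ext, rule pd_has_derivative) (auto intro!: derivative_eq_intros)

lemma smooth_on_fst: "smooth_on S (\<lambda>p. fst p)"
  unfolding smooth_on_def
proof
  show "Ck_on k S (\<lambda>p. fst p)" for k
    by (cases k) (auto intro!: continuous_intros Ck_on_const
      bounded_linear_imp_differentiable bounded_linear_fst simp: pd_fst)
qed

lemma smooth_on_snd: "smooth_on S (\<lambda>p. snd p)"
  unfolding smooth_on_def
proof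
  show "Ck_on k S (\<lambda>p. snd p)" for k
    by (cases k) (auto intro!: continuous_intros Ck_on_const
      bounded_linear_imp_differentiable bounded_linear_snd simp: pd_snd)
qed

lemma smooth_on_const: "smooth_on S (\<lambda>_. c)"
  by (simp add: smooth_on_def Ck_on_const)

lemma smooth_on_add: "open S \<Longrightarrow> smooth_on S f \<Longrightarrow> smooth_on S g \<Longrightarrow> smooth_on S (\<lambda>p. f p + g p)"
  by (simp add: smooth_on_def Ck_on_add)

lemma smooth_on_mult: "open S \<Longrightarrow> smooth_on S f \<Longrightarrow> smooth_on S g \<Longrightarrow> smooth_on S (\<lambda>p. f p * g p)"
  by (simp add: smooth_on_def Ck_on_mult)

lemma smooth_on_diff: "open S \<Longrightarrow> smooth_on S f \<Longrightarrow> smooth_on S g \<Longrightarrow> smooth_on S (\<lambda>p. f p - g p)"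
  using smooth_on_add[of S f "\<lambda>p. -1 * g p"] smooth_on_mult[of S "\<lambda>_. -1" g] by (simp add: smooth_on_const)

lemma smooth_on_sum: "open S \<Longrightarrow> (\<And>j. j \<in> J \<Longrightarrow> smooth_on S (f j)) \<Longrightarrow> smooth_on S (\<lambda>p. \<Sum>j\<in>J. f j p)"
  by (simp add: smooth_on_def Ck_on_sum)

lemma smooth_on_power: "open S \<Longrightarrow> smooth_on S f \<Longrightarrow> smooth_on S (\<lambda>p. f p ^ m)"
  by (induction m) (auto simp: smooth_on_const intro: smooth_on_mult)

lemma smooth_on_compose_real:
  assumes "open S" "\<And>j t. t \<in> T \<Longrightarrow> (D j has_real_derivative D (Suc j) t) (at t)"
    "\<And>p. p \<in> S \<Longrightarrow> g p \<in> T" "smooth_on S g"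
  shows "smooth_on S (\<lambda>p. D j (g p))"
  unfolding smooth_on_def
proof
  show "Ck_on k S (\<lambda>p. D j (g p))" for k
    by (rule Ck_on_compose_real[where D=D and T=T]) (use assms in \<open>auto simp: smooth_on_def\<close>)
qed

lemma smooth_on_pd: "smooth_on S f \<Longrightarrow> smooth_on S (pd i f)"
  unfolding smooth_on_def by (metis Ck_on.simps(2))

lemma smooth_on_subset: "smooth_on T f \<Longrightarrow> S \<subseteq> T \<Longrightarrow> smooth_on S f"
  unfolding smooth_on_def using Ck_on_subset by blast

lemma smooth_on_continuous: "smooth_on S f \<Longrightarrow> continuous_on S f"
  unfolding smooth_on_def using Ck_on_continuous by blast

lemma smooth_on_differentiable: "smooth_on S f \<Longrightarrow> p \<in> S \<Longrightarrow> f differentiable (at p)"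
  unfolding smooth_on_def by (metis Ck_on.simps(2))

text \<open>Differentiating the cosine is a shift of the argument by pi/2, which gives all
  derivatives in one formula.\<close>

lemma smooth_on_cos: "open S \<Longrightarrow> smooth_on S g \<Longrightarrow> smooth_on S (\<lambda>p. cos (g p))"
proof -
  assume *: "open S" "smooth_on S g"
  have "smooth_on S (\<lambda>p. cos (g p + real 0 * (pi/2)))"
  proof (rule smooth_on_compose_real[OF *(1) _ _ *(2), where T=UNIV and j=0
        and D="\<lambda>j t. cos (t + real j * (pi/2))"])
    fix j :: nat and t :: real
    have eq: "t + real (Suc j) * (pi/2) = (t + real j * (pi/2)) + pi/2"
      by (simp add: field_simps)
    have "cos (t + real (Suc j) * (pi/2)) = - sin (t + real j * (pi/2))"
      unfolding eq cos_add by simp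
    moreover have "((\<lambda>t. cos (t + c)) has_real_derivative - sin (t + c)) (at t)" for c
      by (auto intro!: derivative_eq_intros)
    ultimately show "((\<lambda>t. cos (t + real j * (pi/2))) has_real_derivative cos (t + real (Suc j) * (pi/2))) (at t)"
      by (simp only:)
  qed auto
  then show ?thesis by simp
qed

lemma smooth_on_sin: "open S \<Longrightarrow> smooth_on S g \<Longrightarrow> smooth_on S (\<lambda>p. sin (g p))"
proof -
  assume *: "open S" "smooth_on S g"
  have "smooth_on S (\<lambda>p. cos (g p - pi/2))"
    by (intro smooth_on_cos smooth_on_diff smooth_on_const *)
  then show ?thesis by (simp add: cos_diff)
qed

lemma smooth_on_inverse:
  assumes "open S" "smooth_on S g" "\<And>p. p \<in> S \<Longrightarrow> g p \<noteq> 0"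
  shows "smooth_on S (\<lambda>p. inverse (g p))"
proof -
  have "smooth_on S (\<lambda>p. (-1) ^ 0 * fact 0 / g p ^ Suc 0)"
  proof (rule smooth_on_compose_real[OF assms(1) _ _ assms(2), where T="-{0}" and j=0
        and D="\<lambda>j t. (-1) ^ j * fact j / t ^ Suc j"])
    fix j :: nat and t :: real assume "t \<in> -{0}"
    then have t: "t \<noteq> 0" by simp
    have "((\<lambda>t. (-1) ^ j * fact j * inverse (t ^ Suc j)) has_real_derivative
        (-1) ^ j * fact j * - (inverse (t ^ Suc j) * (real (Suc j) * t ^ j) * inverse (t ^ Suc j))) (at t)"
      using t DERIV_pow[of "Suc j" t] by (intro DERIV_cmult DERIV_inverse') auto
    moreover have "(-1) ^ j * fact j * - (inverse (t ^ Suc j) * (real (Suc j) * t ^ j) * inverse (t ^ Suc j)) =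
        (-1) ^ Suc j * fact (Suc j) / t ^ Suc (Suc j)"
      using t by (simp add: divide_simps)
    ultimately show "((\<lambda>t. (-1) ^ j * fact j / t ^ Suc j) has_real_derivative (-1) ^ Suc j * fact (Suc j) / t ^ Suc (Suc j)) (at t)"
      by (simp only: divide_inverse)
  qed (use assms in auto)
  then show ?thesis by (simp add: inverse_eq_divide)
qed

section \<open>A smooth bump on the line\<close>

definition bump :: "real \<Rightarrow> real" where
  "bump t = (if t > 0 then exp (- (1 / t)) else 0)"

lemma bump_nonneg [simp]: "0 \<le> bump t" and bump_le_1 [simp]: "bump t \<le> 1"
  and bump_pos: "0 < t \<Longrightarrow> 0 < bump t" and bump_0: "t \<le> 0 \<Longrightarrow> bump t = 0"
  by (auto simp: bump_def)

text \<open>With s = 1/t the derivative in t of P(s) exp(-s) is s^2 (P(s) - P'(s)) exp(-s); the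
  recursion records the polynomial factor.\<close>

primrec bump_poly :: "nat \<Rightarrow> real poly" where
  "bump_poly 0 = 1"
| "bump_poly (Suc j) = [:0, 0, 1:] * (bump_poly j - pderiv (bump_poly j))"

definition bump_deriv :: "nat \<Rightarrow> real \<Rightarrow> real" where
  "bump_deriv j t = (if t > 0 then poly (bump_poly j) (1 / t) * exp (- (1 / t)) else 0)"

lemma poly_times_exp_tendsto_0: "((\<lambda>s. poly p s * exp (- s)) \<longlongrightarrow> (0::real)) at_top"
proof -
  have "((\<lambda>s. \<Sum>i\<le>degree p. coeff p i * (s ^ i / exp s)) \<longlongrightarrow> (\<Sum>i\<le>degree p. coeff p i * 0)) at_top"
    by (intro tendsto_intros tendsto_power_div_exp_0)
  moreover have "poly p s * exp (- s) = (\<Sum>i\<le>degree p. coeff p i * (s ^ i / exp s))" for s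
    by (simp add: poly_altdef exp_minus divide_inverse sum_distrib_right mult.assoc)
  ultimately show ?thesis by simp
qed

text \<open>Away from 0 this is the chain rule. At 0 the left difference quotient vanishes, and the
  right one is a polynomial in 1/h times exp(-1/h), which tends to 0.\<close>

lemma bump_deriv_has_derivative:
  "(bump_deriv j has_real_derivative bump_deriv (Suc j) t) (at t)"
proof -
  consider "t > 0" | "t < 0" | "t = 0" by linarith
  then show ?thesis
  proof cases
    case 1
    let ?P = "bump_poly j"
    have i: "((\<lambda>t. 1 / t) has_real_derivative - (1 / t\<^sup>2)) (at t)"
      using 1 by (auto intro!: derivative_eq_intros simp: power2_eq_square)
    have p: "((\<lambda>t. poly ?P (1 / t)) has_real_derivative poly (pderiv ?P) (1 / t) * - (1 / t\<^sup>2)) (at t)"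
      by (rule DERIV_chain2[OF poly_DERIV i])
    have e: "((\<lambda>t. exp (- (1 / t))) has_real_derivative exp (- (1 / t)) * - (- (1 / t\<^sup>2))) (at t)"
      by (rule DERIV_chain2[OF DERIV_exp DERIV_minus[OF i]])
    have "poly (bump_poly (Suc j)) (1 / t) = (1 / t\<^sup>2) * (poly ?P (1 / t) - poly (pderiv ?P) (1 / t))"
      by (simp add: power2_eq_square algebra_simps)
    then have "poly (pderiv ?P) (1 / t) * - (1 / t\<^sup>2) * exp (- (1 / t))
        + exp (- (1 / t)) * - (- (1 / t\<^sup>2)) * poly ?P (1 / t) = bump_deriv (Suc j) t"
      unfolding bump_deriv_def using 1 by (simp only: if_True) (simp add: algebra_simps)
    then have "((\<lambda>t. poly ?P (1 / t) * exp (- (1 / t))) has_real_derivative bump_deriv (Suc j) t) (at t)"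
      using DERIV_mult[OF p e] by simp
    then show ?thesis
      by (rule has_field_derivative_transform_within_open[where S="{0<..}"])
         (use 1 in \<open>auto simp: bump_deriv_def\<close>)
  next
    case 2
    have "((\<lambda>t. 0) has_real_derivative bump_deriv (Suc j) t) (at t)"
      using 2 by (auto simp: bump_deriv_def)
    then show ?thesis
      by (rule has_field_derivative_transform_within_open[where S="{..<0}"])
         (use 2 in \<open>auto simp: bump_deriv_def\<close>)
  next
    case 3
    \<comment> \<open>Division by \<open>h\<close> multiplies the polynomial in 1/h by its variable,
      hence \<open>pCons 0\<close>.\<close>
    have "((\<lambda>h. poly (pCons 0 (bump_poly j)) (inverse h) * exp (- inverse h)) \<longlongrightarrow> 0) (at_right 0)"
      by (rule filterlim_compose[OF poly_times_exp_tendsto_0 filterlim_inverse_at_top_right])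
    then have "((\<lambda>h. bump_deriv j h / h) \<longlongrightarrow> 0) (at_right 0)"
      by (rule Lim_transform_eventually)
        (auto simp: eventually_at_filter bump_deriv_def field_simps)
    moreover have "((\<lambda>h. bump_deriv j h / h) \<longlongrightarrow> 0) (at_left 0)"
      by (rule tendsto_eventually) (auto simp: eventually_at_filter bump_deriv_def)
    ultimately have "((\<lambda>h. bump_deriv j h / h) \<longlongrightarrow> 0) (at 0)"
      by (simp add: filterlim_split_at)
    then show ?thesis using 3 by (simp add: DERIV_def bump_deriv_def)
  qed
qed

lemma bump_eq: "bump = bump_deriv 0"
  by (auto simp: bump_def bump_deriv_def)

lemma smooth_on_bump:
  assumes "open S" "smooth_on S g"
  shows "smooth_on S (\<lambda>p. bump (g p))"
  unfolding bump_eq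
  by (rule smooth_on_compose_real[where D=bump_deriv and T=UNIV])
     (use assms bump_deriv_has_derivative in auto)

section \<open>The chain rule in polar coordinates\<close>

lemma has_derivative_polar:
  "(polar has_derivative (\<lambda>h. (fst h * cos (snd p) - snd h * (fst p * sin (snd p)),
      fst h * sin (snd p) + snd h * (fst p * cos (snd p))))) (at p)"
  unfolding polar_def case_prod_beta
  by (auto intro!: derivative_eq_intros simp: algebra_simps)

lemma pd_polar:
  assumes "f differentiable (at (polar p))"
  shows "pd 1 (f \<circ> polar) p = cos (snd p) *\<^sub>R pd 1 f (polar p) + sin (snd p) *\<^sub>R pd 2 f (polar p)"
    and "pd 2 (f \<circ> polar) p = fst p *\<^sub>R (cos (snd p) *\<^sub>R pd 2 f (polar p) - sin (snd p) *\<^sub>R pd 1 f (polar p))"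
    and "(f \<circ> polar) differentiable (at p)"
proof -
  note d = diff_chain_at[OF has_derivative_polar[of p] has_derivative_pd[OF assms]]
  show "pd 1 (f \<circ> polar) p = cos (snd p) *\<^sub>R pd 1 f (polar p) + sin (snd p) *\<^sub>R pd 2 f (polar p)"
    "pd 2 (f \<circ> polar) p = fst p *\<^sub>R (cos (snd p) *\<^sub>R pd 2 f (polar p) - sin (snd p) *\<^sub>R pd 1 f (polar p))"
    by (simp_all add: pd_has_derivative[OF d] algebra_simps)
  show "(f \<circ> polar) differentiable (at p)" using d by (auto simp: differentiable_def)
qed

text \<open>By \<open>pd_polar\<close> the derivatives of \<open>f \<circ> polar\<close> are
  combinations, with smooth coefficients, of \<open>pd i f \<circ> polar\<close>, to which the
  induction hypothesis applies.\<close>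

lemma Ck_on_polar:
  assumes "open S" "polar ` T \<subseteq> S" "open T"
  shows "Ck_on k S f \<Longrightarrow> Ck_on k T (f \<circ> polar)"
proof (induction k arbitrary: f)
  case 0
  have "continuous_on T polar" unfolding polar_def case_prod_beta by (intro continuous_intros)
  then show ?case using continuous_on_compose2[of S f T polar] 0 assms(2)
    by (simp add: comp_def)
next
  case (Suc k)
  have s: "Ck_on k T (\<lambda>p. cos (snd p))" "Ck_on k T (\<lambda>p. sin (snd p))"
    "Ck_on k T (\<lambda>p. fst p)"
    using smooth_on_cos[OF assms(3) smooth_on_snd] smooth_on_sin[OF assms(3) smooth_on_snd]
      smooth_on_fst[of T] by (auto simp: smooth_on_def)
  have I: "Ck_on k T (pd i f \<circ> polar)" for i
    by (rule Suc.IH) (use Suc.prems in simp)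
  note m = Ck_on_mult[OF assms(3)]
  have d: "f differentiable (at (polar p))" if "p \<in> T" for p
    using Suc.prems assms(2) that by auto
  have "Ck_on k T (\<lambda>p. cos (snd p) * (pd 1 f \<circ> polar) p + sin (snd p) * (pd 2 f \<circ> polar) p)"
    by (intro Ck_on_add[OF assms(3)] m I s)
  then have 1: "Ck_on k T (pd 1 (f \<circ> polar))"
    by (rule Ck_on_cong[OF assms(3), rotated]) (use d in \<open>auto simp: pd_polar(1)\<close>)
  have "Ck_on k T (\<lambda>p. fst p * (cos (snd p) * (pd 2 f \<circ> polar) p + (-1) * (sin (snd p) * (pd 1 f \<circ> polar) p)))"
    by (intro Ck_on_add[OF assms(3)] m I s Ck_on_const)
  then have 2: "Ck_on k T (pd 2 (f \<circ> polar))"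
    by (rule Ck_on_cong[OF assms(3), rotated]) (use d in \<open>auto simp: pd_polar(2)\<close>)
  show ?case unfolding Ck_on.simps forall_2 using 1 2 d pd_polar(3) by blast
qed

lemma smooth_on_polar: "smooth_on S f \<Longrightarrow> open S \<Longrightarrow> polar ` T \<subseteq> S \<Longrightarrow> open T \<Longrightarrow> smooth_on T (f \<circ> polar)"
  by (simp add: smooth_on_def Ck_on_polar)

section \<open>Weak derivatives\<close>

lemma test_fun_compact_support:
  assumes "\<psi> \<in> test_fun S"
  obtains K where "compact K" "K \<subseteq> S" "\<And>p. p \<notin> K \<Longrightarrow> \<psi> p = 0" "\<And>p i. p \<notin> K \<Longrightarrow> pd i \<psi> p = 0"
proof
  let ?K = "closure {p. \<psi> p \<noteq> 0}"
  show "compact ?K" "?K \<subseteq> S" using assms unfolding test_fun_def by blast+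
  show z: "\<psi> p = 0" if "p \<notin> ?K" for p using that closure_subset[of "{p. \<psi> p \<noteq> 0}"] by auto
  show "pd i \<psi> p = 0" if "p \<notin> ?K" for p i
  proof -
    have "open (- ?K)" "p \<in> - ?K" "\<And>q. q \<in> - ?K \<Longrightarrow> \<psi> q = 0"
      using that z by blast+
    then have "pd i \<psi> p = pd i (\<lambda>_. 0::real) p" by (rule pd_cong)
    then show ?thesis using pd_has_derivative[of "\<lambda>_. 0::real" "\<lambda>_. 0" p i] by simp
  qed
qed

lemma test_fun_smooth: "\<psi> \<in> test_fun S \<Longrightarrow> smooth_on UNIV \<psi>"
  by (simp add: test_fun_def)

lemma test_fun_continuous: "\<psi> \<in> test_fun S \<Longrightarrow> continuous_on UNIV \<psi>"
  and test_fun_pd_continuous: "\<psi> \<in> test_fun S \<Longrightarrow> continuous_on UNIV (pd i \<psi>)"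
  by (simp_all add: test_fun_smooth smooth_on_continuous smooth_on_pd)

lemma set_integrable_compact_support:
  fixes g :: "real \<times> real \<Rightarrow> real"
  assumes "compact K" "K \<subseteq> S" "continuous_on K g" "\<And>p. p \<in> S \<Longrightarrow> p \<notin> K \<Longrightarrow> g p = 0"
  shows "set_integrable lborel S g"
proof -
  have "integrable lborel (\<lambda>x. indicator K x *\<^sub>R g x)"
    by (rule borel_integrable_compact) (use assms in auto)
  moreover have "(\<lambda>x. indicator K x *\<^sub>R g x) = (\<lambda>x. indicator S x *\<^sub>R g x)"
    using assms by (auto simp: indicator_def fun_eq_iff)
  ultimately show ?thesis by (simp add: set_integrable_def)
qed

lemma locally_integrable_mult:
  assumes "locally_integrable S g" "compact K" "K \<subseteq> S" "continuous_on UNIV \<psi>" "\<And>p. p \<notin> K \<Longrightarrow> \<psi> p = 0"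
  shows "set_integrable lborel S (\<lambda>p. g p * \<psi> p)"
proof -
  have K: "set_integrable lborel K g" using assms by (auto simp: locally_integrable_def)
  obtain B where B: "\<And>p. p \<in> K \<Longrightarrow> \<bar>\<psi> p\<bar> \<le> B"
    using compact_imp_bounded[OF compact_continuous_image[OF continuous_on_subset[OF assms(4)] assms(2)]]
    by (auto simp: bounded_iff)
  have "(\<lambda>p. indicator S p *\<^sub>R (g p * \<psi> p)) = (\<lambda>p. (indicator K p *\<^sub>R g p) * \<psi> p)"
    using assms(3,5) by (auto simp: indicator_def fun_eq_iff)
  moreover have "integrable lborel (\<lambda>p. (indicator K p *\<^sub>R g p) * \<psi> p)"
  proof (rule Bochner_Integration.integrable_bound)
    show "integrable lborel (\<lambda>p. B * (indicator K p *\<^sub>R g p))"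
      using K by (simp add: set_integrable_def)
    show "(\<lambda>p. (indicator K p *\<^sub>R g p) * \<psi> p) \<in> borel_measurable lborel"
      using K borel_measurable_continuous_onI[OF assms(4)] by (auto simp: set_integrable_def)
    show "AE p in lborel. norm (indicator K p *\<^sub>R g p * \<psi> p) \<le> norm (B * (indicator K p *\<^sub>R g p))"
    proof (rule AE_I2)
      fix p
      show "norm (indicator K p *\<^sub>R g p * \<psi> p) \<le> norm (B * (indicator K p *\<^sub>R g p))"
      proof (cases "p \<in> K")
        case True
        then have "\<bar>\<psi> p\<bar> \<le> \<bar>B\<bar>" using B[of p] by linarith
        then show ?thesis using mult_left_mono[of "\<bar>\<psi> p\<bar>" "\<bar>B\<bar>" "\<bar>g p\<bar>"] True by (simp add: abs_mult mult.commute)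
      qed simp
    qed
  qed
  ultimately show ?thesis by (simp add: set_integrable_def)
qed

lemma locally_integrable_test_fun:
  assumes "locally_integrable S g" "\<psi> \<in> test_fun S"
  shows "set_integrable lborel S (\<lambda>p. g p * \<psi> p)" "set_integrable lborel S (\<lambda>p. g p * pd i \<psi> p)"
proof -
  obtain K where K: "compact K" "K \<subseteq> S" "\<And>p. p \<notin> K \<Longrightarrow> \<psi> p = 0" "\<And>p i. p \<notin> K \<Longrightarrow> pd i \<psi> p = 0"
    using test_fun_compact_support[OF assms(2)] by metis
  show "set_integrable lborel S (\<lambda>p. g p * \<psi> p)"
    by (rule locally_integrable_mult[OF assms(1) K(1,2) test_fun_continuous[OF assms(2)] K(3)])
  show "set_integrable lborel S (\<lambda>p. g p * pd i \<psi> p)"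
    by (rule locally_integrable_mult[OF assms(1) K(1,2) test_fun_pd_continuous[OF assms(2)] K(4)])
qed

section \<open>Test functions on boxes and the fundamental lemma of the calculus of
  variations\<close>

definition box_bump :: "nat \<Rightarrow> real \<times> real \<Rightarrow> real \<times> real \<Rightarrow> real \<times> real \<Rightarrow> real" where
  "box_bump n a b p = (bump (real n * (fst p - fst a)) * bump (real n * (fst b - fst p))) *
     (bump (real n * (snd p - snd a)) * bump (real n * (snd b - snd p)))"

lemma box_bump_bounds: "0 \<le> box_bump n a b p" "box_bump n a b p \<le> 1"
  unfolding box_bump_def by (auto intro!: mult_nonneg_nonneg mult_le_one)

lemma smooth_box_bump: "smooth_on UNIV (box_bump n a b)"
proof -
  have "smooth_on UNIV (\<lambda>p. box_bump n a b p)"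
    unfolding box_bump_def
    by (intro smooth_on_mult smooth_on_bump smooth_on_diff smooth_on_const smooth_on_fst smooth_on_snd open_UNIV)
  then show ?thesis by simp
qed

lemma mem_box_prod: "(p :: real \<times> real) \<in> box a b \<longleftrightarrow> fst a < fst p \<and> fst p < fst b \<and> snd a < snd p \<and> snd p < snd b"
  by (auto simp: box_def Basis_prod_def inner_prod_def)

lemma mem_cbox_prod: "(p :: real \<times> real) \<in> cbox a b \<longleftrightarrow> fst a \<le> fst p \<and> fst p \<le> fst b \<and> snd a \<le> snd p \<and> snd p \<le> snd b"
  by (auto simp: cbox_def Basis_prod_def inner_prod_def)

lemma box_bump_zero: "p \<notin> box a b \<Longrightarrow> box_bump n a b p = 0"
  unfolding mem_box_prod box_bump_def
  by (auto simp: not_less mult_nonneg_nonpos intro!: bump_0)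

lemma box_bump_test_fun:
  assumes "cbox a b \<subseteq> S"
  shows "box_bump n a b \<in> test_fun S"
proof -
  have "{p. box_bump n a b p \<noteq> 0} \<subseteq> cbox a b"
    using box_bump_zero box_subset_cbox by blast
  then have c: "closure {p. box_bump n a b p \<noteq> 0} \<subseteq> cbox a b"
    by (intro closure_minimal closed_cbox)
  moreover have "compact (closure {p. box_bump n a b p \<noteq> 0})"
    using c compact_Int_closed[OF compact_cbox[of a b], of "closure {p. box_bump n a b p \<noteq> 0}"]
    by (simp add: Int_absorb1)
  ultimately show ?thesis using assms by (auto simp: test_fun_def smooth_box_bump)
qed

lemma bump_scaled_tendsto: "0 < x \<Longrightarrow> (\<lambda>n. bump (real n * x)) \<longlonglongrightarrow> 1"
proof -
  assume x: "0 < x"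
  have "filterlim (\<lambda>n. real n * x) at_top sequentially"
    using x by (intro filterlim_at_top_mult_tendsto_pos[OF tendsto_const] filterlim_real_sequentially)
  then have "(\<lambda>n. exp (- (1 / (real n * x)))) \<longlonglongrightarrow> exp (- 0)"
    by (intro tendsto_exp tendsto_minus tendsto_divide_0[OF tendsto_const] filterlim_at_top_imp_at_infinity)
  then show "(\<lambda>n. bump (real n * x)) \<longlonglongrightarrow> 1"
    unfolding minus_zero exp_zero
    by (rule Lim_transform_eventually)
      (use x in \<open>auto simp: bump_def eventually_sequentially intro!: exI[of _ 1]\<close>)
qed

lemma box_bump_tendsto: "(\<lambda>n. box_bump n a b p) \<longlonglongrightarrow> indicator (box a b) p"
proof (cases "p \<in> box a b")
  case True
  have "(\<lambda>n. box_bump n a b p) \<longlonglongrightarrow> (1 * 1) * (1 * 1)"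
    unfolding box_bump_def
    by (intro tendsto_mult bump_scaled_tendsto) (use True in \<open>auto simp: mem_box_prod\<close>)
  then show ?thesis using True by simp
qed (simp add: box_bump_zero)

text \<open>Boxes form an intersection-stable generator of the Borel sets, so Dynkin induction
  carries the vanishing of the integral to every Borel set; \<open>tot\<close> is what the
  complement step uses.\<close>

lemma integral_zero_all_boxes_imp_AE_zero:
  fixes h :: "'a::euclidean_space \<Rightarrow> real"
  assumes int: "integrable lborel h"
    and tot: "integral\<^sup>L lborel h = 0"
    and box: "\<And>c d. (LINT p:box c d|lborel. h p) = 0"
  shows "AE p in lborel. h p = 0"
proof (rule density_unique_real)
  show "integrable lborel h" "integrable lborel (\<lambda>_::'a. 0::real)" using int by auto
  have si: "set_integrable lborel A h" if "A \<in> sets borel" for A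
    using that int unfolding set_integrable_def by (intro integrable_mult_indicator) auto
  have "(LINT p:A|lborel. h p) = 0" if "A \<in> sets borel" for A
  proof -
    have "Int_stable (range (\<lambda>(a, b). box a b :: 'a set))"
      by (auto simp: Int_stable_def box_Int_box)
    moreover have "range (\<lambda>(a, b). box a b :: 'a set) \<subseteq> Pow UNIV" by simp
    moreover have "A \<in> sigma_sets UNIV (range (\<lambda>(a, b). box a b :: 'a set))"
      using that by (simp add: borel_eq_box)
    ultimately show ?thesis
    proof (induction rule: sigma_sets_induct_disjoint)
      case (basic A)
      then show ?case using box by auto
    next
      case empty
      then show ?case by (simp add: set_lebesgue_integral_def)
    next
      case (compl A)
      then have A: "A \<in> sets borel" by (simp add: borel_eq_box)
      have "(LINT p:UNIV|lborel. h p) = (LINT p:A|lborel. h p) + (LINT p:(UNIV - A)|lborel. h p)"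
        using set_integral_Un[of A "UNIV - A" lborel h] si A by (simp add: Un_absorb1)
      then show ?case using compl tot by (simp add: set_lebesgue_integral_def)
    next
      case (union A)
      then have A: "A i \<in> sets borel" for i by (auto simp: borel_eq_box)
      have "(LINT p:(\<Union>i. A i)|lborel. h p) = (\<Sum>i. LINT p:A i|lborel. h p)"
        by (rule lebesgue_integral_countable_add)
          (use A union(1) si in \<open>auto simp: disjoint_family_on_def\<close>)
      then show ?case using union by simp
    qed
  qed
  then show "\<And>A. A \<in> sets lborel \<Longrightarrow> (LINT p:A|lborel. h p) = (LINT p:A|lborel. 0)"
    by (simp add: set_lebesgue_integral_def)
qed

text \<open>The functions \<open>box_bump n\<close> are test functions with values in [0, 1] that
  converge to the indicator of the open box, so dominated convergence gives integral zero over every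
  box whose closure lies in \<open>S\<close>. Hence \<open>g\<close> vanishes almost everywhere on
  each such box, and countably many closed boxes, whose boundaries are null sets, cover
  \<open>S\<close>.\<close>

lemma fundamental_lemma_of_variations:
  assumes "open S" and g: "locally_integrable S g"
    and z: "\<And>\<psi>. \<psi> \<in> test_fun S \<Longrightarrow> (LINT p:S|lborel. g p * \<psi> p) = 0"
  shows "AE p in lborel. p \<in> S \<longrightarrow> g p = 0"
proof -
  have box0: "(LINT p:box e f|lborel. g p) = 0" if ef: "cbox e f \<subseteq> S" for e f
  proof -
    have K: "set_integrable lborel (cbox e f) g" using g ef by (auto simp: locally_integrable_def)
    have "(\<lambda>n. LINT p|lborel. (indicator (cbox e f) p *\<^sub>R g p) * box_bump n e f p)
        \<longlonglongrightarrow> (LINT p|lborel. (indicator (cbox e f) p *\<^sub>R g p) * indicator (box e f) p)"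
    proof (rule integral_dominated_convergence[where w="\<lambda>p. norm (indicator (cbox e f) p *\<^sub>R g p)"])
      have bm: "box_bump n e f \<in> borel_measurable borel" for n
        by (intro borel_measurable_continuous_onI smooth_on_continuous smooth_box_bump)
      show "(\<lambda>p. (indicator (cbox e f) p *\<^sub>R g p) * indicator (box e f) p) \<in> borel_measurable lborel"
        "(\<lambda>p. (indicator (cbox e f) p *\<^sub>R g p) * box_bump n e f p) \<in> borel_measurable lborel" for n
        using K bm by (auto simp: set_integrable_def intro!: borel_measurable_times)
      show "integrable lborel (\<lambda>p. norm (indicator (cbox e f) p *\<^sub>R g p))"
        using K unfolding set_integrable_def by (rule integrable_norm)
      show "AE x in lborel. (\<lambda>n. indicator (cbox e f) x *\<^sub>R g x * box_bump n e f x)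
          \<longlonglongrightarrow> indicator (cbox e f) x *\<^sub>R g x * indicator (box e f) x"
        by (intro AE_I2 tendsto_mult tendsto_const box_bump_tendsto)
      show "AE x in lborel. norm (indicator (cbox e f) x *\<^sub>R g x * box_bump n e f x)
          \<le> norm (indicator (cbox e f) x *\<^sub>R g x)" for n
        using box_bump_bounds[of n e f] by (intro AE_I2) (auto simp: abs_mult intro!: mult_left_le)
    qed
    moreover have "(LINT p|lborel. (indicator (cbox e f) p *\<^sub>R g p) * box_bump n e f p) = 0" for n
    proof -
      have "(\<lambda>p. (indicator (cbox e f) p *\<^sub>R g p) * box_bump n e f p) = (\<lambda>p. indicator S p *\<^sub>R (g p * box_bump n e f p))"
        using ef box_bump_zero[of _ e f n] box_subset_cbox[of e f]
        by (auto simp: fun_eq_iff indicator_def)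
      then show ?thesis using z[OF box_bump_test_fun[OF ef]] by (simp add: set_lebesgue_integral_def)
    qed
    ultimately have "(LINT p|lborel. (indicator (cbox e f) p *\<^sub>R g p) * indicator (box e f) p) = 0"
      by (simp add: LIMSEQ_const_iff)
    moreover have "(\<lambda>p. (indicator (cbox e f) p *\<^sub>R g p) * indicator (box e f) p) = (\<lambda>p. indicator (box e f) p *\<^sub>R g p)"
      using box_subset_cbox[of e f] by (auto simp: fun_eq_iff indicator_def)
    ultimately show ?thesis by (simp add: set_lebesgue_integral_def)
  qed
  have cell: "AE p in lborel. p \<in> box a b \<longrightarrow> g p = 0" if ab: "cbox a b \<subseteq> S" for a b
  proof -
    have K: "set_integrable lborel (cbox a b) g" using g ab by (auto simp: locally_integrable_def)
    have "AE p in lborel. indicator (box a b) p *\<^sub>R g p = 0"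
    proof (rule integral_zero_all_boxes_imp_AE_zero)
      show "integrable lborel (\<lambda>p. indicator (box a b) p *\<^sub>R g p)"
        using set_integrable_subset[OF K, of "box a b"] box_subset_cbox[of a b]
        by (simp add: set_integrable_def)
      show "(LINT p|lborel. indicator (box a b) p *\<^sub>R g p) = 0"
        using box0[OF ab] by (simp add: set_lebesgue_integral_def)
      fix c d :: "real \<times> real"
      have "\<exists>e f. box c d \<inter> box a b = box e f" unfolding box_Int_box by blast
      then obtain e f where ef: "box c d \<inter> box a b = box e f" by blast
      have "(LINT p:box c d|lborel. indicator (box a b) p *\<^sub>R g p) = (LINT p:box e f|lborel. g p)"
        unfolding ef[symmetric] set_lebesgue_integral_def
        by (intro Bochner_Integration.integral_cong) (auto simp: indicator_def)
      also have "\<dots> = 0"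
      \<comment> \<open>The inclusion of the closed boxes comes from taking closures, which says
        nothing when the open box is empty; in that case the integral is trivially zero.\<close>
      proof (cases "box e f = {}")
        case False
        then have "box e f \<subseteq> box a b" using ef by auto
        then have "cbox e f \<subseteq> cbox a b" using False
          by (metis box_subset_cbox closure_box closure_minimal closed_cbox order_trans)
        then show ?thesis using box0 ab by blast
      qed (simp add: set_lebesgue_integral_def)
      finally show "(LINT p:box c d|lborel. indicator (box a b) p *\<^sub>R g p) = 0" .
    qed
    then show ?thesis by (rule AE_mp) (auto simp: indicator_def)
  qed
  obtain D where D: "countable D" "D \<subseteq> Pow S" "\<And>X. X \<in> D \<Longrightarrow> \<exists>a b. X = cbox a b" "\<Union>D = S"
    using open_countable_Union_open_cbox[OF \<open>open S\<close>] by metis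
  have "AE p in lborel. p \<in> X \<longrightarrow> g p = 0" if X: "X \<in> D" for X
  proof -
    obtain a b where ab: "X = cbox a b" using D X by blast
    have "negligible (cbox a b - box a b)" by (rule negligible_frontier_interval)
    then have "AE p in lebesgue. p \<notin> cbox a b - box a b"
      unfolding negligible_iff_null_sets by (rule AE_not_in)
    then have "AE p in lborel. p \<notin> cbox a b - box a b"
      by (simp add: AE_completion_iff)
    moreover have "AE p in lborel. p \<in> box a b \<longrightarrow> g p = 0" using cell D X ab by blast
    ultimately show ?thesis by eventually_elim (auto simp: ab)
  qed
  then have "AE p in lborel. \<forall>X\<in>D. p \<in> X \<longrightarrow> g p = 0"
    using D(1) by (subst AE_ball_countable) auto
  then show ?thesis by (rule AE_mp) (use D(4) in auto)
qed

lemma is_weak_pd_unique: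
  assumes "open S" "is_weak_pd i S f g" "is_weak_pd i S f h"
  shows "AE p in lborel. p \<in> S \<longrightarrow> g p = h p"
proof -
  have gh: "locally_integrable S g" "locally_integrable S h" using assms by (auto simp: is_weak_pd_def)
  have "AE p in lborel. p \<in> S \<longrightarrow> g p - h p = 0"
  proof (rule fundamental_lemma_of_variations[OF assms(1)])
    show "locally_integrable S (\<lambda>p. g p - h p)"
      using gh unfolding locally_integrable_def by (auto intro: set_integral_diff)
    fix \<psi> assume "\<psi> \<in> test_fun S"
    then show "(LINT p:S|lborel. (g p - h p) * \<psi> p) = 0"
      using assms(2,3) locally_integrable_test_fun(1)[OF gh(1), of \<psi>] locally_integrable_test_fun(1)[OF gh(2), of \<psi>]
      by (auto simp: is_weak_pd_def left_diff_distrib set_integral_diff)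
  qed
  then show ?thesis by simp
qed

text \<open>\<open>weak_pd\<close> is a choice; this allows any known weak derivative to take its
  place under an integral.\<close>

lemma weak_pd_AE:
  assumes "open S" "is_weak_pd i S f g"
  shows "AE p in lborel. p \<in> S \<longrightarrow> weak_pd i S f p = g p"
proof -
  have "is_weak_pd i S f (weak_pd i S f)" unfolding weak_pd_def by (rule someI[of "is_weak_pd i S f", OF assms(2)])
  then show ?thesis using is_weak_pd_unique assms by blast
qed

text \<open>Fubini with the inner integral in the direction of differentiation: there the
  fundamental theorem of calculus leaves only values outside the support.\<close>

lemma integral_pd_zero:
  fixes h :: "real \<times> real \<Rightarrow> real"
  assumes h: "Ck_on 1 UNIV h" and M: "\<And>p. p \<notin> cbox (-M, -M) (M, M) \<Longrightarrow> h p = 0"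
  shows "integrable lborel (pd i h)" "(LINT p|lborel. pd i h p) = 0"
proof -
  have d: "h differentiable (at p)" and c: "continuous_on UNIV (pd i h)" for p i
    using h by (simp_all del: split_paired_All)
  have z: "pd i h p = 0" if "p \<notin> cbox (-M, -M) (M, M)" for p i
  proof -
    have "pd i h p = pd i (\<lambda>_. 0::real) p"
      by (rule pd_cong[of "- cbox (-M, -M) (M, M)"]) (use that M in auto)
    then show ?thesis using pd_has_derivative[of "\<lambda>_. 0::real" "\<lambda>_. 0" p i] by simp
  qed
  have int: "integrable lborel (pd i h)" for i
  proof -
    have "set_integrable lborel UNIV (pd i h)"
      by (rule set_integrable_compact_support[OF compact_cbox subset_UNIV continuous_on_subset[OF c subset_UNIV]])
        (rule z)
    then show ?thesis by (simp add: set_integrable_def)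
  qed
  then show "integrable lborel (pd i h)" .
  \<comment> \<open>The extra 1 puts both endpoints strictly outside the box that carries
    \<open>h\<close>, whatever the sign of \<open>M\<close>.\<close>
  let ?a = "- \<bar>M\<bar> - 1" and ?b = "\<bar>M\<bar> + 1"
  have x0: "(LINT x|lborel. pd 1 h (x, y)) = 0" for y
  proof -
    have "((\<lambda>x. h (x, y)) has_real_derivative pd 1 h (x, y)) (at x)" for x
    proof -
      have "((\<lambda>x. (x, y)) has_derivative (\<lambda>t. (t, 0))) (at x)"
        by (intro has_derivative_Pair has_derivative_ident has_derivative_const)
      from has_derivative_compose[OF this has_derivative_pd[OF d]] show ?thesis
        by (simp add: has_field_derivative_def mult.commute[of _ "pd 1 h _"])
    qed
    moreover have "isCont (\<lambda>x. pd 1 h (x, y)) x" for x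
      using continuous_on_compose2[OF c[of 1], of UNIV "\<lambda>x. (x, y)"]
      by (auto simp: continuous_on_eq_continuous_at intro!: continuous_intros)
    ultimately have "has_bochner_integral lborel (\<lambda>x. pd 1 h (x, y) * indicator {?a..?b} x) (h (?b, y) - h (?a, y))"
      by (intro has_bochner_integral_FTC_Icc_real) auto
    moreover have "(\<lambda>x. pd 1 h (x, y) * indicator {?a..?b} x) = (\<lambda>x. pd 1 h (x, y))"
    proof
      fix x
      have "(x, y) \<notin> cbox (-M, -M) (M, M)" if "x \<notin> {?a..?b}"
        using that by (auto simp: mem_cbox_prod)
      then show "pd 1 h (x, y) * indicator {?a..?b} x = pd 1 h (x, y)"
        using z[of "(x, y)" 1] by (cases "x \<in> {?a..?b}") auto
    qed
    moreover have "(?b, y) \<notin> cbox (-M, -M) (M, M)" "(?a, y) \<notin> cbox (-M, -M) (M, M)"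
      by (auto simp: mem_cbox_prod)
    then have "h (?b, y) = 0" "h (?a, y) = 0" using M by blast+
    ultimately show ?thesis by (simp add: has_bochner_integral_integral_eq)
  qed
  have y0: "(LINT y|lborel. pd 2 h (x, y)) = 0" for x
  proof -
    have "((\<lambda>y. h (x, y)) has_real_derivative pd 2 h (x, y)) (at y)" for y
    proof -
      have "((\<lambda>y. (x, y)) has_derivative (\<lambda>t. (0, t))) (at y)"
        by (intro has_derivative_Pair has_derivative_ident has_derivative_const)
      from has_derivative_compose[OF this has_derivative_pd[OF d]] show ?thesis
        by (simp add: has_field_derivative_def mult.commute[of _ "pd 2 h _"])
    qed
    moreover have "isCont (\<lambda>y. pd 2 h (x, y)) y" for y
      using continuous_on_compose2[OF c[of 2], of UNIV "\<lambda>y. (x, y)"]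
      by (auto simp: continuous_on_eq_continuous_at intro!: continuous_intros)
    ultimately have "has_bochner_integral lborel (\<lambda>y. pd 2 h (x, y) * indicator {?a..?b} y) (h (x, ?b) - h (x, ?a))"
      by (intro has_bochner_integral_FTC_Icc_real) auto
    moreover have "(\<lambda>y. pd 2 h (x, y) * indicator {?a..?b} y) = (\<lambda>y. pd 2 h (x, y))"
    proof
      fix y
      have "(x, y) \<notin> cbox (-M, -M) (M, M)" if "y \<notin> {?a..?b}"
        using that by (auto simp: mem_cbox_prod)
      then show "pd 2 h (x, y) * indicator {?a..?b} y = pd 2 h (x, y)"
        using z[of "(x, y)" 2] by (cases "y \<in> {?a..?b}") auto
    qed
    moreover have "(x, ?b) \<notin> cbox (-M, -M) (M, M)" "(x, ?a) \<notin> cbox (-M, -M) (M, M)"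
      by (auto simp: mem_cbox_prod)
    then have "h (x, ?b) = 0" "h (x, ?a) = 0" using M by blast+
    ultimately show ?thesis by (simp add: has_bochner_integral_integral_eq)
  qed
  have int': "integrable (lborel \<Otimes>\<^sub>M lborel) (\<lambda>(x, y). pd i h (x, y))" for i
    using int[of i] by (simp add: lborel_prod split_def)
  have "(LINT p|lborel. pd 1 h p) = 0"
    using lborel_pair.integral_snd[OF int'[of 1]] x0 by (simp add: lborel_prod split_def)
  moreover have "(LINT p|lborel. pd 2 h p) = 0"
    using lborel_pair.integral_fst[OF int'[of 2]] y0 by (simp add: lborel_prod split_def)
  ultimately show "(LINT p|lborel. pd i h p) = 0"
    using exhaust_2[of i] by auto
qed

text \<open>Nothing is known about \<open>f\<close> outside \<open>S\<close>, but the product with a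
  test function is C^1 on the whole plane: it is so on \<open>S\<close>, and on the complement of
  the compact support, where it vanishes. The integral of its derivative is zero, and the product
  rule splits that derivative.\<close>

lemma is_weak_pd_classical:
  assumes "open S" and f: "Ck_on 1 S f"
  shows "is_weak_pd i S f (pd i f)"
proof -
  have fd: "f differentiable (at p)" if "p \<in> S" for p using f that by simp
  have fc: "continuous_on S f" using f by (rule Ck_on_continuous)
  have pc: "continuous_on S (pd i f)" for i using f by simp
  have li: "locally_integrable S g" if "continuous_on S g" for g
    unfolding locally_integrable_def
    using that by (auto intro!: set_integrable_compact_support continuous_on_subset[of S g])
  have "(LINT p:S|lborel. f p * pd i \<psi> p) = - (LINT p:S|lborel. pd i f p * \<psi> p)" if \<psi>: "\<psi> \<in> test_fun S" for \<psi>
  proof -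
    obtain K where K: "compact K" "K \<subseteq> S" "\<And>p. p \<notin> K \<Longrightarrow> \<psi> p = 0" "\<And>p i. p \<notin> K \<Longrightarrow> pd i \<psi> p = 0"
      using test_fun_compact_support[OF \<psi>] by metis
    have \<psi>d: "\<psi> differentiable (at p)" for p
      by (rule smooth_on_differentiable[OF test_fun_smooth[OF \<psi>]]) simp
    define h where "h = (\<lambda>p. f p * \<psi> p)"
    have oK: "open (- K)" using K(1) by (simp add: compact_imp_closed open_Compl)
    have hS: "pd i h p = pd i f p * \<psi> p + f p * pd i \<psi> p" "h differentiable (at p)" if "p \<in> S" for p i
      unfolding h_def by (rule pd_mult[OF fd[OF that] \<psi>d], rule differentiable_mult[OF fd[OF that] \<psi>d])
    have hK0: "h p = 0" if "p \<notin> K" for p using K(3) that by (simp add: h_def)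
    have hK: "pd i h p = 0" "h differentiable (at p)" if "p \<in> - K" for p i
    proof -
      have "pd i h p = pd i (\<lambda>_. 0::real) p"
        by (rule pd_cong[OF oK that]) (use hK0 in auto)
      then show "pd i h p = 0" using pd_has_derivative[of "\<lambda>_. 0::real" "\<lambda>_. 0" p i] by simp
      show "h differentiable (at p)"
        by (rule differentiable_cong_open[OF oK that, of "\<lambda>_. 0"]) (use hK0 in auto)
    qed
    have cov: "S \<union> - K = UNIV" using K(2) by auto
    have "continuous_on (S \<union> - K) (pd i h)" for i
    proof (rule continuous_on_open_Un[OF assms(1) oK])
      have "continuous_on S (\<lambda>p. pd i f p * \<psi> p + f p * pd i \<psi> p)"
        using pc fc test_fun_continuous[OF \<psi>] test_fun_pd_continuous[OF \<psi>]
        by (intro continuous_intros) (auto intro: continuous_on_subset)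
      then show "continuous_on S (pd i h)" using hS(1) by (subst continuous_on_cong[OF refl]) auto
      show "continuous_on (- K) (pd i h)" using hK(1) by (subst continuous_on_cong[OF refl]) auto
    qed
    moreover have "h differentiable (at p)" for p using cov hS(2) hK(2) by blast
    ultimately have "Ck_on 1 UNIV h" unfolding One_nat_def Ck_on.simps cov by blast
    moreover obtain M where M: "K \<subseteq> cbox (-M, -M) (M, M)"
    proof -
      obtain B where B: "\<And>p. p \<in> K \<Longrightarrow> norm p \<le> B" using compact_imp_bounded[OF K(1)] by (auto simp: bounded_iff)
      have "\<bar>fst p\<bar> \<le> B \<and> \<bar>snd p\<bar> \<le> B" if "p \<in> K" for p
        using B[OF that] norm_fst_le[of "fst p" "snd p"] norm_snd_le[of "snd p" "fst p"] by simp
      then show ?thesis by (intro that[of B]) (force simp: mem_cbox_prod)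
    qed
    ultimately have 0: "(LINT p|lborel. pd i h p) = 0"
      using hK0 by (intro integral_pd_zero(2)[of h M]) auto
    have e: "(\<lambda>p. indicator S p *\<^sub>R (pd i f p * \<psi> p) + indicator S p *\<^sub>R (f p * pd i \<psi> p)) = pd i h"
    proof
      fix p
      show "indicator S p *\<^sub>R (pd i f p * \<psi> p) + indicator S p *\<^sub>R (f p * pd i \<psi> p) = pd i h p"
        using hS(1)[of p i] hK(1)[of p i] K(2) by (cases "p \<in> S") auto
    qed
    have "(LINT p:S|lborel. pd i f p * \<psi> p) + (LINT p:S|lborel. f p * pd i \<psi> p) = (LINT p|lborel. pd i h p)"
      unfolding set_lebesgue_integral_def e[symmetric]
      using locally_integrable_test_fun[OF li \<psi>] pc fc
      by (subst Bochner_Integration.integral_add) (auto simp: set_integrable_def)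
    with 0 show ?thesis by simp
  qed
  then show ?thesis using li pc fc by (auto simp: is_weak_pd_def)
qed

section \<open>Geometry of the Enneper surface of order 5\<close>

definition enn_u :: "real \<times> real \<Rightarrow> real^3" where
  "enn_u p = vector [(cos (snd p) - fst p ^ 10 * cos (11 * snd p)) / 2,
     (- sin (snd p) - fst p ^ 10 * sin (11 * snd p)) / 2, fst p ^ 5 * cos (6 * snd p)]"

definition enn_v :: "real \<times> real \<Rightarrow> real^3" where
  "enn_v p = vector [(- fst p * sin (snd p) + fst p ^ 11 * sin (11 * snd p)) / 2,
     (- fst p * cos (snd p) - fst p ^ 11 * cos (11 * snd p)) / 2, - (fst p ^ 6 * sin (6 * snd p))]"

lemma has_vector_derivative_vector_3:
  fixes f :: "real \<Rightarrow> real^3"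
  assumes "\<And>t. f t = vector [a t, b t, c t]"
    and "(a has_real_derivative a') (at x)" "(b has_real_derivative b') (at x)" "(c has_real_derivative c') (at x)"
  shows "(f has_vector_derivative vector [a', b', c']) (at x)"
proof -
  have *: "vector [x, y, z] = x *\<^sub>R axis 1 1 + y *\<^sub>R axis 2 1 + z *\<^sub>R (axis 3 1 :: real^3)" for x y z
    by (simp add: vec_eq_iff forall_3 axis_def)
  have "((\<lambda>t. a t *\<^sub>R axis 1 1 + b t *\<^sub>R axis 2 1 + c t *\<^sub>R (axis 3 1 :: real^3)) has_vector_derivative
      a' *\<^sub>R axis 1 1 + b' *\<^sub>R axis 2 1 + c' *\<^sub>R axis 3 1) (at x)"
    using assms(2-4) by (auto intro!: derivative_eq_intros)
  then show ?thesis unfolding * assms(1) .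
qed

lemma pd_vector_3:
  fixes f :: "real \<times> real \<Rightarrow> real^3"
  assumes "\<And>q. f q = vector [a q, b q, c q]"
    and "((\<lambda>t. a (p + t *\<^sub>R coord_dir i)) has_real_derivative a') (at 0)"
        "((\<lambda>t. b (p + t *\<^sub>R coord_dir i)) has_real_derivative b') (at 0)"
        "((\<lambda>t. c (p + t *\<^sub>R coord_dir i)) has_real_derivative c') (at 0)"
  shows "pd i f p = vector [a', b', c']"
  unfolding pd_def by (rule vector_derivative_at, rule has_vector_derivative_vector_3[OF _ assms(2-4)]) (rule assms(1))

lemma enneper_5: "enneper 5 p = vector [(fst p * 11 * cos (snd p) - fst p ^ 11 * cos (11 * snd p)) / 22,
     (- fst p * 11 * sin (snd p) - fst p ^ 11 * sin (11 * snd p)) / 22, fst p ^ 6 * cos (6 * snd p) / 6]"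
  by (cases p) (simp add: enneper_def)

lemma pd_enneper: "pd 1 (enneper 5) p = enn_u p" "pd 2 (enneper 5) p = enn_v p"
proof -
  show "pd 1 (enneper 5) p = enn_u p" unfolding enn_u_def
    by (rule pd_vector_3[OF enneper_5]; cases p)
      (auto intro!: derivative_eq_intros simp: field_simps)
  show "pd 2 (enneper 5) p = enn_v p" unfolding enn_v_def
    by (rule pd_vector_3[OF enneper_5]; cases p)
      (auto intro!: derivative_eq_intros simp: field_simps)
qed

lemma pd_enn:
  "pd 1 enn_u p = vector [- 5 * fst p ^ 9 * cos (11 * snd p), - 5 * fst p ^ 9 * sin (11 * snd p), 5 * fst p ^ 4 * cos (6 * snd p)]"
  "pd 2 enn_u p = vector [(- sin (snd p) + 11 * fst p ^ 10 * sin (11 * snd p)) / 2,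
     (- cos (snd p) - 11 * fst p ^ 10 * cos (11 * snd p)) / 2, - 6 * fst p ^ 5 * sin (6 * snd p)]"
  "pd 1 enn_v p = vector [(- sin (snd p) + 11 * fst p ^ 10 * sin (11 * snd p)) / 2,
     (- cos (snd p) - 11 * fst p ^ 10 * cos (11 * snd p)) / 2, - 6 * fst p ^ 5 * sin (6 * snd p)]"
  "pd 2 enn_v p = vector [(- fst p * cos (snd p) + 11 * fst p ^ 11 * cos (11 * snd p)) / 2,
     (fst p * sin (snd p) + 11 * fst p ^ 11 * sin (11 * snd p)) / 2, - 6 * fst p ^ 6 * cos (6 * snd p)]"
proof -
  show "pd 1 enn_u p = vector [- 5 * fst p ^ 9 * cos (11 * snd p), - 5 * fst p ^ 9 * sin (11 * snd p), 5 * fst p ^ 4 * cos (6 * snd p)]"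
    by (rule pd_vector_3[OF enn_u_def]; cases p)
      (auto intro!: derivative_eq_intros simp: field_simps)
  show "pd 2 enn_u p = vector [(- sin (snd p) + 11 * fst p ^ 10 * sin (11 * snd p)) / 2,
     (- cos (snd p) - 11 * fst p ^ 10 * cos (11 * snd p)) / 2, - 6 * fst p ^ 5 * sin (6 * snd p)]"
    by (rule pd_vector_3[OF enn_u_def]; cases p)
      (auto intro!: derivative_eq_intros simp: field_simps)
  show "pd 1 enn_v p = vector [(- sin (snd p) + 11 * fst p ^ 10 * sin (11 * snd p)) / 2,
     (- cos (snd p) - 11 * fst p ^ 10 * cos (11 * snd p)) / 2, - 6 * fst p ^ 5 * sin (6 * snd p)]"
    by (rule pd_vector_3[OF enn_v_def]; cases p)
      (auto intro!: derivative_eq_intros simp: field_simps)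
  show "pd 2 enn_v p = vector [(- fst p * cos (snd p) + 11 * fst p ^ 11 * cos (11 * snd p)) / 2,
     (fst p * sin (snd p) + 11 * fst p ^ 11 * sin (11 * snd p)) / 2, - 6 * fst p ^ 6 * cos (6 * snd p)]"
    by (rule pd_vector_3[OF enn_v_def]; cases p)
      (auto intro!: derivative_eq_intros simp: field_simps)
qed

text \<open>From 11 v = 2 (6 v) - v. Thereby every trigonometric expression on the surface is a
  polynomial in the sines and cosines of v and 6 v, and the geometric identities become polynomial
  identities modulo two Pythagorean relations.\<close>

lemma angle_11:
  "cos (11 * v) = (2 * cos (6 * v) * cos (6 * v) - 1) * cos v + 2 * sin (6 * v) * cos (6 * v) * sin (v::real)"
  "sin (11 * v) = 2 * sin (6 * v) * cos (6 * v) * cos v - (2 * cos (6 * v) * cos (6 * v) - 1) * sin (v::real)"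
proof -
  have e: "11 * v = 2 * (6 * v) - v" by simp
  show "cos (11 * v) = (2 * cos (6 * v) * cos (6 * v) - 1) * cos v + 2 * sin (6 * v) * cos (6 * v) * sin (v::real)"
    unfolding e cos_diff cos_double_cos sin_double by (simp add: power2_eq_square)
  show "sin (11 * v) = 2 * sin (6 * v) * cos (6 * v) * cos v - (2 * cos (6 * v) * cos (6 * v) - 1) * sin (v::real)"
    unfolding e sin_diff cos_double_cos sin_double by (simp add: power2_eq_square)
qed

lemma inner_vector_3: "(vector [a, b, c] :: real^3) \<bullet> vector [x, y, z] = a * x + b * y + c * z"
  by (simp add: inner_vec_def sum_3)

lemma metric_entries:
  fixes u v :: real
  defines "c \<equiv> cos v" and "s \<equiv> sin v" and "C \<equiv> cos (6 * v)" and "S \<equiv> sin (6 * v)"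
  shows "enn_u (u, v) \<bullet> enn_u (u, v) = ((1 + u ^ 10) / 2)\<^sup>2"
    and "enn_u (u, v) \<bullet> enn_v (u, v) = 0"
    and "enn_v (u, v) \<bullet> enn_v (u, v) = u\<^sup>2 * ((1 + u ^ 10) / 2)\<^sup>2"
proof -
  have 1: "c * c + s * s = 1" "C * C + S * S = 1"
    unfolding c_def s_def C_def S_def by (simp_all add: power2_eq_square[symmetric])
  define t where "t = u ^ 5"
  have u: "u ^ 10 = t * t" "u ^ 11 = u * (t * t)" "u ^ 6 = u * t" by (simp_all add: t_def flip: power_add power_Suc)
  have e: "cos (11 * v) = (2 * C * C - 1) * c + 2 * S * C * s" "sin (11 * v) = 2 * S * C * c - (2 * C * C - 1) * s"
    unfolding c_def s_def C_def S_def by (rule angle_11)+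
  show "enn_u (u, v) \<bullet> enn_u (u, v) = ((1 + u ^ 10) / 2)\<^sup>2"
    unfolding enn_u_def inner_vector_3 fst_conv snd_conv e u t_def[symmetric] c_def[symmetric] s_def[symmetric] C_def[symmetric] S_def[symmetric] power2_eq_square
    using 1 by (simp add: field_simps) algebra
  show "enn_u (u, v) \<bullet> enn_v (u, v) = 0"
    unfolding enn_u_def enn_v_def inner_vector_3 fst_conv snd_conv e u t_def[symmetric] c_def[symmetric] s_def[symmetric] C_def[symmetric] S_def[symmetric] power2_eq_square
    using 1 by (simp add: field_simps) algebra
  show "enn_v (u, v) \<bullet> enn_v (u, v) = u\<^sup>2 * ((1 + u ^ 10) / 2)\<^sup>2"
    unfolding enn_v_def inner_vector_3 fst_conv snd_conv e u t_def[symmetric] c_def[symmetric] s_def[symmetric] C_def[symmetric] S_def[symmetric] power2_eq_square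
    using 1 by (simp add: field_simps) algebra
qed

text \<open>The inverse stereographic projection of z^5, where z has polar coordinates
  \<open>p\<close>.\<close>

definition gauss_map :: "real \<times> real \<Rightarrow> real^3" where
  "gauss_map p = (let t = fst p ^ 5 in
     vector [2 * t * cos (5 * snd p) / (1 + t\<^sup>2), 2 * t * sin (5 * snd p) / (1 + t\<^sup>2), (t\<^sup>2 - 1) / (1 + t\<^sup>2)])"

text \<open>The cross product is u (1 + t^2)^2 / 4 times the Gauss map with t = u^5. The factor is
  positive for u > 0 and the Gauss map has length 1, so normalising returns it.\<close>

lemma unit_normal_enneper:
  assumes "0 < u"
  shows "unit_normal 5 (u, v) = gauss_map (u, v)"
proof -
  define t where "t = u ^ 5"
  define c where "c = cos v"
  define s where "s = sin v"
  define C where "C = cos (6 * v)"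
  define S where "S = sin (6 * v)"
  have 1: "c * c + s * s = 1" "C * C + S * S = 1"
    unfolding c_def s_def C_def S_def by (simp_all add: power2_eq_square[symmetric])
  have u: "u ^ 10 = t * t" "u ^ 11 = u * (t * t)" "u ^ 6 = u * t" by (simp_all add: t_def flip: power_add power_Suc)
  have e: "cos (11 * v) = (2 * C * C - 1) * c + 2 * S * C * s" "sin (11 * v) = 2 * S * C * c - (2 * C * C - 1) * s"
    unfolding c_def s_def C_def S_def by (rule angle_11)+
  have "5 * v = 6 * v - v" by simp
  then have e5: "cos (5 * v) = C * c + S * s" "sin (5 * v) = S * c - C * s"
    unfolding c_def s_def C_def S_def by (simp_all only: cos_diff sin_diff)
  have t0: "1 + t * t \<noteq> 0" by (metis add_pos_nonneg less_irrefl zero_le_square zero_less_one)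
  have g: "gauss_map (u, v) = (1 / (1 + t * t)) *\<^sub>R vector [2 * t * (C * c + S * s), 2 * t * (S * c - C * s), t * t - 1]"
    unfolding gauss_map_def Let_def fst_conv snd_conv e5 t_def[symmetric]
    by (simp add: vec_eq_iff forall_3 power2_eq_square)
  have n: "gauss_map (u, v) \<bullet> gauss_map (u, v) = 1"
  proof -
    have "(2 * t * (C * c + S * s)) * (2 * t * (C * c + S * s)) + (2 * t * (S * c - C * s)) * (2 * t * (S * c - C * s))
       + (t * t - 1) * (t * t - 1) = (1 + t * t) * (1 + t * t)"
      using 1 by algebra
    then show ?thesis unfolding g inner_scaleR_left inner_scaleR_right inner_vector_3 using t0 by simp
  qed
  have "cross3 (enn_u (u, v)) (enn_v (u, v)) = (u * (1 + t * t) / 4) *\<^sub>R vector [2 * t * (C * c + S * s), 2 * t * (S * c - C * s), t * t - 1]"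
    unfolding enn_u_def enn_v_def cross3_def fst_conv snd_conv e u t_def[symmetric] c_def[symmetric] s_def[symmetric] C_def[symmetric] S_def[symmetric]
    unfolding vec_eq_iff forall_3 vector_3 vector_scaleR_component real_scaleR_def
  proof (intro conjI)
    show "(- s - t * t * (2 * S * C * c - (2 * C * C - 1) * s)) / 2 * - (u * t * S) -
      t * C * ((- u * c - u * (t * t) * ((2 * C * C - 1) * c + 2 * S * C * s)) / 2) = u * (1 + t * t) / 4 * (2 * t * (C * c + S * s))"
      using 1 by (simp add: field_simps) algebra
    show "t * C * ((- u * s + u * (t * t) * (2 * S * C * c - (2 * C * C - 1) * s)) / 2) -
      (c - t * t * ((2 * C * C - 1) * c + 2 * S * C * s)) / 2 * - (u * t * S) = u * (1 + t * t) / 4 * (2 * t * (S * c - C * s))"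
      using 1 by (simp add: field_simps) algebra
    show "(c - t * t * ((2 * C * C - 1) * c + 2 * S * C * s)) / 2 * ((- u * c - u * (t * t) * ((2 * C * C - 1) * c + 2 * S * C * s)) / 2) -
      (- s - t * t * (2 * S * C * c - (2 * C * C - 1) * s)) / 2 * ((- u * s + u * (t * t) * (2 * S * C * c - (2 * C * C - 1) * s)) / 2) =
      u * (1 + t * t) / 4 * (t * t - 1)"
      using 1 by (simp add: field_simps) algebra
  qed
  also have "\<dots> = (u * (1 + t * t) * (1 + t * t) / 4) *\<^sub>R gauss_map (u, v)"
    unfolding g scaleR_scaleR using t0 by (intro arg_cong2[of _ _ _ _ scaleR]) (simp_all add: field_simps)
  finally have "cross3 (enn_u (u, v)) (enn_v (u, v)) = (u * (1 + t * t) * (1 + t * t) / 4) *\<^sub>R gauss_map (u, v)" .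
  moreover have "0 < u * (1 + t * t) * (1 + t * t) / 4" using assms t0
    by (simp add: add_pos_nonneg)
  moreover have "sgn (gauss_map (u, v)) = gauss_map (u, v)"
    using n by (simp add: sgn_div_norm norm_eq_sqrt_inner)
  ultimately show ?thesis unfolding unit_normal_def pd_enneper
    by (simp only: sgn_scaleR) simp
qed

text \<open>The second fundamental form is the real part of the quadratic differential -5 z^4 dz^2;
  the entries are its coefficients in polar coordinates.\<close>

lemma second_ff_entries:
  "pd 1 enn_u (u, v) \<bullet> gauss_map (u, v) = - 5 * u ^ 4 * cos (6 * v)"
  "pd 2 enn_u (u, v) \<bullet> gauss_map (u, v) = 5 * u ^ 5 * sin (6 * v)"
  "pd 1 enn_v (u, v) \<bullet> gauss_map (u, v) = 5 * u ^ 5 * sin (6 * v)"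
  "pd 2 enn_v (u, v) \<bullet> gauss_map (u, v) = 5 * u ^ 6 * cos (6 * v)"
proof -
  define t where "t = u ^ 5"
  define q where "q = u ^ 4"
  define c where "c = cos v"
  define s where "s = sin v"
  define C where "C = cos (6 * v)"
  define S where "S = sin (6 * v)"
  have 1: "c * c + s * s = 1" "C * C + S * S = 1"
    unfolding c_def s_def C_def S_def by (simp_all add: power2_eq_square[symmetric])
  have u: "u ^ 10 = t * t" "u ^ 11 = u * (t * t)" "u ^ 6 = u * t" "u ^ 9 = q * t"
    by (simp_all add: t_def q_def flip: power_add power_Suc)
  have e: "cos (11 * v) = (2 * C * C - 1) * c + 2 * S * C * s" "sin (11 * v) = 2 * S * C * c - (2 * C * C - 1) * s"
    unfolding c_def s_def C_def S_def by (rule angle_11)+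
  have "5 * v = 6 * v - v" by simp
  then have e5: "cos (5 * v) = C * c + S * s" "sin (5 * v) = S * c - C * s"
    unfolding c_def s_def C_def S_def by (simp_all only: cos_diff sin_diff)
  have t0: "1 + t * t \<noteq> 0" by (metis add_pos_nonneg less_irrefl zero_le_square zero_less_one)
  have g: "gauss_map (u, v) = (1 / (1 + t * t)) *\<^sub>R vector [2 * t * (C * c + S * s), 2 * t * (S * c - C * s), t * t - 1]"
    unfolding gauss_map_def Let_def fst_conv snd_conv e5 t_def[symmetric]
    by (simp add: vec_eq_iff forall_3 power2_eq_square)
  have k: "1 / (1 + t * t) * x = y" if "x = y * (1 + t * t)" for x y using that t0 by simp
  note D = pd_enn fst_conv snd_conv g inner_scaleR_left inner_scaleR_right inner_vector_3 e u
    t_def[symmetric] q_def[symmetric] c_def[symmetric] s_def[symmetric] C_def[symmetric] S_def[symmetric]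
  show "pd 1 enn_u (u, v) \<bullet> gauss_map (u, v) = - 5 * u ^ 4 * cos (6 * v)"
    unfolding D by (rule k) (use 1 in algebra)
  show "pd 2 enn_u (u, v) \<bullet> gauss_map (u, v) = 5 * u ^ 5 * sin (6 * v)"
    unfolding D by (rule k, use 1 in \<open>simp add: field_simps\<close>) (use 1 in algebra)
  show "pd 1 enn_v (u, v) \<bullet> gauss_map (u, v) = 5 * u ^ 5 * sin (6 * v)"
    unfolding D by (rule k, use 1 in \<open>simp add: field_simps\<close>) (use 1 in algebra)
  show "pd 2 enn_v (u, v) \<bullet> gauss_map (u, v) = 5 * u ^ 6 * cos (6 * v)"
    unfolding D by (rule k, use 1 in \<open>simp add: field_simps\<close>) (use 1 in algebra)
qed

section \<open>The second variation in coordinates\<close>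

lemma matrix_inv_unique:
  fixes A B :: "real^'n^'n"
  assumes "A ** B = mat 1" "B ** A = mat 1"
  shows "matrix_inv A = B"
proof -
  have "A ** matrix_inv A = mat 1 \<and> matrix_inv A ** A = mat 1"
    unfolding matrix_inv_def by (rule someI[of _ B]) (use assms in blast)
  then have "B ** (A ** matrix_inv A) = B" by simp
  moreover have "B ** (A ** matrix_inv A) = matrix_inv A"
    unfolding matrix_mul_assoc using assms(2) by simp
  ultimately show ?thesis by simp
qed

text \<open>The metric is \<open>l\<close> times the flat metric of the plane, so the factor
  \<open>l\<close> cancels in the gradient term. In the other term the curvature times the area
  density is -100 u^9 / (1 + u^10)^2, which is minus the area density of the sphere pulled back by
  z^5.\<close>

lemma second_variation_5:
  "second_variation 5 R f = (LINT p:{0<..<R} \<times> {0..<2 * pi}|lborel.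
     fst p * (weak_pd 1 (strip R) (f \<circ> polar) p)\<^sup>2 + (weak_pd 2 (strip R) (f \<circ> polar) p)\<^sup>2 / fst p
     - 200 * fst p ^ 9 / (1 + fst p ^ 10)\<^sup>2 * (f (polar p))\<^sup>2)"
  unfolding second_variation_def Let_def
proof (rule set_lebesgue_integral_cong)
  show "{0<..<R} \<times> {0..<2 * pi} \<in> sets lborel" by (simp add: borel_Times)
  show "\<forall>p. p \<in> {0<..<R} \<times> {0..<2 * pi} \<longrightarrow>
      ((\<Sum>i\<in>UNIV. \<Sum>j\<in>UNIV. matrix_inv (metric 5 p) $ i $ j * weak_pd i (strip R) (f \<circ> polar) p * weak_pd j (strip R) (f \<circ> polar) p)
          + 2 * gauss_curvature 5 p * ((f \<circ> polar) p)\<^sup>2) * sqrt (det (metric 5 p)) =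
      fst p * (weak_pd 1 (strip R) (f \<circ> polar) p)\<^sup>2 + (weak_pd 2 (strip R) (f \<circ> polar) p)\<^sup>2 / fst p
      - 200 * fst p ^ 9 / (1 + fst p ^ 10)\<^sup>2 * (f (polar p))\<^sup>2"
  proof safe
    fix u v :: real assume "u \<in> {0<..<R}"
    then have u: "0 < u" by simp
    let ?p = "(u, v)"
    define l where "l = ((1 + u ^ 10) / 2)\<^sup>2"
    have u10: "0 < 1 + u ^ 10" using u by (simp add: add_pos_pos)
    then have l: "0 < l" by (simp add: l_def)
    have m: "metric 5 ?p $ 1 $ 1 = l" "metric 5 ?p $ 1 $ 2 = 0" "metric 5 ?p $ 2 $ 1 = 0" "metric 5 ?p $ 2 $ 2 = u\<^sup>2 * l"
      unfolding metric_def l_def using metric_entries[of u v] by (simp_all add: pd_enneper inner_commute)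
    define B :: "real^2^2" where "B = (\<chi> i j. if i = j then (if i = 1 then 1 / l else 1 / (u\<^sup>2 * l)) else 0)"
    have inv: "matrix_inv (metric 5 ?p) = B"
    proof (rule matrix_inv_unique)
      show "metric 5 ?p ** B = mat 1" "B ** metric 5 ?p = mat 1"
        using u l by (auto simp: vec_eq_iff forall_2 matrix_matrix_mult_def sum_2 m B_def mat_def)
    qed
    have det: "det (metric 5 ?p) = (u * l)\<^sup>2"
      by (simp add: det_2 m power2_eq_square)
    have n: "pd i (pd j (enneper 5)) ?p = pd i (if j = 1 then enn_u else enn_v) ?p" for i j
    proof -
      have "pd 1 (enneper 5) = enn_u" "pd 2 (enneper 5) = enn_v" using pd_enneper by auto
      then show ?thesis using exhaust_2[of j] by auto
    qed
    have "det (second_ff 5 ?p) = - 25 * u ^ 10"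
    proof -
      have "det (second_ff 5 ?p) = (- 5 * u ^ 4 * cos (6 * v)) * (5 * u ^ 6 * cos (6 * v)) - (5 * u ^ 5 * sin (6 * v)) * (5 * u ^ 5 * sin (6 * v))"
        unfolding det_2 second_ff_def using unit_normal_enneper[OF u, of v]
        by (simp add: n second_ff_entries)
      also have "\<dots> = - 25 * u ^ 10 * ((cos (6 * v))\<^sup>2 + (sin (6 * v))\<^sup>2)"
      proof -
        have e: "u ^ 4 * u ^ 6 = u ^ 10" "u ^ 5 * u ^ 5 = u ^ 10" by (simp_all flip: power_add)
        have "(- 5 * a * C) * (5 * b * C) - (5 * c * S) * (5 * c * S) = - 25 * (a * b) * (C * C) - 25 * (c * c) * (S * S)"
          for a b c C S :: real by (simp add: algebra_simps)
        from this[of "u ^ 4" _ "u ^ 6" "u ^ 5"] have "- 5 * u ^ 4 * cos (6 * v) * (5 * u ^ 6 * cos (6 * v)) - 5 * u ^ 5 * sin (6 * v) * (5 * u ^ 5 * sin (6 * v))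
          = - 25 * u ^ 10 * (cos (6 * v) * cos (6 * v)) - 25 * u ^ 10 * (sin (6 * v) * sin (6 * v))"
          unfolding e .
        also have "\<dots> = - 25 * u ^ 10 * ((cos (6 * v))\<^sup>2 + (sin (6 * v))\<^sup>2)"
          unfolding power2_eq_square distrib_left by simp
        finally show ?thesis .
      qed
      finally show ?thesis by simp
    qed
    then have "gauss_curvature 5 ?p = - 25 * u ^ 10 / (u * l)\<^sup>2"
      by (simp add: gauss_curvature_def det)
    moreover have sd: "sqrt (det (metric 5 ?p)) = u * l" using u l by (simp add: det)
    moreover have "- 25 * u ^ 10 / (u * l)\<^sup>2 * (u * l) = - 100 * u ^ 9 / (1 + u ^ 10)\<^sup>2"
    proof -
      have "- 25 * u ^ 10 / (u * l)\<^sup>2 * (u * l) = - 25 * u ^ 9 / l"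
        using u l by (simp add: power2_eq_square field_simps flip: power_Suc)
      also have "\<dots> = - 100 * u ^ 9 / (1 + u ^ 10)\<^sup>2"
        using u10 by (simp add: l_def power_divide)
      finally show ?thesis .
    qed
    ultimately have gd: "gauss_curvature 5 ?p * sqrt (det (metric 5 ?p)) = - 100 * u ^ 9 / (1 + u ^ 10)\<^sup>2"
      by (simp only:)
    have K: "(2 * gauss_curvature 5 ?p * a) * sqrt (det (metric 5 ?p)) = - (200 * u ^ 9 / (1 + u ^ 10)\<^sup>2 * a)" for a
    proof -
      have "(2 * gauss_curvature 5 ?p * a) * sqrt (det (metric 5 ?p)) = 2 * a * (gauss_curvature 5 ?p * sqrt (det (metric 5 ?p)))"
        by (simp only: mult_ac)
      then show ?thesis unfolding gd by simp
    qed
    have "(\<Sum>i\<in>UNIV. \<Sum>j\<in>UNIV. B $ i $ j * a i * a j) * sqrt (det (metric 5 ?p)) = u * (a 1)\<^sup>2 + (a 2)\<^sup>2 / u" for a :: "2 \<Rightarrow> real"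
      unfolding sd using u l by (simp add: sum_2 B_def power2_eq_square field_simps)
    then show "((\<Sum>i\<in>UNIV. \<Sum>j\<in>UNIV. matrix_inv (metric 5 ?p) $ i $ j * weak_pd i (strip R) (f \<circ> polar) ?p * weak_pd j (strip R) (f \<circ> polar) ?p)
          + 2 * gauss_curvature 5 ?p * ((f \<circ> polar) ?p)\<^sup>2) * sqrt (det (metric 5 ?p)) =
      fst ?p * (weak_pd 1 (strip R) (f \<circ> polar) ?p)\<^sup>2 + (weak_pd 2 (strip R) (f \<circ> polar) ?p)\<^sup>2 / fst ?p
      - 200 * fst ?p ^ 9 / (1 + fst ?p ^ 10)\<^sup>2 * (f (polar ?p))\<^sup>2"
      unfolding inv distrib_right K by simp
  qed
qed

section \<open>Fourier coefficients\<close>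

text \<open>An orthonormal system with cosines for \<open>k > 0\<close> and sines for \<open>k < 0\<close>, so that differentiation
  exchanges \<open>k\<close> and \<open>- k\<close>.\<close>

definition trig :: "int \<Rightarrow> real \<Rightarrow> real" where
  "trig k v = (if k = 0 then 1 / sqrt (2 * pi)
     else if k > 0 then cos (of_int k * v) / sqrt pi else sin (- of_int k * v) / sqrt pi)"

lemma trig_deriv: "(trig k has_real_derivative - of_int k * trig (- k) v) (at v)"
proof -
  consider "k = 0" | "k > 0" | "k < 0" by linarith
  then show ?thesis
  proof cases
    case 1
    then show ?thesis by (simp add: trig_def[abs_def])
  next
    case 2
    then have "trig k = (\<lambda>v. cos (of_int k * v) / sqrt pi)" by (auto simp: trig_def fun_eq_iff)
    moreover have "((\<lambda>v. cos (of_int k * v)) has_real_derivative - (of_int k * sin (of_int k * v))) (at v)"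
      by (auto intro!: derivative_eq_intros)
    from DERIV_cdivide[OF this, of "sqrt pi"] have "((\<lambda>v. cos (of_int k * v) / sqrt pi) has_real_derivative
        - of_int k * trig (- k) v) (at v)" using 2 by (simp add: trig_def)
    ultimately show ?thesis by simp
  next
    case 3
    then have "trig k = (\<lambda>v. sin (- of_int k * v) / sqrt pi)" by (auto simp: trig_def fun_eq_iff)
    moreover have "((\<lambda>v. sin (- of_int k * v)) has_real_derivative (- of_int k * cos (- of_int k * v))) (at v)"
      by (auto intro!: derivative_eq_intros)
    from DERIV_cdivide[OF this, of "sqrt pi"] have "((\<lambda>v. sin (- of_int k * v) / sqrt pi) has_real_derivative
        - of_int k * trig (- k) v) (at v)" using 3 by (simp add: trig_def)
    ultimately show ?thesis by simp
  qed
qed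

lemma continuous_on_trig [continuous_intros]: "continuous_on S g \<Longrightarrow> continuous_on S (\<lambda>x. trig k (g x))"
  by (rule continuous_on_compose2[of UNIV "trig k"])
    (auto intro!: continuous_at_imp_continuous_on DERIV_isCont[OF trig_deriv])

lemma sin_int_2pi [simp]: "sin (of_int n * (2 * pi)) = 0"
  using sin_int_2pin[of n] by (simp add: mult_ac)

lemma cos_int_2pi [simp]: "cos (of_int n * (2 * pi)) = 1"
  using cos_int_2pin[of n] by (simp add: mult_ac)

lemma trig_periodic: "trig k (v + 2 * pi) = trig k v"
proof -
  have "cos (of_int k * (v + 2 * pi)) = cos (of_int k * v)"
    unfolding distrib_left cos_add cos_int_2pi sin_int_2pi by simp
  moreover have "sin (- of_int k * (v + 2 * pi)) = sin (- of_int k * v)"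
    using cos_int_2pi[of k] sin_int_2pi[of k]
    by (simp only: distrib_left sin_add cos_minus sin_minus mult_minus_left)
  ultimately show ?thesis by (simp add: trig_def)
qed

lemma trig_periodic_0: "trig k (2 * pi) = trig k 0"
  using trig_periodic[of k 0] by simp

lemma has_integral_cos_int:
  "((\<lambda>v. cos (of_int n * v)) has_integral (if n = 0 then 2 * pi else 0)) {0..2 * pi}"
proof (cases "n = 0")
  case True
  then show ?thesis using has_integral_const_real[of "1::real" 0 "2 * pi"] by simp
next
  case False
  have "((\<lambda>v. cos (of_int n * v)) has_integral (sin (of_int n * (2 * pi)) / of_int n - sin (of_int n * 0) / of_int n)) {0..2 * pi}"
    by (rule fundamental_theorem_of_calculus)
      (use False in \<open>auto intro!: derivative_eq_intros simp flip: has_real_derivative_iff_has_vector_derivative\<close>)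
  then show ?thesis using False by (simp del: sin_int_2pi add: sin_int_2pi)
qed

lemma has_integral_sin_int:
  "((\<lambda>v. sin (of_int n * v)) has_integral 0) {0..2 * pi}"
proof (cases "n = 0")
  case False
  have "((\<lambda>v. sin (of_int n * v)) has_integral (- cos (of_int n * (2 * pi)) / of_int n - - cos (of_int n * 0) / of_int n)) {0..2 * pi}"
    by (rule fundamental_theorem_of_calculus)
      (use False in \<open>auto intro!: derivative_eq_intros simp flip: has_real_derivative_iff_has_vector_derivative\<close>)
  then show ?thesis by simp
qed simp

lemma cos_cos_int: "cos (of_int j * v) * cos (of_int k * v) = (cos (of_int (j - k) * v) + cos (of_int (j + k) * v)) / (2::real)"
  and sin_sin_int: "sin (of_int j * v) * sin (of_int k * v) = (cos (of_int (j - k) * v) - cos (of_int (j + k) * v)) / (2::real)"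
  and sin_cos_int: "sin (of_int j * v) * cos (of_int k * v) = (sin (of_int (j + k) * v) + sin (of_int (j - k) * v)) / (2::real)"
  by (simp_all add: left_diff_distrib distrib_right cos_add cos_diff sin_add sin_diff)

lemma has_integral_trig_mult:
  "((\<lambda>v. trig j v * trig k v) has_integral (if j = k then 1 else 0)) {0..2 * pi}"
proof -
  have cc: "((\<lambda>v. cos (of_int j * v) * cos (of_int k * v)) has_integral
      ((if j - k = 0 then 2 * pi else 0) + (if j + k = 0 then 2 * pi else 0)) / 2) {0..2 * pi}" for j k
    unfolding cos_cos_int by (intro has_integral_divide has_integral_add has_integral_cos_int)
  have ss: "((\<lambda>v. sin (of_int j * v) * sin (of_int k * v)) has_integral
      ((if j - k = 0 then 2 * pi else 0) - (if j + k = 0 then 2 * pi else 0)) / 2) {0..2 * pi}" for j k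
    unfolding sin_sin_int by (intro has_integral_divide has_integral_diff has_integral_cos_int)
  have sc: "((\<lambda>v. sin (of_int j * v) * cos (of_int k * v)) has_integral (0 + 0) / 2) {0..2 * pi}" for j k
    unfolding sin_cos_int by (intro has_integral_divide has_integral_add has_integral_sin_int)
  define \<alpha> where "\<alpha> k = (if k = 0 then 1 / sqrt (2 * pi) else 1 / sqrt pi)" for k :: int
  have t: "trig k v = \<alpha> k * (if k \<ge> 0 then cos (of_int k * v) else sin (of_int (- k) * v))" for k v
    by (simp add: trig_def \<alpha>_def)
  have a0: "\<alpha> 0 * \<alpha> 0 = 1 / (2 * pi)" 
  proof -
    have "sqrt (2 * pi) * sqrt (2 * pi) = 2 * pi" by (rule real_sqrt_mult_self[THEN trans]) simp
    then show ?thesis by (simp only: \<alpha>_def if_True simp_thms times_divide_times_eq mult_1)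
  qed
  have a1: "k \<noteq> 0 \<Longrightarrow> \<alpha> k * \<alpha> k = 1 / pi" for k by (simp add: \<alpha>_def)
  consider "0 \<le> j" "0 \<le> k" | "0 \<le> j" "k < 0" | "j < 0" "0 \<le> k" | "j < 0" "k < 0" by linarith
  then show ?thesis
  proof cases
    case 1
    have "((\<lambda>v. (\<alpha> j * \<alpha> k) * (cos (of_int j * v) * cos (of_int k * v))) has_integral
        (\<alpha> j * \<alpha> k) * (((if j - k = 0 then 2 * pi else 0) + (if j + k = 0 then 2 * pi else 0)) / 2)) {0..2 * pi}"
      by (intro has_integral_mult_right cc)
    moreover have "(\<alpha> j * \<alpha> k) * (((if j - k = 0 then 2 * pi else 0) + (if j + k = 0 then 2 * pi else 0)) / 2) = (if j = k then 1 else 0)"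
      using 1 a0 a1[of k] by auto
    ultimately show ?thesis using 1 by (simp add: t mult_ac)
  next
    case 2
    have "((\<lambda>v. (\<alpha> j * \<alpha> k) * (sin (of_int (- k) * v) * cos (of_int j * v))) has_integral (\<alpha> j * \<alpha> k) * ((0 + 0) / 2)) {0..2 * pi}"
      by (intro has_integral_mult_right sc)
    then show ?thesis using 2 by (simp add: t mult_ac)
  next
    case 3
    have "((\<lambda>v. (\<alpha> j * \<alpha> k) * (sin (of_int (- j) * v) * cos (of_int k * v))) has_integral (\<alpha> j * \<alpha> k) * ((0 + 0) / 2)) {0..2 * pi}"
      by (intro has_integral_mult_right sc)
    then show ?thesis using 3 by (simp add: t mult_ac)
  next
    case 4
    have "((\<lambda>v. (\<alpha> j * \<alpha> k) * (sin (of_int (- j) * v) * sin (of_int (- k) * v))) has_integral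
        (\<alpha> j * \<alpha> k) * (((if (- j) - (- k) = 0 then 2 * pi else 0) - (if (- j) + (- k) = 0 then 2 * pi else 0)) / 2)) {0..2 * pi}"
      by (intro has_integral_mult_right ss)
    moreover have "(\<alpha> j * \<alpha> k) * (((if (- j) - (- k) = 0 then 2 * pi else 0) - (if (- j) + (- k) = 0 then 2 * pi else 0)) / 2) = (if j = k then 1 else 0)"
      using 4 a1[of k] by auto
    ultimately show ?thesis using 4 by (simp add: t mult_ac)
  qed
qed

section \<open>Trigonometric polynomials and their density\<close>

inductive trig_poly :: "(real \<Rightarrow> real) \<Rightarrow> bool" where
  cos: "trig_poly (\<lambda>v. a * cos (of_int n * v))"
| sin: "trig_poly (\<lambda>v. a * sin (of_int n * v))"
| add: "trig_poly f \<Longrightarrow> trig_poly g \<Longrightarrow> trig_poly (\<lambda>v. f v + g v)"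

lemma mult_half_sum:
  fixes a b P Q X Y :: real
  shows "P * Q = (X + Y) / 2 \<Longrightarrow> (a * b / 2) * X + (a * b / 2) * Y = (a * P) * (b * Q)"
    and "P * Q = (X + Y) / 2 \<Longrightarrow> (b * a / 2) * X + (b * a / 2) * Y = (b * Q) * (a * P)"
    and "P * Q = (X - Y) / 2 \<Longrightarrow> (a * b / 2) * X + (- (a * b / 2)) * Y = (a * P) * (b * Q)"
proof -
  have *: "(a * P) * (b * Q) = a * b * (P * Q)" "(b * Q) * (a * P) = a * b * (P * Q)" by (simp_all add: mult_ac)
  show "(a * b / 2) * X + (a * b / 2) * Y = (a * P) * (b * Q)" "(b * a / 2) * X + (b * a / 2) * Y = (b * Q) * (a * P)"
    if "P * Q = (X + Y) / 2" unfolding * that by (simp_all add: field_simps)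
  show "(a * b / 2) * X + (- (a * b / 2)) * Y = (a * P) * (b * Q)"
    if "P * Q = (X - Y) / 2" unfolding * that by (simp add: field_simps)
qed

text \<open>Product-to-sum formulas. Frequencies of \<open>trig_poly\<close> are arbitrary integers,
  so sums and differences of frequencies stay inside the class without any bookkeeping of degrees;
  the ordered expansion is recovered by \<open>trig_poly_expansion\<close>.\<close>

lemma trig_poly_mult:
  assumes "trig_poly f" "trig_poly g"
  shows "trig_poly (\<lambda>v. f v * g v)"
  using assms
proof (induction f)
  case (cos a n)
  from cos show ?case
  proof (induction g)
    case (cos b m)
    have "trig_poly (\<lambda>v. (a * b / 2) * cos (of_int (n - m) * v) + (a * b / 2) * cos (of_int (n + m) * v))"
      by (intro trig_poly.intros)
    then show ?case by (rule back_subst[of trig_poly]) (rule ext, rule mult_half_sum(1)[OF cos_cos_int])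
  next
    case (sin b m)
    have "trig_poly (\<lambda>v. (a * b / 2) * sin (of_int (m + n) * v) + (a * b / 2) * sin (of_int (m - n) * v))"
      by (intro trig_poly.intros)
    then show ?case by (rule back_subst[of trig_poly]) (rule ext, rule mult_half_sum(2)[OF sin_cos_int])
  next
    case (add f g)
    then show ?case using trig_poly.add by (simp add: distrib_left)
  qed
next
  case (sin a n)
  from sin show ?case
  proof (induction g)
    case (cos b m)
    have "trig_poly (\<lambda>v. (a * b / 2) * sin (of_int (n + m) * v) + (a * b / 2) * sin (of_int (n - m) * v))"
      by (intro trig_poly.intros)
    then show ?case by (rule back_subst[of trig_poly]) (rule ext, rule mult_half_sum(1)[OF sin_cos_int])
  next
    case (sin b m)
    have "trig_poly (\<lambda>v. (a * b / 2) * cos (of_int (n - m) * v) + (- (a * b / 2)) * cos (of_int (n + m) * v))"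
      by (intro trig_poly.intros)
    then show ?case by (rule back_subst[of trig_poly]) (rule ext, rule mult_half_sum(3)[OF sin_sin_int])
  next
    case (add f g)
    then show ?case using trig_poly.add by (simp add: distrib_left)
  qed
next
  case (add f1 f2)
  then show ?case using trig_poly.add by (simp add: distrib_right)
qed

lemma trig_poly_expansion:
  assumes "trig_poly f"
  shows "\<exists>N c. f = (\<lambda>v. \<Sum>k\<in>{- int N..int N}. c k * trig k v)"
  using assms
proof induction
  case (cos a n)
  define c where "c k = (if k = \<bar>n\<bar> then a * (if n = 0 then sqrt (2 * pi) else sqrt pi) else 0)" for k :: int
  have "a * cos (of_int n * v) = (\<Sum>k\<in>{- int (nat \<bar>n\<bar>)..int (nat \<bar>n\<bar>)}. c k * trig k v)" for v
  proof -
    have "(\<Sum>k\<in>{- int (nat \<bar>n\<bar>)..int (nat \<bar>n\<bar>)}. c k * trig k v) = c \<bar>n\<bar> * trig \<bar>n\<bar> v"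
      by (subst sum.remove[of _ "\<bar>n\<bar>"]) (auto simp: c_def intro!: sum.neutral)
    also have "\<dots> = a * cos (of_int n * v)"
      by (cases "n > 0"; cases "n = 0") (auto simp: c_def trig_def abs_if)
    finally show ?thesis by simp
  qed
  then show ?case by blast
next
  case (sin a n)
  define c where "c k = (if k = - \<bar>n\<bar> then a * of_int (sgn n) * sqrt pi else 0)" for k :: int
  have "a * sin (of_int n * v) = (\<Sum>k\<in>{- int (nat \<bar>n\<bar>)..int (nat \<bar>n\<bar>)}. c k * trig k v)" for v
  proof -
    have "(\<Sum>k\<in>{- int (nat \<bar>n\<bar>)..int (nat \<bar>n\<bar>)}. c k * trig k v) = c (- \<bar>n\<bar>) * trig (- \<bar>n\<bar>) v"
      by (subst sum.remove[of _ "- \<bar>n\<bar>"]) (auto simp: c_def intro!: sum.neutral)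
    also have "\<dots> = a * sin (of_int n * v)"
      by (cases "n > 0"; cases "n = 0") (auto simp: c_def trig_def abs_if)
    finally show ?thesis by simp
  qed
  then show ?case by blast
next
  case (add f g)
  then obtain N c M d where f: "f = (\<lambda>v. \<Sum>k\<in>{- int N..int N}. c k * trig k v)"
    and g: "g = (\<lambda>v. \<Sum>k\<in>{- int M..int M}. d k * trig k v)" by blast
  have extend: "(\<Sum>k\<in>{- int N..int N}. c k * trig k v) =
      (\<Sum>k\<in>{- int (max N M)..int (max N M)}. (if k \<in> {- int N..int N} then c k else 0) * trig k v)" for N M c v
    by (rule sum.mono_neutral_cong_left) auto
  have "f v + g v = (\<Sum>k\<in>{- int (max N M)..int (max N M)}.
      ((if k \<in> {- int N..int N} then c k else 0) + (if k \<in> {- int M..int M} then d k else 0)) * trig k v)" for v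
    unfolding f g distrib_right sum.distrib extend[where N=N and M=M and c=c and v=v] extend[where N=M and M=N and c=d and v=v]
    by (simp only: max.commute)
  then show ?case
    by (intro exI[of _ "max N M"] exI[of _ "\<lambda>k. (if k \<in> {- int N..int N} then c k else 0)
      + (if k \<in> {- int M..int M} then d k else 0)"]) (rule ext)
qed

text \<open>On the unit circle a real-linear function is a combination of cosine and sine, and sums
  and products stay trigonometric polynomials.\<close>

lemma trig_poly_real_polynomial_function:
  "real_polynomial_function g \<Longrightarrow> trig_poly (\<lambda>v. g (cis v))"
proof (induction g rule: real_polynomial_function.induct)
  case (linear f)
  then interpret bounded_linear f .
  have "f (cis v) = f 1 * cos (of_int 1 * v) + f \<i> * sin (of_int 1 * v)" for v
  proof -
    have "cis v = cos v *\<^sub>R 1 + sin v *\<^sub>R \<i>" by (simp add: complex_eq_iff)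
    then have "f (cis v) = f (cos v *\<^sub>R 1 + sin v *\<^sub>R \<i>)" by (rule arg_cong)
    then show ?thesis by (simp only: add scaleR) simp
  qed
  then show ?case by (simp only:) (intro trig_poly.intros)
next
  case (const c)
  then show ?case using trig_poly.cos[of c 0] by simp
next
  case (add f g)
  then show ?case by (intro trig_poly.add)
next
  case (mult f g)
  then show ?case by (intro trig_poly_mult)
qed

text \<open>Periodicity turns \<open>f\<close> into a continuous function on the unit circle, where
  real polynomial functions are uniformly dense by Stone and Weierstrass.\<close>

lemma trig_approximation:
  assumes f: "continuous_on {0..2 * pi} f" and per: "f (2 * pi) = f 0" and "0 < e"
  shows "\<exists>N c. \<forall>v\<in>{0..2 * pi}. \<bar>f v - (\<Sum>k\<in>{- int N..int N}. c k * trig k v)\<bar> < e"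
proof -
  define p where "p t = f (2 * pi * t)" for t
  have "path p" unfolding path_def p_def
    by (intro continuous_on_compose2[OF f]) (auto intro!: continuous_intros)
  moreover have "pathfinish p = pathstart p" using per by (simp add: p_def pathfinish_def pathstart_def)
  \<comment> \<open>The trivial homotopy is taken only for its consequence that the loop, read
    through the argument, is continuous on the circle, including the point where
    \<open>Arg2pi\<close> jumps.\<close>
  ultimately have "homotopic_loops UNIV p p" by (simp add: homotopic_loops_refl)
  from homotopic_with_imp_continuous[OF homotopic_loops_imp_homotopic_circlemaps[OF this]]
  have "continuous_on (sphere 0 1) (\<lambda>z. f (Arg2pi z))" by (simp add: p_def comp_def)
  from Stone_Weierstrass_real_polynomial_function[OF _ this \<open>0 < e\<close>]
  obtain g where g: "real_polynomial_function g" "\<And>z. z \<in> sphere 0 1 \<Longrightarrow> \<bar>f (Arg2pi z) - g z\<bar> < e" by auto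
  obtain N c where "(\<lambda>v. g (cis v)) = (\<lambda>v. \<Sum>k\<in>{- int N..int N}. c k * trig k v)"
    using trig_poly_expansion[OF trig_poly_real_polynomial_function[OF g(1)]] by blast
  then have Nc: "g (cis v) = (\<Sum>k\<in>{- int N..int N}. c k * trig k v)" for v by (rule fun_cong)
  have "f (Arg2pi (cis v)) = f v" if "v \<in> {0..2 * pi}" for v
  \<comment> \<open>\<open>Arg2pi\<close> takes values below 2 pi, so the right endpoint is sent to
    0 and periodicity of \<open>f\<close> is used.\<close>
  proof (cases "v = 2 * pi")
    case True
    then show ?thesis using per by (simp add: cis_2pi Arg2pi_of_real[of 1, simplified])
  next
    case False
    then have "Arg2pi (cis v) = v"
      using that by (intro Arg2pi_unique[of 1]) (auto simp: cis_conv_exp)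
    then show ?thesis by simp
  qed
  then have "\<bar>f v - (\<Sum>k\<in>{- int N..int N}. c k * trig k v)\<bar> < e" if "v \<in> {0..2 * pi}" for v
    using g(2)[of "cis v"] that unfolding Nc by simp
  then show ?thesis by blast
qed

section \<open>Fourier coefficients: Bessel, Parseval and Wirtinger\<close>

definition fourier :: "(real \<Rightarrow> real) \<Rightarrow> int \<Rightarrow> real" where
  "fourier f k = integral {0..2 * pi} (\<lambda>v. f v * trig k v)"

lemma has_integral_fourier:
  "continuous_on {0..2 * pi} f \<Longrightarrow> ((\<lambda>v. f v * trig k v) has_integral fourier f k) {0..2 * pi}"
  unfolding fourier_def
  by (intro integrable_integral integrable_continuous_interval continuous_intros)

text \<open>Orthonormality and completion of the square. The choice \<open>c = fourier f\<close>
  gives the Bessel inequality; dropping the last, nonnegative sum shows that no trigonometric sum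
  approximates better than the Fourier sum.\<close>

lemma integral_minus_trig_sum:
  assumes f: "continuous_on {0..2 * pi} f" and K: "finite K"
  shows "((\<lambda>v. (f v - (\<Sum>k\<in>K. c k * trig k v))\<^sup>2) has_integral
    integral {0..2 * pi} (\<lambda>v. (f v)\<^sup>2) - (\<Sum>k\<in>K. (fourier f k)\<^sup>2) + (\<Sum>k\<in>K. (c k - fourier f k)\<^sup>2)) {0..2 * pi}"
proof -
  have 1: "((\<lambda>v. (f v)\<^sup>2) has_integral integral {0..2 * pi} (\<lambda>v. (f v)\<^sup>2)) {0..2 * pi}"
    by (intro integrable_integral integrable_continuous_interval continuous_intros f)
  have 2: "((\<lambda>v. \<Sum>k\<in>K. (2 * c k) * (f v * trig k v)) has_integral (\<Sum>k\<in>K. (2 * c k) * fourier f k)) {0..2 * pi}"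
    by (intro has_integral_sum K has_integral_mult_right has_integral_fourier f)
  have 3: "((\<lambda>v. \<Sum>j\<in>K. \<Sum>k\<in>K. (c j * c k) * (trig j v * trig k v)) has_integral
      (\<Sum>j\<in>K. \<Sum>k\<in>K. (c j * c k) * (if j = k then 1 else 0))) {0..2 * pi}"
    by (intro has_integral_sum K has_integral_mult_right has_integral_trig_mult)
  have e3: "(\<Sum>j\<in>K. \<Sum>k\<in>K. (c j * c k) * (if j = k then 1 else 0)) = (\<Sum>k\<in>K. (c k)\<^sup>2)"
    using K by (simp add: if_distrib[of "\<lambda>x. _ * x"] power2_eq_square cong: if_cong)
  have sq: "(f v - (\<Sum>k\<in>K. c k * trig k v))\<^sup>2 = (f v)\<^sup>2 - (\<Sum>k\<in>K. (2 * c k) * (f v * trig k v))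
      + (\<Sum>j\<in>K. \<Sum>k\<in>K. (c j * c k) * (trig j v * trig k v))" for v
    unfolding power2_diff power2_eq_square[of "sum _ _"] sum_product
    by (simp add: sum_distrib_left mult_ac)
  have val: "integral {0..2 * pi} (\<lambda>v. (f v)\<^sup>2) - (\<Sum>k\<in>K. (fourier f k)\<^sup>2) + (\<Sum>k\<in>K. (c k - fourier f k)\<^sup>2) =
     integral {0..2 * pi} (\<lambda>v. (f v)\<^sup>2) - (\<Sum>k\<in>K. (2 * c k) * fourier f k) + (\<Sum>k\<in>K. (c k)\<^sup>2)"
    by (simp add: power2_diff sum.distrib sum_subtractf)
  show ?thesis unfolding sq val
    using has_integral_add[OF has_integral_diff[OF 1 2] 3] unfolding e3 .
qed

lemma bessel:
  assumes f: "continuous_on {0..2 * pi} f" and K: "finite K"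
  shows "(\<Sum>k\<in>K. (fourier f k)\<^sup>2) \<le> integral {0..2 * pi} (\<lambda>v. (f v)\<^sup>2)"
  using has_integral_nonneg[OF integral_minus_trig_sum[OF f K, of "fourier f"]] by simp

text \<open>The Fourier sum is at least as close in mean square as the uniform approximation with
  the same frequencies.\<close>

lemma parseval_approx:
  assumes f: "continuous_on {0..2 * pi} f" and per: "f (2 * pi) = f 0" and "0 < e"
  shows "\<exists>N. integral {0..2 * pi} (\<lambda>v. (f v)\<^sup>2) - e \<le> (\<Sum>k\<in>{- int N..int N}. (fourier f k)\<^sup>2)"
proof -
  \<comment> \<open>A uniform error below \<open>d\<close> costs at most 2 pi d^2 = e in mean
    square.\<close>
  define d where "d = sqrt (e / (2 * pi))"
  have d: "0 < d" "d\<^sup>2 * (2 * pi) = e" using \<open>0 < e\<close> by (simp_all add: d_def)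
  obtain N c where Nc: "\<And>v. v \<in> {0..2 * pi} \<Longrightarrow> \<bar>f v - (\<Sum>k\<in>{- int N..int N}. c k * trig k v)\<bar> < d"
    using trig_approximation[OF f per d(1)] by blast
  have "integral {0..2 * pi} (\<lambda>v. (f v)\<^sup>2) - (\<Sum>k\<in>{- int N..int N}. (fourier f k)\<^sup>2)
      + (\<Sum>k\<in>{- int N..int N}. (c k - fourier f k)\<^sup>2) \<le> d\<^sup>2 * (2 * pi)"
  proof (rule has_integral_le[OF integral_minus_trig_sum[OF f]])
    show "((\<lambda>_. d\<^sup>2) has_integral d\<^sup>2 * (2 * pi)) {0..2 * pi}"
      using has_integral_const_real[of "d\<^sup>2" 0 "2 * pi"] by (simp add: mult.commute)
    fix v assume "v \<in> {0..2 * pi}"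
    from Nc[OF this] d(1) show "(f v - (\<Sum>k\<in>{- int N..int N}. c k * trig k v))\<^sup>2 \<le> d\<^sup>2"
      by (intro power2_le_iff_abs_le[THEN iffD2]) auto
  qed auto
  moreover have "0 \<le> (\<Sum>k\<in>{- int N..int N}. (c k - fourier f k)\<^sup>2)" by (intro sum_nonneg) auto
  ultimately show ?thesis using d(2) by (intro exI[of _ N]) linarith
qed

text \<open>Integration by parts; the boundary terms cancel by periodicity.\<close>

lemma fourier_deriv:
  assumes d: "\<And>v. v \<in> {0..2 * pi} \<Longrightarrow> (f has_real_derivative f' v) (at v within {0..2 * pi})"
    and f': "continuous_on {0..2 * pi} f'" and per: "f (2 * pi) = f 0"
  shows "fourier f' k = of_int k * fourier f (- k)"
proof -
  have f: "continuous_on {0..2 * pi} f" using d by (rule DERIV_continuous_on)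
  have "((\<lambda>v. f' v * trig k v + f v * (- of_int k * trig (- k) v)) has_integral
      f (2 * pi) * trig k (2 * pi) - f 0 * trig k 0) {0..2 * pi}"
  proof (rule fundamental_theorem_of_calculus)
    fix v assume "v \<in> {0..2 * pi}"
    from DERIV_mult[OF d[OF this] has_field_derivative_at_within[OF trig_deriv[of k]]]
    show "((\<lambda>v. f v * trig k v) has_vector_derivative f' v * trig k v + f v * (- of_int k * trig (- k) v)) (at v within {0..2 * pi})"
      by (simp add: mult_ac add.commute flip: has_real_derivative_iff_has_vector_derivative)
  qed simp
  then have A: "((\<lambda>v. f' v * trig k v + f v * (- of_int k * trig (- k) v)) has_integral 0) {0..2 * pi}"
    by (simp add: per trig_periodic_0)
  have B: "((\<lambda>v. f' v * trig k v + (- of_int k) * (f v * trig (- k) v)) has_integral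
      fourier f' k + (- of_int k) * fourier f (- k)) {0..2 * pi}"
    by (intro has_integral_add has_integral_mult_right has_integral_fourier f f')
  have "fourier f' k + (- of_int k) * fourier f (- k) = 0"
    by (rule has_integral_unique[OF B]) (use A in \<open>simp add: mult_ac\<close>)
  then show ?thesis by simp
qed

text \<open>The modes up to \<open>m\<close> are kept with their exact weights, and all others are
  charged the smallest weight they can have, (m + 1)^2. Bessel for \<open>f'\<close> and approximate
  Parseval for \<open>f\<close> are compared on a symmetric range of modes, because differentiation
  exchanges k and -k; the slack \<open>e\<close> comes from Parseval.\<close>

lemma wirtinger:
  assumes d: "\<And>v. v \<in> {0..2 * pi} \<Longrightarrow> (f has_real_derivative f' v) (at v within {0..2 * pi})"
    and f': "continuous_on {0..2 * pi} f'" and per: "f (2 * pi) = f 0"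
  shows "(\<Sum>k\<in>{- int m..int m}. (of_int k)\<^sup>2 * (fourier f k)\<^sup>2)
      + (real m + 1)\<^sup>2 * (integral {0..2 * pi} (\<lambda>v. (f v)\<^sup>2) - (\<Sum>k\<in>{- int m..int m}. (fourier f k)\<^sup>2))
    \<le> integral {0..2 * pi} (\<lambda>v. (f' v)\<^sup>2)" (is "?L \<le> ?R")
proof (rule field_le_epsilon)
  fix e :: real assume e: "0 < e"
  let ?I = "\<lambda>N. {- int N..int N}" and ?G = "integral {0..2 * pi} (\<lambda>v. (f v)\<^sup>2)"
  have f: "continuous_on {0..2 * pi} f" using d by (rule DERIV_continuous_on)
  obtain N0 where N0: "?G - e / (real m + 1)\<^sup>2 \<le> (\<Sum>k\<in>?I N0. (fourier f k)\<^sup>2)"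
    using parseval_approx[OF f per, of "e / (real m + 1)\<^sup>2"] e by auto
  define N where "N = max m N0"
  have sub: "?I m \<subseteq> ?I N" "?I N0 \<subseteq> ?I N" by (auto simp: N_def)
  have "(\<Sum>k\<in>?I N0. (fourier f k)\<^sup>2) \<le> (\<Sum>k\<in>?I N. (fourier f k)\<^sup>2)"
    by (rule sum_mono2) (use sub in auto)
  with N0 have N: "?G - e / (real m + 1)\<^sup>2 \<le> (\<Sum>k\<in>?I N. (fourier f k)\<^sup>2)" by simp
  have split: "(\<Sum>k\<in>?I N. g k) = (\<Sum>k\<in>?I m. g k) + (\<Sum>k\<in>?I N - ?I m. g k)" for g :: "int \<Rightarrow> real"
    using sum.subset_diff[OF sub(1), of g] by simp
  have fd: "fourier f' k = of_int k * fourier f (- k)" for k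
    by (rule fourier_deriv[OF d f' per])
  have "(\<Sum>k\<in>?I N. (fourier f' k)\<^sup>2) = (\<Sum>k\<in>?I N. (of_int k)\<^sup>2 * (fourier f k)\<^sup>2)"
    by (rule sum.reindex_bij_witness[of _ uminus uminus])
      (auto simp: fd power_mult_distrib)
  then have 1: "(\<Sum>k\<in>?I N. (of_int k)\<^sup>2 * (fourier f k)\<^sup>2) \<le> ?R" using bessel[OF f', of "?I N"] by simp
  have 2: "(\<Sum>k\<in>?I N - ?I m. (real m + 1)\<^sup>2 * (fourier f k)\<^sup>2) \<le> (\<Sum>k\<in>?I N - ?I m. (of_int k)\<^sup>2 * (fourier f k)\<^sup>2)"
  proof (intro sum_mono mult_right_mono)
    fix k assume "k \<in> ?I N - ?I m"
    then have "int m + 1 \<le> \<bar>k\<bar>" by auto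
    then have "real m + 1 \<le> \<bar>of_int k\<bar>" by linarith
    then show "(real m + 1)\<^sup>2 \<le> (of_int k)\<^sup>2" by (simp add: abs_le_square_iff[symmetric])
  qed auto
  have "(real m + 1)\<^sup>2 * (?G - (\<Sum>k\<in>?I m. (fourier f k)\<^sup>2))
      \<le> (real m + 1)\<^sup>2 * (e / (real m + 1)\<^sup>2 + (\<Sum>k\<in>?I N - ?I m. (fourier f k)\<^sup>2))"
    using N split[of "\<lambda>k. (fourier f k)\<^sup>2"] by (intro mult_left_mono) auto
  also have "\<dots> = e + (\<Sum>k\<in>?I N - ?I m. (real m + 1)\<^sup>2 * (fourier f k)\<^sup>2)"
    by (simp add: distrib_left sum_distrib_left)
  finally have 3: "(real m + 1)\<^sup>2 * (?G - (\<Sum>k\<in>?I m. (fourier f k)\<^sup>2))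
      \<le> e + (\<Sum>k\<in>?I N - ?I m. (real m + 1)\<^sup>2 * (fourier f k)\<^sup>2)" .
  show "?L \<le> ?R + e"
    using 1 2 3 split[of "\<lambda>k. (of_int k)\<^sup>2 * (fourier f k)\<^sup>2"] by linarith
qed

section \<open>Nonnegativity of the second variation under eleven conditions\<close>

text \<open>Minus twice the Gaussian curvature times the area density.\<close>

definition pot :: "real \<Rightarrow> real" where
  "pot u = 200 * u ^ 9 / (1 + u ^ 10)\<^sup>2"

text \<open>\<open>u^k * jden k u / (1 + u^10)\<close> is the Jacobi field of mode \<open>k\<close> and \<open>jlog k u\<close> is \<open>u\<close> times its
  logarithmic derivative.\<close>

definition jden :: "real \<Rightarrow> real \<Rightarrow> real" where
  "jden k u = (k + 5) + (k - 5) * u ^ 10"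

definition jlog :: "real \<Rightarrow> real \<Rightarrow> real" where
  "jlog k u = k - 100 * u ^ 10 / ((1 + u ^ 10) * jden k u)"

lemma one_plus_u10: "0 < 1 + u ^ 10" for u :: real
  by (simp add: add_pos_nonneg)

lemma pot_nonneg: "0 \<le> u \<Longrightarrow> 0 \<le> pot u"
  by (simp add: pot_def)

lemma pot_le: "0 \<le> u \<Longrightarrow> u \<le> 1 \<Longrightarrow> pot u \<le> 200"
proof -
  assume u: "0 \<le> u" "u \<le> 1"
  have "1 \<le> (1 + u ^ 10)\<^sup>2" using u by (intro one_le_power) simp
  moreover have "u ^ 9 \<le> 1" using u by (simp add: power_le_one)
  ultimately have "200 * u ^ 9 \<le> 200 * (1 + u ^ 10)\<^sup>2" by linarith
  then show ?thesis unfolding pot_def using one_plus_u10[of u]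
    by (subst pos_divide_le_eq) auto
qed

lemma continuous_on_pot: "continuous_on S pot"
  unfolding pot_def using one_plus_u10
  by (intro continuous_intros) (simp add: less_imp_neq[symmetric])

lemma jden_deriv: "(jden k has_real_derivative (k - 5) * (10 * u ^ 9)) (at u)"
  unfolding jden_def by (auto intro!: derivative_eq_intros)

text \<open>The Riccati form of the Jacobi equation: if (u f')' = (k^2 / u - pot) f, then W = u f' /
  f satisfies W' = (k^2 - W^2) / u - pot. It is checked on the closed formula.\<close>

lemma jlog_deriv:
  assumes u: "0 < u" and D: "jden k u \<noteq> 0"
  shows "(jlog k has_real_derivative (k\<^sup>2 - (jlog k u)\<^sup>2) / u - pot u) (at u)"
proof -
  define t where "t = u ^ 10"
  define A where "A = 1 + t"
  define D where "D = jden k u"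
  have t': "((\<lambda>u. u ^ 10) has_real_derivative 10 * u ^ 9) (at u)" by (auto intro!: derivative_eq_intros)
  have pos: "A \<noteq> 0" "D \<noteq> 0" using one_plus_u10[of u] D by (auto simp: A_def t_def D_def)
  \<comment> \<open>This linear relation between the two denominators reduces the Riccati equation
    to a polynomial identity.\<close>
  have Dt: "D = (k - 5) * A + 10" by (simp add: D_def A_def jden_def t_def algebra_simps)
  have 9: "u * u ^ 9 = t" by (simp add: t_def flip: power_Suc)
  have "((\<lambda>u. (1 + u ^ 10) * jden k u) has_real_derivative (10 * u ^ 9) * D + (k - 5) * (10 * u ^ 9) * A) (at u)"
    using DERIV_mult[OF DERIV_add[OF DERIV_const t'] jden_deriv[of k u]]
    by (simp add: A_def D_def t_def)
  from DERIV_diff[OF DERIV_const[of k] DERIV_divide[OF DERIV_cmult[OF t', of 100] this]] pos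
  have d: "(jlog k has_real_derivative 0 - ((100 * (10 * u ^ 9)) * (A * D) - (100 * t) * ((10 * u ^ 9) * D + (k - 5) * (10 * u ^ 9) * A))
      / ((A * D) * (A * D))) (at u)"
    unfolding jlog_def[abs_def] by (simp add: A_def D_def t_def)
  have J: "jlog k u = k - 100 * t / (A * D)" by (simp add: jlog_def A_def D_def t_def)
  have p: "pot u = 200 * u ^ 9 / (A * A)" by (simp add: pot_def A_def t_def power2_eq_square)
  define X where "X = (100 * (10 * u ^ 9)) * (A * D) - (100 * t) * ((10 * u ^ 9) * D + (k - 5) * (10 * u ^ 9) * A)"
  have "u * X = (1000 * (u * u ^ 9)) * (A * D) - (100 * t) * (10 * (u * u ^ 9) * D + (k - 5) * (10 * (u * u ^ 9)) * A)"
    unfolding X_def by (simp add: algebra_simps)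
  then have uX: "u * X = (1000 * t) * (A * D) - (100 * t) * (10 * t * D + (k - 5) * (10 * t) * A)"
    unfolding 9 .
  have 1: "(k\<^sup>2 - (k - 100 * t / (A * D))\<^sup>2) - 200 * t / (A * A)
       = (200 * k * t * (A * D) - 10000 * t * t - 200 * t * D * D) / ((A * D) * (A * D))"
    using pos by (simp add: field_simps power2_eq_square)
  have 2: "200 * k * t * (A * D) - 10000 * t * t - 200 * t * D * D =
       - ((1000 * t) * (A * D) - (100 * t) * (10 * t * D + (k - 5) * (10 * t) * A))"
    unfolding Dt unfolding A_def by (simp add: algebra_simps)
  have "u * ((k\<^sup>2 - (jlog k u)\<^sup>2) / u - pot u) = (k\<^sup>2 - (jlog k u)\<^sup>2) - 200 * (u * u ^ 9) / (A * A)"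
    unfolding p right_diff_distrib using u by simp
  then have "u * ((k\<^sup>2 - (jlog k u)\<^sup>2) / u - pot u) = - (u * X) / ((A * D) * (A * D))"
    unfolding 9 J 1 2 uX .
  then have "u * ((k\<^sup>2 - (jlog k u)\<^sup>2) / u - pot u) = u * (0 - X / ((A * D) * (A * D)))" by simp
  then have "0 - X / ((A * D) * (A * D)) = (k\<^sup>2 - (jlog k u)\<^sup>2) / u - pot u"
    using mult_left_cancel[of u] u by (metis less_irrefl)
  with d[folded X_def] show ?thesis by simp
qed

lemma jden_zero_unique:
  assumes "0 < u" "0 < w" "jden k u = 0" "jden k w = 0"
  shows "u = w"
proof -
  have "(k - 5) * u ^ 10 = (k - 5) * w ^ 10" using assms(3,4) unfolding jden_def by linarith
  moreover have "k \<noteq> 5" using assms by (auto simp: jden_def)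
  ultimately have "u ^ 10 = w ^ 10" using mult_left_cancel[of "k - 5" "u ^ 10" "w ^ 10"] by linarith
  then show ?thesis using assms(1,2) by (simp add: power_eq_iff_eq_base)
qed

text \<open>Applied with \<open>B = a\<^sup>2\<close>, \<open>A = a'\<^sup>2\<close> for one Fourier coefficient \<open>a\<close>, and with the sums of these over all
  modes \<open>\<bar>k\<bar> \<ge> 6\<close>; \<open>quad\<close> says that \<open>\<Sum> (a' + l a)\<^sup>2 \<ge> 0\<close>.\<close>

lemma picone_integral:
  fixes A B B' :: "real \<Rightarrow> real"
  assumes ab: "0 < a" "a \<le> b"
    and B: "\<And>u. u \<in> {a..b} \<Longrightarrow> (B has_real_derivative B' u) (at u)"
    and cont: "continuous_on {a..b} A" "continuous_on {a..b} B'"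
    and quad: "\<And>u l. u \<in> {a..b} \<Longrightarrow> 0 \<le> A u + l * B' u + l\<^sup>2 * B u"
    and sing: "\<And>z. z \<in> {a..b} \<Longrightarrow> jden k z = 0 \<Longrightarrow> B z = 0 \<and> ((\<lambda>u. B u / jden k u) \<longlongrightarrow> 0) (at z)"
  shows "jlog k b * B b - jlog k a * B a \<le> integral {a..b} (\<lambda>u. u * A u + (k\<^sup>2 / u - pot u) * B u)"
proof -
  \<comment> \<open>The poles of \<open>jlog k\<close> in the interval, at most one. They are
    exceptional points of the fundamental theorem of calculus, for which continuity of the primitive
    is enough.\<close>
  define Z where "Z = {u \<in> {a..b}. jden k u = 0}"
  have "finite Z"
  proof (cases "Z = {}")
    case False
    then obtain z where "z \<in> Z" by blast
    then have "Z \<subseteq> {z}" using ab jden_zero_unique[of _ z k] by (force simp: Z_def)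
    then show ?thesis by (rule finite_subset) simp
  qed simp
  let ?H' = "\<lambda>u. ((k\<^sup>2 - (jlog k u)\<^sup>2) / u - pot u) * B u + jlog k u * B' u"
  have "(?H' has_integral jlog k b * B b - jlog k a * B a) {a..b}"
  proof (rule fundamental_theorem_of_calculus_interior_strong[OF \<open>finite Z\<close> ab(2)])
    fix u assume u: "u \<in> {a<..<b} - Z"
    then have "(jlog k has_real_derivative (k\<^sup>2 - (jlog k u)\<^sup>2) / u - pot u) (at u)"
      using ab by (intro jlog_deriv) (auto simp: Z_def)
    from DERIV_mult[OF this B[of u]] u
    show "((\<lambda>u. jlog k u * B u) has_vector_derivative ?H' u) (at u)"
      by (simp add: has_real_derivative_iff_has_vector_derivative mult.commute)
  next
    show "continuous_on {a..b} (\<lambda>u. jlog k u * B u)"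
    proof (intro continuous_at_imp_continuous_on ballI)
      fix z assume z: "z \<in> {a..b}"
      have cB: "isCont B z" using B[OF z] by (rule DERIV_isCont)
      show "isCont (\<lambda>u. jlog k u * B u) z"
      proof (cases "jden k z = 0")
        case False
        then have "isCont (jlog k) z" using z ab by (intro DERIV_isCont[OF jlog_deriv]) auto
        then show ?thesis using cB by (intro continuous_intros)
      next
        case True
        \<comment> \<open>The limit removes the pole of \<open>jlog k\<close> from the product.
          Since \<open>B z = 0\<close>, the value of the product at \<open>z\<close> is 0 whatever
          division by zero returns, so it agrees with the limit.\<close>
        from sing[OF z True] have 0: "B z = 0" "((\<lambda>u. B u / jden k u) \<longlongrightarrow> 0) (at z)" by auto
        have e: "jlog k u * B u = k * B u - 100 * u ^ 10 / (1 + u ^ 10) * (B u / jden k u)" for u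
          by (simp add: jlog_def left_diff_distrib)
        have "isCont (\<lambda>u. 100 * u ^ 10 / (1 + u ^ 10)) z"
          using less_imp_neq[OF one_plus_u10[of z]] by (intro continuous_intros) simp
        then have "((\<lambda>u. jlog k u * B u) \<longlongrightarrow> k * B z - 100 * z ^ 10 / (1 + z ^ 10) * 0) (at z)"
          unfolding e using cB 0(2) unfolding isCont_def by (intro tendsto_diff tendsto_mult tendsto_const)
        then show ?thesis using 0(1) by (simp add: isCont_def)
      qed
    qed
  qed
  moreover have "((\<lambda>u. u * A u + (k\<^sup>2 / u - pot u) * B u) has_integral
      integral {a..b} (\<lambda>u. u * A u + (k\<^sup>2 / u - pot u) * B u)) {a..b}"
    using ab B by (intro integrable_integral integrable_continuous_interval continuous_intros
      continuous_on_pot cont DERIV_atLeastAtMost_imp_continuous_on) auto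
  ultimately show ?thesis
  proof (rule has_integral_le)
    fix u assume u: "u \<in> {a..b}"
    let ?W = "jlog k u"
    \<comment> \<open>The multiplier \<open>l = - ?W / u\<close> makes \<open>quad\<close> the
      square of a' - (f'/f) a, with f the Jacobi field.\<close>
    have "0 \<le> u * (A u + (- ?W / u) * B' u + (- ?W / u)\<^sup>2 * B u)"
      using u ab by (intro mult_nonneg_nonneg quad) auto
    also have "\<dots> = u * A u - ?W * B' u + ?W\<^sup>2 / u * B u"
      using u ab by (simp add: field_simps power2_eq_square)
    finally show "((k\<^sup>2 - ?W\<^sup>2) / u - pot u) * B u + ?W * B' u \<le> u * A u + (k\<^sup>2 / u - pot u) * B u"
      by (simp add: left_diff_distrib diff_divide_distrib)
  qed
qed

text \<open>A double zero divided by a simple one: for k \<noteq> 5 the derivative of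
  \<open>jden k\<close> at the positive point \<open>z\<close> is not 0.\<close>

lemma square_over_jden_tendsto:
  assumes "0 < z" "k \<noteq> 5" "jden k z = 0" "a z = 0" "(a has_real_derivative a') (at z)"
  shows "((\<lambda>u. (a u)\<^sup>2 / jden k u) \<longlongrightarrow> 0) (at z)"
proof -
  have 1: "((\<lambda>u. a u / (u - z)) \<longlongrightarrow> a') (at z)"
    using assms(4,5) by (simp add: has_field_derivative_iff)
  have 2: "((\<lambda>u. jden k u / (u - z)) \<longlongrightarrow> (k - 5) * (10 * z ^ 9)) (at z)"
    using jden_deriv[of k z] assms(3) by (simp add: has_field_derivative_iff)
  have 3: "(a \<longlongrightarrow> 0) (at z)" using DERIV_isCont[OF assms(5)] assms(4) by (simp add: isCont_def)
  have "((\<lambda>u. a u * ((a u / (u - z)) / (jden k u / (u - z)))) \<longlongrightarrow> 0 * (a' / ((k - 5) * (10 * z ^ 9)))) (at z)"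
    using assms(1,2) by (intro tendsto_intros 1 2 3) auto
  then have "((\<lambda>u. a u * ((a u / (u - z)) / (jden k u / (u - z)))) \<longlongrightarrow> 0) (at z)" by simp
  then show ?thesis
    by (rule Lim_transform_eventually) (auto simp: eventually_at_filter power2_eq_square)
qed

text \<open>Inside the unit circle \<open>jden k\<close> is positive, so the fraction in
  \<open>jlog\<close> is subtracted with the right sign. This controls the boundary terms at the
  inner radius.\<close>

lemma jlog_le: "0 < u \<Longrightarrow> u < 1 \<Longrightarrow> 0 \<le> k \<Longrightarrow> jlog k u \<le> k"
proof -
  assume u: "0 < u" "u < 1" "0 \<le> k"
  have "u ^ 10 < 1" using u by (simp add: power_less_one_iff)
  then have "0 < (k + 5) - 5 * u ^ 10 + k * u ^ 10" using u by (simp add: add_pos_nonneg)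
  then have "0 < jden k u" by (simp add: jden_def algebra_simps)
  then show ?thesis using one_plus_u10[of u] u by (simp add: jlog_def)
qed

text \<open>For k at most 4 the denominator \<open>jden k\<close> changes sign where u^10 = (5 + k)
  / (5 - k), which is at most 9, and (3/2)^10 exceeds 9. Beyond that radius the fraction in
  \<open>jlog\<close> is negative, so subtracting it adds to \<open>k\<close>.\<close>

lemma jlog_nonneg: "3 / 2 \<le> u \<Longrightarrow> 0 \<le> k \<Longrightarrow> k \<le> 4 \<Longrightarrow> 0 \<le> jlog k u"
proof -
  assume u: "3 / 2 \<le> u" "0 \<le> k" "k \<le> 4"
  have "(3 / 2) ^ 10 \<le> u ^ 10" using u by (intro power_mono) auto
  then have "9 \<le> u ^ 10" by (simp add: power_divide)
  moreover have "1 * u ^ 10 \<le> (5 - k) * u ^ 10" using u by (intro mult_right_mono) auto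
  moreover have "(k - 5) * u ^ 10 = - ((5 - k) * u ^ 10)" by (simp add: left_diff_distrib)
  ultimately have "jden k u \<le> 0" using u unfolding jden_def by linarith
  then have "100 * u ^ 10 / ((1 + u ^ 10) * jden k u) \<le> 0"
    using one_plus_u10[of u] by (intro divide_nonneg_nonpos mult_nonneg_nonpos) auto
  then show ?thesis using u by (simp add: jlog_def)
qed

lemma jlog_6_nonneg: "0 \<le> jlog 6 u"
proof -
  define t where "t = u ^ 10"
  have t: "0 \<le> t" by (simp add: t_def)
  \<comment> \<open>The polynomial 6 t^2 - 28 t + 66 after completing the square.\<close>
  have "0 \<le> 6 * (t - 7 / 3)\<^sup>2 + 100 / 3" by simp
  also have "\<dots> = 6 * ((1 + t) * (11 + t)) - 100 * t" by (simp add: power2_eq_square algebra_simps)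
  finally have "100 * t / ((1 + t) * (11 + t)) \<le> 6" using t by (simp add: divide_le_eq)
  then show ?thesis by (simp add: jlog_def jden_def t_def)
qed

text \<open>Here \<open>jlog 5\<close> equals 5 - 10 t / (1 + t) with t = u^10, which decreases in t
  from 5 towards -5.\<close>

lemma jlog_5_ge: "- 5 \<le> jlog 5 u"
proof -
  define t where "t = u ^ 10"
  have t: "0 \<le> t" by (simp add: t_def)
  have "100 * t / ((1 + t) * 10) \<le> 10" using t by (simp add: divide_le_eq)
  then show ?thesis by (simp add: jlog_def jden_def t_def)
qed

section \<open>The energy of a function on the strip, circle by circle\<close>

definition variation_density :: "(real \<times> real \<Rightarrow> real) \<Rightarrow> real \<times> real \<Rightarrow> real" where
  "variation_density \<phi> p = fst p * (pd 1 \<phi> p)\<^sup>2 + (pd 2 \<phi> p)\<^sup>2 / fst p - pot (fst p) * (\<phi> p)\<^sup>2"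

lemma Ck_on_1_slices:
  fixes \<phi> :: "real \<times> real \<Rightarrow> real"
  assumes "\<phi> differentiable (at (u, v))"
  shows "((\<lambda>u. \<phi> (u, v)) has_real_derivative pd 1 \<phi> (u, v)) (at u)"
    and "((\<lambda>v. \<phi> (u, v)) has_real_derivative pd 2 \<phi> (u, v)) (at v)"
proof -
  have 1: "((\<lambda>x. (x, v)) has_derivative (\<lambda>t. (t, 0))) (at u)"
    and 2: "((\<lambda>y. (u, y)) has_derivative (\<lambda>t. (0, t))) (at v)"
    by (intro has_derivative_Pair has_derivative_ident has_derivative_const)+
  from has_derivative_compose[OF 1 has_derivative_pd[OF assms]] has_derivative_compose[OF 2 has_derivative_pd[OF assms]]
  show "((\<lambda>u. \<phi> (u, v)) has_real_derivative pd 1 \<phi> (u, v)) (at u)"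
    "((\<lambda>v. \<phi> (u, v)) has_real_derivative pd 2 \<phi> (u, v)) (at v)"
    by (simp_all add: has_field_derivative_def mult.commute[of _ "pd _ \<phi> _"])
qed

lemma fourier_linear:
  assumes "continuous_on {0..2 * pi} f" "continuous_on {0..2 * pi} g"
  shows "fourier (\<lambda>v. f v + c * g v) k = fourier f k + c * fourier g k"
proof -
  have "((\<lambda>v. f v * trig k v + c * (g v * trig k v)) has_integral fourier f k + c * fourier g k) {0..2 * pi}"
    by (intro has_integral_add has_integral_mult_right has_integral_fourier assms)
  moreover have "(\<lambda>v. f v * trig k v + c * (g v * trig k v)) = (\<lambda>v. (f v + c * g v) * trig k v)"
    by (simp add: algebra_simps)
  ultimately show ?thesis by (simp add: fourier_def integral_unique)
qed

lemma integral_square_linear: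
  fixes f g :: "real \<Rightarrow> real"
  assumes "continuous_on {0..2 * pi} f" "continuous_on {0..2 * pi} g"
  shows "integral {0..2 * pi} (\<lambda>v. (f v + c * g v)\<^sup>2) = integral {0..2 * pi} (\<lambda>v. (f v)\<^sup>2)
    + c * integral {0..2 * pi} (\<lambda>v. 2 * g v * f v) + c\<^sup>2 * integral {0..2 * pi} (\<lambda>v. (g v)\<^sup>2)"
proof -
  have "((\<lambda>v. (f v)\<^sup>2 + c * (2 * g v * f v) + c\<^sup>2 * (g v)\<^sup>2) has_integral integral {0..2 * pi} (\<lambda>v. (f v)\<^sup>2)
    + c * integral {0..2 * pi} (\<lambda>v. 2 * g v * f v) + c\<^sup>2 * integral {0..2 * pi} (\<lambda>v. (g v)\<^sup>2)) {0..2 * pi}"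
    by (intro has_integral_add has_integral_mult_right integrable_integral integrable_continuous_interval continuous_intros assms)
  moreover have "(\<lambda>v. (f v)\<^sup>2 + c * (2 * g v * f v) + c\<^sup>2 * (g v)\<^sup>2) = (\<lambda>v. (f v + c * g v)\<^sup>2)"
    by (simp add: fun_eq_iff power2_eq_square algebra_simps)
  ultimately show ?thesis by (simp add: integral_unique)
qed

definition root_radius :: "int \<Rightarrow> real" where
  "root_radius k = root 10 ((5 + \<bar>of_int k\<bar>) / (5 - \<bar>of_int k\<bar>))"

text \<open>The largest of these radii belongs to the modes 4 and -4 and is 9^(1/10). The bound 3/2
  puts all of them inside every disc considered in the upper bounds.\<close>

lemma root_radius:
  assumes "\<bar>k\<bar> \<le> 4"
  shows "0 < root_radius k" "root_radius k < 3 / 2" "jden \<bar>of_int k\<bar> u = 0 \<Longrightarrow> 0 < u \<Longrightarrow> u = root_radius k"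
proof -
  define l :: real where "l = \<bar>of_int k\<bar>"
  have l: "0 \<le> l" "l \<le> 4" using assms unfolding l_def by linarith+
  have p: "root_radius k ^ 10 = (5 + l) / (5 - l)"
    unfolding root_radius_def l_def[symmetric] using l by (subst real_root_pow_pos2) auto
  show pos: "0 < root_radius k" unfolding root_radius_def l_def[symmetric] using l by simp
  have "(5 + l) / (5 - l) \<le> 9" using l by (simp add: divide_le_eq)
  moreover have "9 < (3 / 2 :: real) ^ 10" by (simp add: power_divide)
  ultimately have "root_radius k ^ 10 < (3 / 2) ^ 10" unfolding p by linarith
  then show "root_radius k < 3 / 2" by (rule power_less_imp_less_base) simp
  assume u: "jden \<bar>of_int k\<bar> u = 0" "0 < u"
  have "jden \<bar>of_int k\<bar> (root_radius k) = 0"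
    unfolding jden_def p l_def[symmetric] using l by (simp add: field_simps)
  then show "u = root_radius k" by (rule jden_zero_unique[OF u(2) pos u(1)])
qed

text \<open>Nothing is assumed at u = 0 or at u = R, so that test functions, functions of the
  bounded class and the trial functions of the lower bounds are all instances.\<close>

locale strip_function =
  fixes R :: real and \<phi> :: "real \<times> real \<Rightarrow> real"
  assumes C1: "Ck_on 1 (strip R) \<phi>" and per: "\<And>u v. \<phi> (u, v + 2 * pi) = \<phi> (u, v)"
begin

text \<open>All quantities are integrals over the circle of radius \<open>u\<close>. In particular
  \<open>dens u\<close> collects the whole of \<open>variation_density\<close> on that circle, so
  the second variation is a one-dimensional integral of \<open>dens\<close>.\<close>

definition "coef k u = fourier (\<lambda>v. \<phi> (u, v)) k"
definition "coef' k u = fourier (\<lambda>v. pd 1 \<phi> (u, v)) k"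
definition "nrm u = integral {0..2 * pi} (\<lambda>v. (\<phi> (u, v))\<^sup>2)"
definition "nrm' u = integral {0..2 * pi} (\<lambda>v. 2 * \<phi> (u, v) * pd 1 \<phi> (u, v))"
definition "rad u = integral {0..2 * pi} (\<lambda>v. (pd 1 \<phi> (u, v))\<^sup>2)"
definition "ang u = integral {0..2 * pi} (\<lambda>v. (pd 2 \<phi> (u, v))\<^sup>2)"
definition "dens u = u * rad u + ang u / u - pot u * nrm u"

lemma mem_strip: "(u, v) \<in> strip R \<longleftrightarrow> u \<in> {0<..<R}" by (auto simp: strip_def)

lemma diff: "u \<in> {0<..<R} \<Longrightarrow> \<phi> differentiable (at (u, v))"
  using C1 mem_strip unfolding One_nat_def Ck_on.simps by blast

lemma cont: "continuous_on (strip R) \<phi>" "continuous_on (strip R) (pd i \<phi>)"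
  using Ck_on_continuous[OF C1] C1 unfolding One_nat_def Ck_on.simps by blast+

lemma cont_prod:
  fixes h :: "real \<times> real \<Rightarrow> real"
  assumes "continuous_on (strip R) h"
  shows "continuous_on ({0<..<R} \<times> cbox 0 (2 * pi)) (\<lambda>(u, v). h (u, v))"
  using continuous_on_subset[OF assms, of "{0<..<R} \<times> cbox 0 (2 * pi)"] by (auto simp: strip_def)

lemma cont_slice:
  fixes h :: "real \<times> real \<Rightarrow> real"
  assumes "continuous_on (strip R) h" "u \<in> {0<..<R}"
  shows "continuous_on S (\<lambda>v. h (u, v))"
  by (rule continuous_on_compose2[OF assms(1)]) (use assms(2) in \<open>auto simp: mem_strip intro!: continuous_intros\<close>)

lemmas slices = cont_slice[OF cont(1)] cont_slice[OF cont(2)]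

lemma cont_integral:
  fixes h :: "real \<times> real \<Rightarrow> real"
  assumes "continuous_on (strip R) h"
  shows "continuous_on {0<..<R} (\<lambda>u. integral {0..2 * pi} (\<lambda>v. h (u, v)))"
  using integral_continuous_on_param[OF cont_prod[OF assms]] by simp

lemma cont_trig_snd: "continuous_on S (\<lambda>p. trig k (snd p))"
  by (intro continuous_intros)

lemma cont_coef: "continuous_on {0<..<R} (coef k)" "continuous_on {0<..<R} (coef' k)"
  using cont_integral[OF continuous_on_mult[OF cont(1) cont_trig_snd[of _ k]]]
    cont_integral[OF continuous_on_mult[OF cont(2)[of 1] cont_trig_snd[of _ k]]]
  by (simp_all add: coef_def[abs_def] coef'_def[abs_def] fourier_def)

lemma cont_nrm: "continuous_on {0<..<R} nrm" "continuous_on {0<..<R} nrm'"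
    "continuous_on {0<..<R} rad" "continuous_on {0<..<R} ang"
  unfolding nrm_def[abs_def] nrm'_def[abs_def] rad_def[abs_def] ang_def[abs_def]
  by (intro cont_integral continuous_intros cont)+

lemma deriv_integral:
  assumes "\<And>u v. u \<in> {0<..<R} \<Longrightarrow> ((\<lambda>u. h (u, v)) has_real_derivative h' (u, v)) (at u)"
    and "continuous_on (strip R) h" "continuous_on (strip R) h'" "u \<in> {0<..<R}"
  shows "((\<lambda>u. integral {0..2 * pi} (\<lambda>v. h (u, v))) has_real_derivative integral {0..2 * pi} (\<lambda>v. h' (u, v))) (at u)"
proof -
  have "((\<lambda>u. integral (cbox 0 (2 * pi)) (\<lambda>v. h (u, v))) has_real_derivative integral (cbox 0 (2 * pi)) (\<lambda>v. h' (u, v)))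
      (at u within {0<..<R})"
  proof (rule leibniz_rule_field_derivative[OF _ _ cont_prod[OF assms(3)] assms(4)])
    show "((\<lambda>x. h (x, t)) has_real_derivative h' (x, t)) (at x within {0<..<R})" if "x \<in> {0<..<R}" for x t
      using assms(1)[OF that] by (rule has_field_derivative_at_within)
    show "(\<lambda>v. h (x, v)) integrable_on cbox 0 (2 * pi)" if "x \<in> {0<..<R}" for x
      by (intro integrable_continuous cont_slice[OF assms(2) that])
  qed simp
  then show ?thesis using assms(4) by (simp add: at_within_open[of u "{0<..<R}"])
qed

lemma deriv_coef:
  assumes "u \<in> {0<..<R}"
  shows "(coef k has_real_derivative coef' k u) (at u)"
proof -
  have "((\<lambda>u. integral {0..2 * pi} (\<lambda>v. \<phi> (u, v) * trig k (snd (u, v)))) has_real_derivative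
      integral {0..2 * pi} (\<lambda>v. pd 1 \<phi> (u, v) * trig k (snd (u, v)))) (at u)"
    by (rule deriv_integral[where h="\<lambda>p. \<phi> p * trig k (snd p)" and h'="\<lambda>p. pd 1 \<phi> p * trig k (snd p)"])
      (use assms in \<open>auto intro!: continuous_intros cont DERIV_cmult_right Ck_on_1_slices(1) diff\<close>)
  then show ?thesis by (simp add: coef_def[abs_def] coef'_def fourier_def)
qed

lemma deriv_nrm:
  assumes "u \<in> {0<..<R}"
  shows "(nrm has_real_derivative nrm' u) (at u)"
proof -
  have "((\<lambda>u. integral {0..2 * pi} (\<lambda>v. (\<phi> (u, v))\<^sup>2)) has_real_derivative
      integral {0..2 * pi} (\<lambda>v. 2 * \<phi> (u, v) * pd 1 \<phi> (u, v))) (at u)"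
  proof (rule deriv_integral[where h="\<lambda>p. (\<phi> p)\<^sup>2" and h'="\<lambda>p. 2 * \<phi> p * pd 1 \<phi> p"])
    fix u v assume "u \<in> {0<..<R}"
    from DERIV_power[OF Ck_on_1_slices(1)[OF diff[OF this]], where n=2]
    show "((\<lambda>u. (\<phi> (u, v))\<^sup>2) has_real_derivative 2 * \<phi> (u, v) * pd 1 \<phi> (u, v)) (at u)"
      by (simp add: mult_ac)
  qed (use assms in \<open>auto intro!: continuous_intros cont\<close>)
  then show ?thesis by (simp add: nrm_def[abs_def] nrm'_def)
qed

abbreviation "modes \<equiv> {-5..5::int}"
text \<open>\<open>rest\<close> and \<open>rrest\<close> collect the contribution of the modes \<open>\<bar>k\<bar> \<ge> 6\<close>.\<close>

definition "rest u = nrm u - (\<Sum>k\<in>modes. (coef k u)\<^sup>2)"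
definition "rest' u = nrm' u - (\<Sum>k\<in>modes. 2 * coef k u * coef' k u)"
definition "rrest u = rad u - (\<Sum>k\<in>modes. (coef' k u)\<^sup>2)"

lemma deriv_rest:
  assumes "u \<in> {0<..<R}"
  shows "(rest has_real_derivative rest' u) (at u)"
proof -
  have "((\<lambda>u. (coef k u)\<^sup>2) has_real_derivative 2 * coef k u * coef' k u) (at u)" for k
    using DERIV_power[OF deriv_coef[OF assms], where n=2] by (simp add: mult_ac)
  then show ?thesis unfolding rest_def[abs_def] rest'_def
    by (intro DERIV_diff deriv_nrm[OF assms] DERIV_sum)
qed

text \<open>Bessel's inequality for \<phi>_u + l \<phi>, expanded in powers of \<open>l\<close>.
  This provides the hypothesis \<open>quad\<close> of \<open>picone_integral\<close> for the
  remainder as a whole.\<close>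

lemma rest_quadratic:
  assumes "u \<in> {0<..<R}"
  shows "0 \<le> rrest u + l * rest' u + l\<^sup>2 * rest u"
proof -
  note c = slices[OF assms]
  have "(\<Sum>k\<in>modes. (fourier (\<lambda>v. pd 1 \<phi> (u, v) + l * \<phi> (u, v)) k)\<^sup>2)
      \<le> integral {0..2 * pi} (\<lambda>v. (pd 1 \<phi> (u, v) + l * \<phi> (u, v))\<^sup>2)"
    by (intro bessel continuous_intros c) simp
  moreover have "fourier (\<lambda>v. pd 1 \<phi> (u, v) + l * \<phi> (u, v)) k = coef' k u + l * coef k u" for k
    unfolding coef_def coef'_def by (rule fourier_linear[OF c(2) c(1)])
  moreover have "integral {0..2 * pi} (\<lambda>v. (pd 1 \<phi> (u, v) + l * \<phi> (u, v))\<^sup>2) = rad u + l * nrm' u + l\<^sup>2 * nrm u"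
    unfolding rad_def nrm_def nrm'_def by (rule integral_square_linear[OF c(2) c(1)])
  moreover have "(\<Sum>k\<in>modes. (coef' k u + l * coef k u)\<^sup>2) = (\<Sum>k\<in>modes. (coef' k u)\<^sup>2)
      + l * (\<Sum>k\<in>modes. 2 * coef k u * coef' k u) + l\<^sup>2 * (\<Sum>k\<in>modes. (coef k u)\<^sup>2)"
    unfolding sum_distrib_left sum.distrib[symmetric]
    by (intro sum.cong refl) (simp add: power2_eq_square algebra_simps)
  ultimately show ?thesis unfolding rrest_def rest'_def rest_def right_diff_distrib by simp
qed

lemma rest_nonneg: "u \<in> {0<..<R} \<Longrightarrow> 0 \<le> rest u"
  unfolding rest_def nrm_def coef_def using bessel[OF slices(1), of u modes] by simp

lemma ang_ge:
  assumes "u \<in> {0<..<R}"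
  shows "(\<Sum>k\<in>modes. (of_int k)\<^sup>2 * (coef k u)\<^sup>2) + 36 * rest u \<le> ang u"
proof -
  have "(\<Sum>k\<in>{- int 5..int 5}. (of_int k)\<^sup>2 * (fourier (\<lambda>v. \<phi> (u, v)) k)\<^sup>2)
      + (real 5 + 1)\<^sup>2 * (integral {0..2 * pi} (\<lambda>v. (\<phi> (u, v))\<^sup>2) - (\<Sum>k\<in>{- int 5..int 5}. (fourier (\<lambda>v. \<phi> (u, v)) k)\<^sup>2))
    \<le> integral {0..2 * pi} (\<lambda>v. (pd 2 \<phi> (u, v))\<^sup>2)"
  proof (rule wirtinger[where f="\<lambda>v. \<phi> (u, v)" and f'="\<lambda>v. pd 2 \<phi> (u, v)" and m=5])
    show "((\<lambda>v. \<phi> (u, v)) has_real_derivative pd 2 \<phi> (u, v)) (at v within {0..2 * pi})" for v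
      by (rule has_field_derivative_at_within[OF Ck_on_1_slices(2)[OF diff[OF assms]]])
    show "continuous_on {0..2 * pi} (\<lambda>v. pd 2 \<phi> (u, v))" by (rule slices(2)[OF assms])
    show "\<phi> (u, 2 * pi) = \<phi> (u, 0)" using per[of u 0] by simp
  qed
  then show ?thesis by (simp add: ang_def coef_def rest_def nrm_def)
qed

text \<open>Wirtinger's inequality in the angle: the remainder is charged the angular energy of
  frequency 6, the lowest it contains.\<close>

lemma dens_ge:
  assumes u: "u \<in> {0<..<R}"
  shows "(\<Sum>k\<in>modes. u * (coef' k u)\<^sup>2 + (\<bar>of_int k\<bar>\<^sup>2 / u - pot u) * (coef k u)\<^sup>2)
      + (u * rrest u + (6\<^sup>2 / u - pot u) * rest u) \<le> dens u"
proof -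
  have "((\<Sum>k\<in>modes. (of_int k)\<^sup>2 * (coef k u)\<^sup>2) + 36 * rest u) / u \<le> ang u / u"
    using ang_ge[OF u] u by (intro divide_right_mono) auto
  moreover have "(\<Sum>k\<in>modes. u * (coef' k u)\<^sup>2 + (\<bar>of_int k\<bar>\<^sup>2 / u - pot u) * (coef k u)\<^sup>2) =
     u * (\<Sum>k\<in>modes. (coef' k u)\<^sup>2) + (\<Sum>k\<in>modes. (of_int k)\<^sup>2 * (coef k u)\<^sup>2) / u - pot u * (\<Sum>k\<in>modes. (coef k u)\<^sup>2)"
    unfolding sum_distrib_left sum_divide_distrib sum.distrib[symmetric] sum_subtractf[symmetric]
    by (intro sum.cong refl) (simp add: left_diff_distrib)
  moreover have "dens u = u * rrest u + u * (\<Sum>k\<in>modes. (coef' k u)\<^sup>2) + ang u / u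
      - pot u * (\<Sum>k\<in>modes. (coef k u)\<^sup>2) - pot u * rest u"
    unfolding dens_def rrest_def rest_def by (simp add: algebra_simps)
  ultimately show ?thesis by (simp add: add_divide_distrib left_diff_distrib)
qed

lemma continuous_on_dens: "continuous_on {0<..<R} dens"
  unfolding dens_def[abs_def] by (intro continuous_intros cont_nrm continuous_on_pot) auto

text \<open>\<open>picone_integral\<close> for each mode up to 5 and, with the field of mode 6, for
  the remainder. At the outer radius only the modes 5 and -5 contribute negatively; at the inner
  radius the total is bounded by the angular energy there.\<close>

lemma dens_integral_ge:
  assumes ab: "0 < a" "a < 1" "3 / 2 < b" "b < R"
    and z: "\<And>k. \<bar>k\<bar> \<le> 4 \<Longrightarrow> coef k (root_radius k) = 0"
  shows "- 5 * ((coef 5 b)\<^sup>2 + (coef (- 5) b)\<^sup>2) - ang a \<le> integral {a..b} dens"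
proof -
  have sub: "{a..b} \<subseteq> {0<..<R}" using ab by auto
  have mem: "u \<in> {0<..<R}" if "u \<in> {a..b}" for u using sub that by blast
  note cs = continuous_on_subset[OF _ sub]
  have cr: "continuous_on {0<..<R} rrest" "continuous_on {0<..<R} rest'" "continuous_on {0<..<R} rest"
    unfolding rrest_def[abs_def] rest'_def[abs_def] rest_def[abs_def]
    by (intro continuous_intros cont_nrm cont_coef)+
  let ?q = "\<lambda>k u. u * (coef' k u)\<^sup>2 + (\<bar>of_int k\<bar>\<^sup>2 / u - pot u) * (coef k u)\<^sup>2"
  have q: "jlog \<bar>of_int k\<bar> b * (coef k b)\<^sup>2 - jlog \<bar>of_int k\<bar> a * (coef k a)\<^sup>2 \<le> integral {a..b} (?q k)"
    if k: "k \<in> modes" for k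
  proof (rule picone_integral[where B'="\<lambda>u. 2 * coef k u * coef' k u" and A="\<lambda>u. (coef' k u)\<^sup>2"])
    show "((\<lambda>u. (coef k u)\<^sup>2) has_real_derivative 2 * coef k u * coef' k u) (at u)" if "u \<in> {a..b}" for u
      using DERIV_power[OF deriv_coef[OF mem[OF that]], where n=2] by (simp add: mult_ac)
    show "continuous_on {a..b} (\<lambda>u. (coef' k u)\<^sup>2)" "continuous_on {a..b} (\<lambda>u. 2 * coef k u * coef' k u)"
      by (intro continuous_intros cs cont_coef)+
    show "0 \<le> (coef' k u)\<^sup>2 + l * (2 * coef k u * coef' k u) + l\<^sup>2 * (coef k u)\<^sup>2" for u l
      using zero_le_power2[of "coef' k u + l * coef k u"] by (simp add: power2_eq_square algebra_simps)
    fix w assume w: "w \<in> {a..b}" "jden \<bar>of_int k\<bar> w = 0"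
    \<comment> \<open>\<open>jden 5\<close> is the constant 10 and has no zero.\<close>
    have "\<bar>k\<bar> \<noteq> 5"
    proof
      assume "\<bar>k\<bar> = 5"
      then have "\<bar>of_int k\<bar> = (5::real)" by linarith
      then show False using w(2) by (simp add: jden_def)
    qed
    then have k4: "\<bar>k\<bar> \<le> 4" using k by auto
    then have r: "w = root_radius k" using root_radius(3)[OF k4 w(2)] w(1) ab by auto
    then have "coef k w = 0" using z[OF k4] by simp
    moreover have "\<bar>of_int k\<bar> \<noteq> (5::real)" using k4 by linarith
    ultimately show "(coef k w)\<^sup>2 = 0 \<and> ((\<lambda>u. (coef k u)\<^sup>2 / jden \<bar>of_int k\<bar> u) \<longlongrightarrow> 0) (at w)"
      using w ab by (auto intro!: square_over_jden_tendsto deriv_coef mem)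
  qed (use ab in auto)
  have r: "jlog 6 b * rest b - jlog 6 a * rest a \<le> integral {a..b} (\<lambda>u. u * rrest u + (6\<^sup>2 / u - pot u) * rest u)"
  proof (rule picone_integral[where B'=rest'])
    show "continuous_on {a..b} rrest" "continuous_on {a..b} rest'" by (rule cs, rule cr)+
    fix w assume w: "w \<in> {a..b}" "jden 6 w = 0"
    have "0 < jden 6 w" using w(1) ab by (simp add: jden_def add_pos_nonneg)
    then show "rest w = 0 \<and> ((\<lambda>u. rest u / jden 6 u) \<longlongrightarrow> 0) (at w)" using w(2) by simp
  qed (use ab in \<open>auto intro!: deriv_rest rest_quadratic mem\<close>)
  have iq: "?q k integrable_on {a..b}" for k
    using ab by (intro integrable_continuous_interval continuous_intros cs cont_coef continuous_on_pot) auto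
  have ir: "(\<lambda>u. u * rrest u + (6\<^sup>2 / u - pot u) * rest u) integrable_on {a..b}"
    using ab by (intro integrable_continuous_interval continuous_intros cs cr continuous_on_pot) auto
  have "integral {a..b} (\<lambda>u. (\<Sum>k\<in>modes. ?q k u) + (u * rrest u + (6\<^sup>2 / u - pot u) * rest u)) \<le> integral {a..b} dens"
    by (intro integral_le integrable_add integrable_sum iq ir dens_ge mem
        integrable_continuous_interval cs continuous_on_dens) auto
  moreover have "integral {a..b} (\<lambda>u. (\<Sum>k\<in>modes. ?q k u) + (u * rrest u + (6\<^sup>2 / u - pot u) * rest u)) =
      (\<Sum>k\<in>modes. integral {a..b} (?q k)) + integral {a..b} (\<lambda>u. u * rrest u + (6\<^sup>2 / u - pot u) * rest u)"
  proof -
    have "integral {a..b} (\<lambda>u. \<Sum>k\<in>modes. ?q k u) = (\<Sum>k\<in>modes. integral {a..b} (?q k))"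
      by (intro integral_sum finite_atLeastAtMost_int iq)
    then show ?thesis
      using Henstock_Kurzweil_Integration.integral_add[OF integrable_sum[OF finite_atLeastAtMost_int iq] ir] by simp
  qed
  moreover have "(\<Sum>k\<in>modes. jlog \<bar>of_int k\<bar> b * (coef k b)\<^sup>2 - jlog \<bar>of_int k\<bar> a * (coef k a)\<^sup>2)
      \<le> (\<Sum>k\<in>modes. integral {a..b} (?q k))"
    by (intro sum_mono q)
  \<comment> \<open>Since \<open>jlog\<close> is at most the frequency and a nonnegative integer is
    at most its square, the inner boundary terms are dominated by the lower bound for
    \<open>ang a\<close>.\<close>
  moreover have "(\<Sum>k\<in>modes. jlog \<bar>of_int k\<bar> a * (coef k a)\<^sup>2) + jlog 6 a * rest a \<le> ang a"
  proof -
    have "jlog \<bar>of_int k\<bar> a * (coef k a)\<^sup>2 \<le> (of_int k)\<^sup>2 * (coef k a)\<^sup>2" for k :: int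
    proof (rule mult_right_mono)
      have "\<bar>k\<bar> \<le> k\<^sup>2"
        using self_le_power[of "\<bar>k\<bar>" 2] by (cases "k = 0") auto
      then have "of_int \<bar>k\<bar> \<le> (of_int (k\<^sup>2) :: real)" by (simp only: of_int_le_iff)
      moreover have "jlog \<bar>of_int k\<bar> a \<le> \<bar>of_int k\<bar>" using ab by (intro jlog_le) auto
      ultimately show "jlog \<bar>of_int k\<bar> a \<le> (of_int k)\<^sup>2" by simp
    qed simp
    then have "(\<Sum>k\<in>modes. jlog \<bar>of_int k\<bar> a * (coef k a)\<^sup>2) \<le> (\<Sum>k\<in>modes. (of_int k)\<^sup>2 * (coef k a)\<^sup>2)"
      by (rule sum_mono)
    moreover have "jlog 6 a * rest a \<le> 36 * rest a"
      using jlog_le[of a 6] ab by (intro mult_right_mono rest_nonneg) auto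
    ultimately show ?thesis using ang_ge[of a] ab by auto
  qed
  moreover have "- 5 * ((coef 5 b)\<^sup>2 + (coef (- 5) b)\<^sup>2) \<le> (\<Sum>k\<in>modes. jlog \<bar>of_int k\<bar> b * (coef k b)\<^sup>2) + jlog 6 b * rest b"
  proof -
    have "(\<Sum>k\<in>modes. (if \<bar>k\<bar> = 5 then - 5 * (coef k b)\<^sup>2 else 0)) \<le> (\<Sum>k\<in>modes. jlog \<bar>of_int k\<bar> b * (coef k b)\<^sup>2)"
    proof (rule sum_mono)
      fix k assume k: "k \<in> modes"
      show "(if \<bar>k\<bar> = 5 then - 5 * (coef k b)\<^sup>2 else 0) \<le> jlog \<bar>of_int k\<bar> b * (coef k b)\<^sup>2"
      proof (cases "\<bar>k\<bar> = 5")
        case True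
        then have "\<bar>of_int k\<bar> = (5::real)" by linarith
        then show ?thesis using True mult_right_mono[OF jlog_5_ge[of b], of "(coef k b)\<^sup>2"] by simp
      next
        case False
        then have "\<bar>of_int k\<bar> \<le> (4::real)" using k by auto
        then show ?thesis using False jlog_nonneg[of b "\<bar>of_int k\<bar>"] ab by simp
      qed
    qed
    moreover have "(\<Sum>k\<in>modes. (if \<bar>k\<bar> = 5 then - 5 * (coef k b)\<^sup>2 else 0)) = (\<Sum>k\<in>{-5, 5}. - 5 * (coef k b)\<^sup>2)"
      by (rule sum.mono_neutral_cong_right) auto
    moreover have "0 \<le> jlog 6 b * rest b" using jlog_6_nonneg rest_nonneg ab by (intro mult_nonneg_nonneg) auto
    ultimately show ?thesis by simp
  qed
  ultimately show ?thesis using r by (simp add: sum_subtractf)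
qed

text \<open>Otherwise \<open>ang u / u\<close> would not be integrable at 0. This disposes of the boundary terms at small radii
  without any regularity of \<open>\<phi>\<close> at the centre of the disc.\<close>

lemma ang_small:
  assumes R: "0 < R" and bd: "bounded (\<phi> ` strip R)" and int: "dens integrable_on {0..R}"
    and \<eta>: "0 < \<eta>" and d: "0 < d" "d < 1" "d < R"
  shows "\<exists>a. 0 < a \<and> a < d \<and> ang a < \<eta>"
proof (rule ccontr)
  assume "\<not> ?thesis"
  then have ge: "\<eta> \<le> ang a" if "0 < a" "a < d" for a using that by force
  obtain M where M: "\<And>p. p \<in> strip R \<Longrightarrow> \<bar>\<phi> p\<bar> \<le> M" using bd by (auto simp: bounded_iff)
  define C where "C = M\<^sup>2 * (2 * pi)"
  have nrm: "nrm u \<le> C" "0 \<le> rad u" if u: "u \<in> {0<..<R}" for u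
  proof -
    show "0 \<le> rad u" unfolding rad_def by (intro integral_nonneg integrable_continuous_interval continuous_intros slices u) auto
    have "\<bar>\<phi> (u, v)\<bar> \<le> \<bar>M\<bar>" for v using M[of "(u, v)"] u by (auto simp: mem_strip)
    then have "(\<phi> (u, v))\<^sup>2 \<le> M\<^sup>2" for v by (simp only: abs_le_square_iff)
    then have "nrm u \<le> integral {0..2 * pi} (\<lambda>_. M\<^sup>2)" unfolding nrm_def
      by (intro integral_le integrable_continuous_interval continuous_intros slices u) auto
    then show "nrm u \<le> C" by (simp add: C_def mult.commute)
  qed
  have C0: "0 \<le> C" by (simp add: C_def)
  define P where "P x = integral {0..x} dens" for x
  have "continuous_on {0..R} P" unfolding P_def[abs_def] by (rule indefinite_integral_continuous_1[OF int])
  then have "bounded (P ` {0..R})" by (intro compact_imp_bounded compact_continuous_image) auto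
  then obtain K where "\<forall>x\<in>{0..R}. \<bar>P x\<bar> \<le> K" by (auto simp: bounded_iff)
  then have K: "\<bar>P x\<bar> \<le> K" if "x \<in> {0..R}" for x using that by blast
  define e where "e = d / 2"
  have e: "0 < e" "e < d" "e < 1" "e < R" using d by (auto simp: e_def)
  \<comment> \<open>If \<open>ang\<close> stayed above \<eta>, the integral of \<open>dens\<close>
    over [a, e] with a = e exp(-T) would be at least \<eta> T - 200 C. It is at most 2 K, and this
    \<open>T\<close> is just large enough for a contradiction; 200 bounds \<open>pot\<close> on
    [0, 1].\<close>
  define T where "T = (2 * K + 200 * C + 1) / \<eta>"
  have T: "0 < T" using K[of 0] R C0 \<eta> by (auto simp: T_def intro!: divide_pos_pos add_nonneg_pos)
  define a where "a = e * exp (- T)"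
  have a: "0 < a" "a < e" using e T by (auto simp: a_def)
  have sub: "{a..e} \<subseteq> {0<..<R}" using a e by auto
  have "((\<lambda>u. \<eta> * (1 / u) - 200 * C) has_integral (\<eta> * ln e - 200 * C * e) - (\<eta> * ln a - 200 * C * a)) {a..e}"
    by (rule fundamental_theorem_of_calculus)
      (use a in \<open>auto intro!: derivative_eq_intros simp flip: has_real_derivative_iff_has_vector_derivative\<close>)
  moreover have "(dens has_integral integral {a..e} dens) {a..e}"
    by (intro integrable_integral integrable_continuous_interval continuous_on_subset[OF continuous_on_dens sub])
  ultimately have "(\<eta> * ln e - 200 * C * e) - (\<eta> * ln a - 200 * C * a) \<le> integral {a..e} dens"
  proof (rule has_integral_le)
    fix u assume u: "u \<in> {a..e}"
    then have u': "u \<in> {0<..<R}" using sub by blast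
    have "\<eta> / u \<le> ang u / u" using ge[of u] u a e by (intro divide_right_mono) auto
    moreover have "0 \<le> u * rad u" using nrm(2)[OF u'] u' by auto
    moreover have "pot u * nrm u \<le> 200 * C"
    proof -
      have "pot u * nrm u \<le> pot u * C" using nrm(1)[OF u'] u' by (intro mult_left_mono pot_nonneg) auto
      also have "\<dots> \<le> 200 * C" using pot_le[of u] u a e C0 by (intro mult_right_mono) auto
      finally show ?thesis .
    qed
    ultimately show "\<eta> * (1 / u) - 200 * C \<le> dens u" by (simp add: dens_def)
  qed
  moreover have "integral {a..e} dens = P e - P a"
  proof -
    have "integral {0..a} dens + integral {a..e} dens = integral {0..e} dens"
      by (rule Henstock_Kurzweil_Integration.integral_combine) (use a e in \<open>auto intro: integrable_on_subinterval[OF int]\<close>)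
    then show ?thesis by (simp add: P_def)
  qed
  moreover have "ln a = ln e - T" using e by (simp add: a_def ln_mult)
  moreover have "P e - P a \<le> 2 * K" using K[of e] K[of a] a e by auto
  moreover have "200 * C * e \<le> 200 * C" using e C0 by (simp add: mult_left_le)
  moreover have "0 \<le> 200 * C * a" using a C0 by simp
  ultimately have "\<eta> * T \<le> 2 * K + 200 * C" by (simp add: right_diff_distrib)
  then show False using \<eta> by (simp add: T_def)
qed

text \<open>The annulus is exhausted: the inner radius runs through radii at which
  \<open>ang\<close> happens to be small, the outer one tends to R, where the coefficients of the
  modes 5 and -5 vanish in the limit.\<close>

lemma integral_dens_nonneg:
  assumes R: "3 / 2 < R" and bd: "bounded (\<phi> ` strip R)" and int: "dens integrable_on {0..R}"
    and z: "\<And>k. \<bar>k\<bar> \<le> 4 \<Longrightarrow> coef k (root_radius k) = 0"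
    and lim: "(coef 5 \<longlongrightarrow> 0) (at_left R)" "(coef (- 5) \<longlongrightarrow> 0) (at_left R)"
  shows "0 \<le> integral {0..R} dens"
proof (rule field_le_epsilon)
  fix \<epsilon> :: real assume "0 < \<epsilon>"
  \<comment> \<open>Three errors of size \<eta> occur: the integral over [0, a], the inner boundary
    term, and the outer boundary term together with the integral over [b, R].\<close>
  define \<eta> where "\<eta> = \<epsilon> / 4"
  have \<eta>: "0 < \<eta>" using \<open>0 < \<epsilon>\<close> by (simp add: \<eta>_def)
  define P where "P x = integral {0..x} dens" for x
  have cP: "continuous_on {0..R} P" unfolding P_def[abs_def] by (rule indefinite_integral_continuous_1[OF int])
  have "0 \<in> {0..R}" "P 0 = 0" using R by (auto simp: P_def)
  with cP[unfolded continuous_on_iff, rule_format, of 0 \<eta>] \<eta>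
  obtain d where d: "0 < d" "\<forall>x\<in>{0..R}. \<bar>x\<bar> < d \<longrightarrow> \<bar>P x\<bar> < \<eta>"
    unfolding dist_real_def by auto
  obtain a where a: "0 < a" "a < min d (1 / 2)" "ang a < \<eta>"
  proof -
    have "0 < R" "0 < min d (1 / 2)" "min d (1 / 2) < 1" "min d (1 / 2) < R"
      using R d(1) by (auto simp: min_def)
    from ang_small[OF this(1) bd int \<eta> this(2-4)] show ?thesis using that by blast
  qed
  have "((\<lambda>b. - 5 * ((coef 5 b)\<^sup>2 + (coef (- 5) b)\<^sup>2) + (P R - P b)) \<longlongrightarrow> - 5 * (0\<^sup>2 + 0\<^sup>2) + (P R - P R)) (at_left R)"
  proof (intro tendsto_intros lim)
    have "(P \<longlongrightarrow> P R) (at R within {0..R})" using cP R by (simp add: continuous_on)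
    then show "(P \<longlongrightarrow> P R) (at_left R)"
      using R by (simp add: at_within_Icc_at_left)
  qed
  then have "eventually (\<lambda>b. - \<eta> < - 5 * ((coef 5 b)\<^sup>2 + (coef (- 5) b)\<^sup>2) + (P R - P b)) (at_left R)"
    by (rule order_tendstoD) (use \<eta> in simp)
  moreover have "eventually (\<lambda>b. b \<in> {3 / 2<..<R}) (at_left R)" by (rule eventually_at_left_real[OF R])
  ultimately have "eventually (\<lambda>b. b \<in> {3 / 2<..<R} \<and> - \<eta> < - 5 * ((coef 5 b)\<^sup>2 + (coef (- 5) b)\<^sup>2) + (P R - P b)) (at_left R)"
    by eventually_elim auto
  then obtain b where b: "3 / 2 < b" "b < R" "- \<eta> < - 5 * ((coef 5 b)\<^sup>2 + (coef (- 5) b)\<^sup>2) + (P R - P b)"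
    using eventually_happens[of _ "at_left R"] by (auto simp: trivial_limit_at_left_real)
  have sub: "dens integrable_on {0..b}" using integrable_on_subinterval[OF int] b by auto
  have "integral {0..a} dens + integral {a..b} dens = integral {0..b} dens"
    by (rule Henstock_Kurzweil_Integration.integral_combine[OF _ _ sub]) (use a b in auto)
  then have "P b = P a + integral {a..b} dens" by (simp add: P_def)
  moreover have "- 5 * ((coef 5 b)\<^sup>2 + (coef (- 5) b)\<^sup>2) - ang a \<le> integral {a..b} dens"
    using a b by (intro dens_integral_ge z) auto
  moreover have "\<bar>P a\<bar> < \<eta>" using d(2) a b by auto
  ultimately have "- (3 * \<eta>) \<le> P R" using a(3) b(3) by linarith
  then show "0 \<le> integral {0..R} dens + \<epsilon>" using \<open>0 < \<epsilon>\<close> by (simp add: P_def \<eta>_def)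
qed

text \<open>Fubini; integrability in the plane yields integrability of \<open>dens\<close>. The
  half-open period and the open radius interval differ from the closed ones by null sets.\<close>

lemma integral_variation_density:
  assumes "set_integrable lborel ({0<..<R} \<times> {0..<2 * pi}) (variation_density \<phi>)"
  shows "dens integrable_on {0..R}"
    "(LINT p:{0<..<R} \<times> {0..<2 * pi}|lborel. variation_density \<phi> p) = integral {0..R} dens"
proof -
  let ?I = "\<lambda>p. indicator ({0<..<R} \<times> {0..<2 * pi}) p *\<^sub>R variation_density \<phi> p"
  have int: "integrable (lborel \<Otimes>\<^sub>M lborel) ?I"
    using assms by (simp add: set_integrable_def lborel_prod)
  have in_eq: "(LINT v|lborel. ?I (u, v)) = indicator {0<..<R} u *\<^sub>R dens u" for u
  proof (cases "u \<in> {0<..<R}")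
    case True
    have vd: "variation_density \<phi> (u, v) = u * (pd 1 \<phi> (u, v))\<^sup>2 + (pd 2 \<phi> (u, v))\<^sup>2 * (1 / u) - pot u * (\<phi> (u, v))\<^sup>2" for v
      by (simp add: variation_density_def)
    have c: "continuous_on {0..2 * pi} (\<lambda>v. variation_density \<phi> (u, v))"
      unfolding vd by (intro continuous_intros slices True)
    have s: "set_integrable lborel {0..<2 * pi} (\<lambda>v. variation_density \<phi> (u, v))"
      by (rule set_integrable_subset[OF borel_integrable_atLeastAtMost'[OF c]]) auto
    have "(LINT v|lborel. ?I (u, v)) = (LINT v:{0..<2 * pi}|lborel. variation_density \<phi> (u, v))"
      unfolding set_lebesgue_integral_def using True
      by (intro Bochner_Integration.integral_cong) (auto simp: indicator_def)
    also have "\<dots> = integral {0..<2 * pi} (\<lambda>v. variation_density \<phi> (u, v))"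
      by (rule set_borel_integral_eq_integral(2)[OF s])
    also have "\<dots> = integral {0..2 * pi} (\<lambda>v. variation_density \<phi> (u, v))"
      by (rule integral_spike_set; rule negligible_subset[of "{2 * pi}"]) auto
    also have "\<dots> = dens u"
    proof -
      have "((\<lambda>v. u * (pd 1 \<phi> (u, v))\<^sup>2 + (pd 2 \<phi> (u, v))\<^sup>2 * (1 / u) - pot u * (\<phi> (u, v))\<^sup>2) has_integral
          u * rad u + ang u * (1 / u) - pot u * nrm u) {0..2 * pi}"
        unfolding rad_def ang_def nrm_def
        by (intro has_integral_add has_integral_diff has_integral_mult_right has_integral_mult_left
            integrable_integral integrable_continuous_interval continuous_intros slices True)
      then show ?thesis unfolding vd by (simp add: integral_unique dens_def)
    qed
    finally show ?thesis using True by simp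
  next
    case False
    then have 0: "?I (u, v) = 0" for v by auto
    show ?thesis unfolding 0 using False by simp
  qed
  have "integrable lborel (\<lambda>u. LINT v|lborel. ?I (u, v))" by (rule lborel_pair.integrable_fst'[OF int])
  then have si: "set_integrable lborel {0<..<R} dens" unfolding in_eq by (simp add: set_integrable_def)
  have "dens integrable_on {0<..<R}" by (rule set_borel_integral_eq_integral(1)[OF si])
  then show "dens integrable_on {0..R}" by (simp add: integrable_on_Icc_iff_Ioo)
  have "(LINT p:{0<..<R} \<times> {0..<2 * pi}|lborel. variation_density \<phi> p) = (LINT u|lborel. LINT v|lborel. ?I (u, v))"
    using lborel_pair.integral_fst'[OF int] by (simp add: set_lebesgue_integral_def lborel_prod)
  also have "\<dots> = (LINT u:{0<..<R}|lborel. dens u)" unfolding in_eq by (simp add: set_lebesgue_integral_def)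
  also have "\<dots> = integral {0<..<R} dens" by (rule set_borel_integral_eq_integral(2)[OF si])
  finally show "(LINT p:{0<..<R} \<times> {0..<2 * pi}|lborel. variation_density \<phi> p) = integral {0..R} dens"
    by (simp add: integral_open_interval_real)
qed

lemma variation_nonneg:
  assumes "3 / 2 < R" "bounded (\<phi> ` strip R)"
    and "\<And>k. \<bar>k\<bar> \<le> 4 \<Longrightarrow> coef k (root_radius k) = 0"
    and "(coef 5 \<longlongrightarrow> 0) (at_left R)" "(coef (- 5) \<longlongrightarrow> 0) (at_left R)"
  shows "0 \<le> (LINT p:{0<..<R} \<times> {0..<2 * pi}|lborel. variation_density \<phi> p)"
proof (cases "set_integrable lborel ({0<..<R} \<times> {0..<2 * pi}) (variation_density \<phi>)")
  case True
  then show ?thesis using integral_variation_density integral_dens_nonneg assms by simp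
next
  \<comment> \<open>A density that is not integrable has integral 0 by the convention of the
    Lebesgue integral.\<close>
  case False
  then show ?thesis by (simp add: set_integrable_def set_lebesgue_integral_def not_integrable_integral_eq)
qed

end

section \<open>Polar coordinates\<close>

text \<open>The change of variables formula of the library is stated for \<open>real^'n\<close>.\<close>

definition plane :: "real^2 \<Rightarrow> real \<times> real" where "plane x = (x $ 1, x $ 2)"

lemma continuous_on_plane: "continuous_on S plane"
  unfolding plane_def[abs_def] by (intro continuous_intros)

lemma plane_measurable [measurable]: "plane \<in> borel_measurable borel"
  by (rule borel_measurable_continuous_onI[OF continuous_on_plane])

lemma plane_surj: "plane (vector [a, b]) = (a, b)" by (simp add: plane_def)

lemma Basis_real_2: "(Basis :: (real^2) set) = {axis 1 1, axis 2 1}"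
  by (auto simp: Basis_vec_def UNIV_2)

text \<open>\<open>plane\<close> carries boxes to boxes with the same side lengths, and Lebesgue
  measure is determined by the volumes of boxes.\<close>

lemma distr_plane: "distr lborel borel plane = (lborel :: (real \<times> real) measure)"
proof (rule lborel_eqI[symmetric])
  fix l u :: "real \<times> real" assume lu: "\<And>b. b \<in> Basis \<Longrightarrow> l \<bullet> b \<le> u \<bullet> b"
  have 1: "fst l \<le> fst u" "snd l \<le> snd u"
    using lu[of "(1, 0)"] lu[of "(0, 1)"] by (auto simp: Basis_prod_def inner_prod_def)
  let ?l = "vector [fst l, snd l] :: real^2" and ?u = "vector [fst u, snd u] :: real^2"
  have ne: "axis 1 1 \<noteq> (axis 2 1 :: real^2)" by (simp add: axis_eq_axis)
  have "emeasure (distr lborel borel plane) (box l u) = emeasure lborel (plane -` box l u)"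
    by (subst emeasure_distr) auto
  also have "plane -` box l u = box ?l ?u"
    by (auto simp: box_def Basis_real_2 inner_axis Basis_prod_def inner_prod_def plane_def)
  also have "emeasure lborel (box ?l ?u) = (\<Prod>b\<in>Basis. (?u - ?l) \<bullet> b)"
    using 1 by (intro emeasure_lborel_box) (auto simp: Basis_real_2 inner_axis)
  also have "(\<Prod>b\<in>Basis. (?u - ?l) \<bullet> b) = (fst u - fst l) * (snd u - snd l)"
    by (simp add: Basis_real_2 ne inner_axis)
  also have "\<dots> = (\<Prod>b\<in>Basis. (u - l) \<bullet> b)"
  proof -
    have B: "(Basis :: (real \<times> real) set) = {(1, 0), (0, 1)}" by (auto simp: Basis_prod_def)
    show ?thesis unfolding B by (simp add: inner_prod_def)
  qed
  finally show "emeasure (distr lborel borel plane) (box l u) = (\<Prod>b\<in>Basis. (u - l) \<bullet> b)" .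
qed simp

lemma integrable_plane:
  fixes f :: "real \<times> real \<Rightarrow> real"
  assumes "f \<in> borel_measurable borel"
  shows "integrable lborel (\<lambda>x. f (plane x)) \<longleftrightarrow> integrable lborel f"
    "(LINT x|lborel. f (plane x)) = (LINT p|lborel. f p)"
proof -
  show "integrable lborel (\<lambda>x. f (plane x)) \<longleftrightarrow> integrable lborel f"
    by (subst distr_plane[symmetric], subst integrable_distr_eq) (use assms in auto)
  show "(LINT x|lborel. f (plane x)) = (LINT p|lborel. f p)"
    by (subst distr_plane[symmetric], subst integral_distr) (use assms in auto)
qed

definition polar2 :: "real^2 \<Rightarrow> real^2" where
  "polar2 x = vector [x $ 1 * cos (x $ 2), x $ 1 * sin (x $ 2)]"

lemma plane_polar2: "plane (polar2 x) = polar (plane x)"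
  by (simp add: plane_def polar2_def polar_def)

lemma vector_2_axis: "vector [a, b] = a *\<^sub>R axis 1 1 + b *\<^sub>R (axis 2 1 :: real^2)"
  by (simp add: vec_eq_iff forall_2 axis_def)

lemma polar2_deriv:
  "(polar2 has_derivative (\<lambda>h. vector [h $ 1 * cos (x $ 2) - h $ 2 * (x $ 1 * sin (x $ 2)),
      h $ 1 * sin (x $ 2) + h $ 2 * (x $ 1 * cos (x $ 2))])) (at x within S)"
proof -
  have n: "((\<lambda>x. x $ i) has_derivative (\<lambda>h. h $ i)) (at x within S)" for i :: 2
    by (rule bounded_linear.has_derivative[OF bounded_linear_vec_nth has_derivative_ident])
  show ?thesis
    unfolding polar2_def[abs_def] vector_2_axis
    by (rule derivative_eq_intros n refl | simp add: fun_eq_iff algebra_simps)+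
qed

lemma polar2_det:
  fixes x :: "real^2"
  shows "det (matrix (\<lambda>h. vector [h $ 1 * cos (x $ 2) - h $ 2 * (x $ 1 * sin (x $ 2)),
      h $ 1 * sin (x $ 2) + h $ 2 * (x $ 1 * cos (x $ 2))] :: real^2)) = x $ 1"
proof -
  have cs: "cos (x $ 2) * cos (x $ 2) + sin (x $ 2) * sin (x $ 2) = 1"
    by (simp flip: power2_eq_square)
  have "x $ 1 * (cos (x $ 2) * cos (x $ 2)) + x $ 1 * (sin (x $ 2) * sin (x $ 2)) = x $ 1"
    by (simp only: distrib_left[symmetric] cs mult_1_right)
  then show ?thesis by (simp add: det_2 matrix_def axis_def algebra_simps)
qed

lemma mem_disc: "(x, y) \<in> disc R \<longleftrightarrow> sqrt (x\<^sup>2 + y\<^sup>2) < R"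
  by (simp add: disc_def dist_prod_def dist_real_def)

lemma polar_mem_disc: "0 \<le> u \<Longrightarrow> polar (u, v) \<in> disc R \<longleftrightarrow> u < R"
  by (simp add: polar_def mem_disc power_mult_distrib flip: distrib_left)

lemma polar_eq_0: "polar (u, v) = 0 \<longleftrightarrow> u = 0"
proof
  assume "polar (u, v) = 0"
  then have "u * cos v = 0" "u * sin v = 0" by (auto simp: polar_def zero_prod_def)
  then show "u = 0" using sin_zero_abs_cos_one[of v] by auto
qed (simp add: polar_def zero_prod_def)

lemma polar_inj: "inj_on polar ({0<..<R} \<times> {c..<c + 2 * pi})"
proof (rule inj_onI, clarify)
  fix u v u' v' assume uv: "u \<in> {0<..<R}" "v \<in> {c..<c + 2 * pi}" "u' \<in> {0<..<R}" "v' \<in> {c..<c + 2 * pi}"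
    and eq: "polar (u, v) = polar (u', v')"
  have e: "u * cos v = u' * cos v'" "u * sin v = u' * sin v'" using eq by (auto simp: polar_def)
  have "(u * cos v)\<^sup>2 + (u * sin v)\<^sup>2 = (u' * cos v')\<^sup>2 + (u' * sin v')\<^sup>2" unfolding e ..
  then have "u\<^sup>2 = u'\<^sup>2" unfolding power_mult_distrib distrib_left[symmetric] by simp
  then have u: "u = u'" using uv by (simp add: power2_eq_iff_nonneg)
  then have "cos v = cos v' \<and> sin v = sin v'" using e uv by auto
  then have "sin v = sin v' \<and> cos v = cos v'" by simp
  then obtain n where n: "v = v' + 2 * pi * of_int n" by (auto simp: sin_cos_eq_iff)
  have "n = 0"
  proof (rule ccontr)
    assume "n \<noteq> 0"
    then have "1 \<le> \<bar>of_int n :: real\<bar>" by linarith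
    then have "2 * pi * 1 \<le> 2 * pi * \<bar>of_int n\<bar>" by (rule mult_left_mono) simp
    moreover have "v - v' < 2 * pi" "v' - v < 2 * pi" using uv by auto
    moreover have "\<bar>v - v'\<bar> = 2 * pi * \<bar>of_int n\<bar>" using n by (simp add: abs_mult)
    ultimately show False by linarith
  qed
  then show "u = u' \<and> v = v'" using u n by simp
qed

lemma polar_image: "polar ` ({0<..<R} \<times> {c..<c + 2 * pi}) = disc R - {0}"
proof
  show "polar ` ({0<..<R} \<times> {c..<c + 2 * pi}) \<subseteq> disc R - {0}"
    using polar_mem_disc polar_eq_0 by (force simp del: split_paired_All)
  show "disc R - {0} \<subseteq> polar ` ({0<..<R} \<times> {c..<c + 2 * pi})"
  proof
    fix p :: "real \<times> real" assume p: "p \<in> disc R - {0}"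
    obtain x y where xp: "p = (x, y)" by (cases p)
    then have xy: "(x, y) \<in> disc R" "(x, y) \<noteq> 0" using p by auto
    define u where "u = sqrt (x\<^sup>2 + y\<^sup>2)"
    have u: "0 < u" "u < R" using xy by (auto simp: u_def mem_disc zero_prod_def sum_power2_gt_zero_iff)
    have "x\<^sup>2 + y\<^sup>2 = u\<^sup>2" by (simp add: u_def)
    then have "(x / u)\<^sup>2 + (y / u)\<^sup>2 = 1"
      unfolding power_divide add_divide_distrib[symmetric] using u by simp
    then obtain t where t: "x / u = cos t" "y / u = sin t" by (rule sincos_total_2pi)
    define m where "m = \<lceil>(c - t) / (2 * pi)\<rceil>"
    define v where "v = t + 2 * pi * of_int m"
    have "(c - t) / (2 * pi) \<le> of_int m" "of_int m < (c - t) / (2 * pi) + 1" unfolding m_def by linarith+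
    then have "v \<in> {c..<c + 2 * pi}" by (auto simp: v_def field_simps)
    moreover have "polar (u, v) = (x, y)"
      using t u sin_cos_eq_iff[of v t] by (auto simp: polar_def v_def field_simps)
    ultimately show "p \<in> polar ` ({0<..<R} \<times> {c..<c + 2 * pi})" using u xp by force
  qed
qed

text \<open>The angle may start at any \<open>c\<close>: compact subsets of the strip can spread
  over several periods, and each period gives another copy of the disc.\<close>

lemma polar_integral:
  fixes H :: "real \<times> real \<Rightarrow> real"
  assumes "set_integrable lborel (disc R) H"
  shows "set_integrable lborel ({0<..<R} \<times> {c..<c + 2 * pi}) (\<lambda>p. fst p * H (polar p))"
    "(LINT p:{0<..<R} \<times> {c..<c + 2 * pi}|lborel. fst p * H (polar p)) = (LINT p:disc R|lborel. H p)"
proof -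
  let ?P = "{0<..<R} \<times> {c..<c + 2 * pi}"
  \<comment> \<open>The origin is taken out because no point with positive radius is mapped to it; a
    single point does not change the integral.\<close>
  define H0 where "H0 p = indicator (disc R - {0}) p * H p" for p
  have si: "set_integrable lborel (disc R - {0}) H"
    by (rule set_integrable_subset[OF assms]) (auto simp: disc_def)
  then have int0: "integrable lborel H0" by (simp add: H0_def[abs_def] set_integrable_def)
  then have meas: "H0 \<in> borel_measurable borel" by auto
  have pm: "polar \<in> borel_measurable borel"
    unfolding polar_def case_prod_beta by (intro borel_measurable_continuous_onI continuous_intros)
  have "AE p in lborel. p \<noteq> (0 :: real \<times> real)" by (rule AE_lborel_singleton)
  then have "AE p in lborel. indicator (disc R) p *\<^sub>R H p = indicator (disc R - {0}) p *\<^sub>R H p"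
    by eventually_elim (auto simp: indicator_def)
  then have "(LINT p:disc R|lborel. H p) = (LINT p:(disc R - {0})|lborel. H p)"
    using assms si unfolding set_lebesgue_integral_def set_integrable_def
    by (intro integral_cong_AE) auto
  then have I0: "(LINT p:disc R|lborel. H p) = (LINT p|lborel. H0 p)"
    by (simp add: H0_def[abs_def] set_lebesgue_integral_def)
  define S where "S = plane -` ?P"
  have Pb: "?P \<in> sets borel" by (simp add: borel_Times)
  have Sb: "S \<in> sets borel" unfolding S_def using measurable_sets[OF plane_measurable Pb] by simp
  have imS: "plane ` (polar2 ` S) = disc R - {0}"
  proof -
    have "plane ` S = ?P" unfolding S_def using plane_surj by (auto simp: image_iff) (metis plane_surj)+
    then show ?thesis unfolding image_image plane_polar2 using polar_image[of R c] by (metis image_image)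
  qed
  have inj: "inj_on polar2 S"
  proof (rule inj_onI)
    fix x y assume "x \<in> S" "y \<in> S" "polar2 x = polar2 y"
    then have "plane x = plane y"
      using polar_inj[of R c] unfolding S_def inj_on_def by (metis plane_polar2 vimageE)
    then show "x = y" by (simp add: plane_def vec_eq_iff forall_2)
  qed
  \<comment> \<open>The change of variables theorem is stated for vector-valued integrands, hence
    the type \<open>real^1\<close>.\<close>
  define f where "f x = (vec (H0 (plane x)) :: real^1)" for x
  have abs_int: "integrable lebesgue (\<lambda>x. H0 (plane x))" "integral\<^sup>L lebesgue (\<lambda>x. H0 (plane x)) = (LINT p|lborel. H0 p)"
    using integrable_plane[OF meas] int0 meas by (simp_all add: integrable_completion integral_completion)
  have off: "indicator (polar2 ` S) x *\<^sub>R H0 (plane x) = H0 (plane x)" for x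
  proof (cases "x \<in> polar2 ` S")
    case False
    have "plane x \<notin> disc R - {0}"
    proof
      assume "plane x \<in> disc R - {0}"
      then obtain y where "y \<in> polar2 ` S" "plane x = plane y" using imS by (metis imageE)
      moreover from this(2) have "x = y" by (simp add: plane_def vec_eq_iff forall_2)
      ultimately show False using False by simp
    qed
    then show ?thesis by (simp add: H0_def)
  qed simp
  have a1: "(\<lambda>x. H0 (plane x)) absolutely_integrable_on (polar2 ` S)"
    using abs_int(1) by (simp only: set_integrable_def off)
  have b1: "integral (polar2 ` S) (\<lambda>x. H0 (plane x)) = (LINT p|lborel. H0 p)"
    using set_lebesgue_integral_eq_integral(2)[OF a1] abs_int(2) by (simp only: set_lebesgue_integral_def off)
  let ?D = "\<lambda>x. x $ 1 * H0 (plane (polar2 x))"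
  let ?g' = "\<lambda>x h. vector [h $ 1 * cos (x $ 2) - h $ 2 * (x $ 1 * sin (x $ 2)),
      h $ 1 * sin (x $ 2) + h $ 2 * (x $ 1 * cos (x $ 2))] :: real^2"
  have "(\<lambda>x. \<bar>det (matrix (?g' x))\<bar> *\<^sub>R f (polar2 x)) absolutely_integrable_on S \<and>
      integral S (\<lambda>x. \<bar>det (matrix (?g' x))\<bar> *\<^sub>R f (polar2 x)) = vec (LINT p|lborel. H0 p)
    \<longleftrightarrow> f absolutely_integrable_on (polar2 ` S) \<and> integral (polar2 ` S) f = vec (LINT p|lborel. H0 p)"
    by (rule has_absolute_integral_change_of_variables[OF _ polar2_deriv inj]) (use Sb in auto)
  then have cv: "(\<lambda>x. \<bar>x $ 1\<bar> * H0 (plane (polar2 x))) absolutely_integrable_on S \<and>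
      integral S (\<lambda>x. \<bar>x $ 1\<bar> * H0 (plane (polar2 x))) = (LINT p|lborel. H0 p)"
    unfolding polar2_det f_def absolutely_integrable_on_1_iff integral_on_1_eq using a1 b1 by simp
  have eqS: "indicator S x *\<^sub>R (\<bar>x $ 1\<bar> * H0 (plane (polar2 x))) = indicator ?P (plane x) *\<^sub>R (fst (plane x) * H (polar (plane x)))" for x
  proof (cases "x \<in> S")
    case True
    then have "plane x \<in> ?P" by (simp add: S_def)
    then have "polar (plane x) \<in> disc R - {0}" "0 < x $ 1" using polar_image[of R c] by (auto simp: plane_def)
    moreover have "fst (plane x) = x $ 1" by (simp add: plane_def)
    ultimately show ?thesis unfolding plane_polar2 using True \<open>plane x \<in> ?P\<close> by (simp add: H0_def)
  qed (simp add: S_def)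
  have eqP: "indicator ?P p *\<^sub>R (fst p * H (polar p)) = indicator ?P p * (fst p * H0 (polar p))" for p
  proof (cases "p \<in> ?P")
    case True
    then have "polar p \<in> disc R - {0}" using polar_image[of R c] by blast
    then show ?thesis by (simp add: H0_def)
  qed simp
  have mP: "(\<lambda>p. indicator ?P p *\<^sub>R (fst p * H (polar p))) \<in> borel_measurable borel"
    unfolding eqP using Pb measurable_compose[OF pm meas]
    by (intro borel_measurable_times borel_measurable_indicator) (auto intro!: borel_measurable_continuous_onI continuous_intros)
  have mS: "(\<lambda>x. indicator ?P (plane x) *\<^sub>R (fst (plane x) * H (polar (plane x)))) \<in> borel_measurable borel"
    using measurable_compose[OF plane_measurable mP] .
  have "integrable lebesgue (\<lambda>x. indicator ?P (plane x) *\<^sub>R (fst (plane x) * H (polar (plane x))))"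
    using cv unfolding set_integrable_def eqS by blast
  then have iP: "integrable lborel (\<lambda>p. indicator ?P p *\<^sub>R (fst p * H (polar p)))"
    using integrable_plane(1)[OF mP] mS by (simp add: integrable_completion)
  then show "set_integrable lborel ?P (\<lambda>p. fst p * H (polar p))" by (simp add: set_integrable_def)
  have "(LINT p|lborel. H0 p) = integral\<^sup>L lebesgue (\<lambda>x. indicator ?P (plane x) *\<^sub>R (fst (plane x) * H (polar (plane x))))"
    using cv set_lebesgue_integral_eq_integral(2)[of S "\<lambda>x. \<bar>x $ 1\<bar> * H0 (plane (polar2 x))"]
    unfolding set_lebesgue_integral_def eqS by simp
  also have "\<dots> = (LINT p|lborel. indicator ?P p *\<^sub>R (fst p * H (polar p)))"
    using integrable_plane(2)[OF mP] mS by (simp add: integral_completion)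
  finally show "(LINT p:?P|lborel. fst p * H (polar p)) = (LINT p:disc R|lborel. H p)"
    using I0 by (simp add: set_lebesgue_integral_def)
qed

section \<open>The second variation on the Sobolev space\<close>

definition L2fun :: "'a measure \<Rightarrow> ('a \<Rightarrow> real) \<Rightarrow> bool" where
  "L2fun M f \<longleftrightarrow> f \<in> borel_measurable M \<and> integrable M (\<lambda>x. (f x)\<^sup>2)"

lemma L2fun_add:
  assumes "L2fun M f" "L2fun M g"
  shows "L2fun M (\<lambda>x. f x + g x)"
    "(\<integral>x. (f x + g x)\<^sup>2 \<partial>M) \<le> 2 * (\<integral>x. (f x)\<^sup>2 \<partial>M) + 2 * (\<integral>x. (g x)\<^sup>2 \<partial>M)"
proof -
  have [measurable]: "f \<in> borel_measurable M" "g \<in> borel_measurable M"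
    and i: "integrable M (\<lambda>x. (f x)\<^sup>2)" "integrable M (\<lambda>x. (g x)\<^sup>2)" using assms by (auto simp: L2fun_def)
  have le: "(f x + g x)\<^sup>2 \<le> 2 * (f x)\<^sup>2 + 2 * (g x)\<^sup>2" for x
    using zero_le_power2[of "f x - g x"] by (simp add: power2_eq_square algebra_simps)
  have i2: "integrable M (\<lambda>x. 2 * (f x)\<^sup>2 + 2 * (g x)\<^sup>2)" using i by simp
  have i3: "integrable M (\<lambda>x. (f x + g x)\<^sup>2)"
    by (rule Bochner_Integration.integrable_bound[OF i2]) (auto intro!: AE_I2 order_trans[OF le])
  then show "L2fun M (\<lambda>x. f x + g x)" by (simp add: L2fun_def)
  have "(\<integral>x. (f x + g x)\<^sup>2 \<partial>M) \<le> (\<integral>x. 2 * (f x)\<^sup>2 + 2 * (g x)\<^sup>2 \<partial>M)"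
    by (rule integral_mono[OF i3 i2 le])
  then show "(\<integral>x. (f x + g x)\<^sup>2 \<partial>M) \<le> 2 * (\<integral>x. (f x)\<^sup>2 \<partial>M) + 2 * (\<integral>x. (g x)\<^sup>2 \<partial>M)"
    using i by simp
qed

lemma L2fun_cmult: "L2fun M f \<Longrightarrow> L2fun M (\<lambda>x. c * f x)"
  by (auto simp: L2fun_def power_mult_distrib)

lemma L2fun_diff: "L2fun M f \<Longrightarrow> L2fun M g \<Longrightarrow> L2fun M (\<lambda>x. f x - g x)"
  using L2fun_add(1)[of M f "\<lambda>x. -1 * g x"] L2fun_cmult[of M g "-1"] by simp

lemma L2fun_sum: "(\<And>i. i \<in> I \<Longrightarrow> L2fun M (f i)) \<Longrightarrow> L2fun M (\<lambda>x. \<Sum>i\<in>I. f i x)"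
  by (induction I rule: infinite_finite_induct) (auto intro: L2fun_add(1) simp: L2fun_def[of _ "\<lambda>_. 0"])

text \<open>Young's inequality with a free parameter \<open>e\<close>, in the role of the
  Cauchy-Schwarz inequality.\<close>

lemma L2fun_mult:
  assumes "L2fun M f" "L2fun M g"
  shows "integrable M (\<lambda>x. f x * g x)"
    "0 < e \<Longrightarrow> \<bar>\<integral>x. f x * g x \<partial>M\<bar> \<le> (\<integral>x. (f x)\<^sup>2 \<partial>M) / e + e * (\<integral>x. (g x)\<^sup>2 \<partial>M)"
proof -
  have [measurable]: "f \<in> borel_measurable M" "g \<in> borel_measurable M"
    and i: "integrable M (\<lambda>x. (f x)\<^sup>2)" "integrable M (\<lambda>x. (g x)\<^sup>2)" using assms by (auto simp: L2fun_def)
  have le: "\<bar>f x * g x\<bar> \<le> (f x)\<^sup>2 / e + e * (g x)\<^sup>2" if e: "0 < e" for e x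
  proof -
    have "\<bar>f x * g x\<bar> * e \<le> 2 * (\<bar>f x * g x\<bar> * e)" using e by simp
    also have "\<dots> \<le> (f x)\<^sup>2 + e\<^sup>2 * (g x)\<^sup>2"
      using zero_le_power2[of "\<bar>f x\<bar> - e * \<bar>g x\<bar>"] by (simp add: power2_eq_square algebra_simps abs_mult)
    finally have "\<bar>f x * g x\<bar> \<le> ((f x)\<^sup>2 + e\<^sup>2 * (g x)\<^sup>2) / e" using e by (simp add: pos_le_divide_eq)
    also have "\<dots> = (f x)\<^sup>2 / e + e * (g x)\<^sup>2" using e by (simp add: add_divide_distrib power2_eq_square)
    finally show ?thesis .
  qed
  have i2: "integrable M (\<lambda>x. (f x)\<^sup>2 / e + e * (g x)\<^sup>2)" for e using i by simp
  show i3: "integrable M (\<lambda>x. f x * g x)"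
    by (rule Bochner_Integration.integrable_bound[OF i2[of 1]]) (use le[of 1] in \<open>auto intro!: AE_I2 intro: order_trans\<close>)
  assume e: "0 < e"
  have "\<bar>\<integral>x. f x * g x \<partial>M\<bar> \<le> (\<integral>x. \<bar>f x * g x\<bar> \<partial>M)" by (rule integral_abs_bound)
  also have "\<dots> \<le> (\<integral>x. (f x)\<^sup>2 / e + e * (g x)\<^sup>2 \<partial>M)"
    by (rule integral_mono[OF integrable_abs[OF i3] i2 le[OF e]])
  finally show "\<bar>\<integral>x. f x * g x \<partial>M\<bar> \<le> (\<integral>x. (f x)\<^sup>2 \<partial>M) / e + e * (\<integral>x. (g x)\<^sup>2 \<partial>M)"
    using i by simp
qed

definition L2null :: "'a measure \<Rightarrow> (nat \<Rightarrow> 'a \<Rightarrow> real) \<Rightarrow> bool" where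
  "L2null M X \<longleftrightarrow> (\<forall>k. L2fun M (X k)) \<and> (\<lambda>k. \<integral>x. (X k x)\<^sup>2 \<partial>M) \<longlonglongrightarrow> 0"

lemma L2null_add:
  assumes "L2null M X" "L2null M Y"
  shows "L2null M (\<lambda>k x. X k x + Y k x)"
  unfolding L2null_def
proof
  show "\<forall>k. L2fun M (\<lambda>x. X k x + Y k x)" using assms by (auto simp: L2null_def intro: L2fun_add(1))
  have "(\<lambda>k. 2 * (\<integral>x. (X k x)\<^sup>2 \<partial>M) + 2 * (\<integral>x. (Y k x)\<^sup>2 \<partial>M)) \<longlonglongrightarrow> 2 * 0 + 2 * 0"
    using assms unfolding L2null_def by (intro tendsto_intros) auto
  then have lim: "(\<lambda>k. 2 * (\<integral>x. (X k x)\<^sup>2 \<partial>M) + 2 * (\<integral>x. (Y k x)\<^sup>2 \<partial>M)) \<longlonglongrightarrow> 0" by simp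
  have "0 \<le> (\<integral>x. (X k x + Y k x)\<^sup>2 \<partial>M)" for k by (rule Bochner_Integration.integral_nonneg) simp
  moreover have "(\<integral>x. (X k x + Y k x)\<^sup>2 \<partial>M) \<le> 2 * (\<integral>x. (X k x)\<^sup>2 \<partial>M) + 2 * (\<integral>x. (Y k x)\<^sup>2 \<partial>M)" for k
    using assms by (intro L2fun_add(2)) (auto simp: L2null_def)
  ultimately show "(\<lambda>k. \<integral>x. (X k x + Y k x)\<^sup>2 \<partial>M) \<longlonglongrightarrow> 0"
    by (intro Lim_null_comparison[OF _ lim]) simp
qed

lemma L2null_cmult:
  assumes "L2null M X" "c \<longlonglongrightarrow> l"
  shows "L2null M (\<lambda>k x. c k * X k x)"
proof -
  have "(\<lambda>k. (c k)\<^sup>2 * (\<integral>x. (X k x)\<^sup>2 \<partial>M)) \<longlonglongrightarrow> l\<^sup>2 * 0"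
    using assms unfolding L2null_def by (intro tendsto_intros) auto
  then show ?thesis using assms L2fun_cmult by (auto simp: L2null_def power_mult_distrib)
qed

lemma L2null_const:
  assumes "L2fun M f" "c \<longlonglongrightarrow> 0"
  shows "L2null M (\<lambda>k x. c k * f x)"
proof -
  have "(\<lambda>k. (c k)\<^sup>2 * (\<integral>x. (f x)\<^sup>2 \<partial>M)) \<longlonglongrightarrow> 0\<^sup>2 * (\<integral>x. (f x)\<^sup>2 \<partial>M)"
    using assms by (intro tendsto_intros)
  then show ?thesis using assms L2fun_cmult by (auto simp: L2null_def power_mult_distrib)
qed

lemma L2null_sum:
  "(\<And>i. i \<in> I \<Longrightarrow> L2null M (X i)) \<Longrightarrow> L2null M (\<lambda>k x. \<Sum>i\<in>I. X i k x)"
proof (induction I rule: infinite_finite_induct)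
  case (insert i I)
  then show ?case using L2null_add[of M "X i" "\<lambda>k x. \<Sum>i\<in>I. X i k x"] by simp
qed (auto simp: L2null_def L2fun_def)

lemma L2null_mult_tendsto:
  assumes X: "L2null M X" and g: "L2fun M g"
  shows "(\<lambda>k. \<integral>x. X k x * g x \<partial>M) \<longlonglongrightarrow> 0"
proof (rule tendstoI)
  fix r :: real assume r: "0 < r"
  let ?B = "\<integral>x. (g x)\<^sup>2 \<partial>M"
  have B: "0 \<le> ?B" by (rule Bochner_Integration.integral_nonneg) simp
  \<comment> \<open>Chosen from \<open>g\<close> alone so that the second term of Young's inequality
    stays below r/2; the 1 keeps the denominator positive.\<close>
  define e where "e = r / (2 * (?B + 1))"
  have e: "0 < e" using r B by (simp add: e_def add_nonneg_pos)
  have "e * ?B \<le> r / 2"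
  proof -
    have "e * ?B \<le> e * (?B + 1)" using e by simp
    also have "\<dots> = r / 2"
    proof -
      have "r / (2 * c) * c = r / 2" if "c \<noteq> 0" for c using that by simp
      moreover have "?B + 1 \<noteq> 0" using B by linarith
      ultimately show ?thesis unfolding e_def by blast
    qed
    finally show ?thesis .
  qed
  have "(\<lambda>k. \<integral>x. (X k x)\<^sup>2 \<partial>M) \<longlonglongrightarrow> 0" using X by (simp add: L2null_def)
  then have "(\<lambda>k. (\<integral>x. (X k x)\<^sup>2 \<partial>M) / e) \<longlonglongrightarrow> 0 / e" using e by (intro tendsto_intros) auto
  then have "\<forall>\<^sub>F k in sequentially. (\<integral>x. (X k x)\<^sup>2 \<partial>M) / e < r / 2"
    by (rule order_tendstoD) (use r in simp)
  then show "\<forall>\<^sub>F k in sequentially. dist (\<integral>x. X k x * g x \<partial>M) 0 < r"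
  proof eventually_elim
    case (elim k)
    have "\<bar>\<integral>x. X k x * g x \<partial>M\<bar> \<le> (\<integral>x. (X k x)\<^sup>2 \<partial>M) / e + e * ?B"
      using X by (intro L2fun_mult(2)[OF _ g e]) (simp add: L2null_def)
    with elim \<open>e * ?B \<le> r / 2\<close> show ?case
      unfolding dist_real_def diff_0_right by linarith
  qed
qed

lemma L2fun_weight:
  assumes "L2fun M f" and [measurable]: "\<rho> \<in> borel_measurable M" and "\<And>x. \<bar>\<rho> x\<bar> \<le> C"
  shows "L2fun M (\<lambda>x. \<rho> x * f x)" "integrable M (\<lambda>x. \<rho> x * (f x)\<^sup>2)"
    "\<bar>\<integral>x. \<rho> x * (f x)\<^sup>2 \<partial>M\<bar> \<le> C * (\<integral>x. (f x)\<^sup>2 \<partial>M)"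
proof -
  have [measurable]: "f \<in> borel_measurable M" and i: "integrable M (\<lambda>x. (f x)\<^sup>2)"
    using assms by (auto simp: L2fun_def)
  have C: "0 \<le> C" using assms(3) abs_ge_zero order_trans by blast
  have i2: "integrable M (\<lambda>x. C\<^sup>2 * (f x)\<^sup>2)" "integrable M (\<lambda>x. C * (f x)\<^sup>2)" using i by auto
  have "(\<rho> x)\<^sup>2 \<le> C\<^sup>2" for x using assms(3)[of x] C by (simp add: power2_le_iff_abs_le)
  then have "integrable M (\<lambda>x. (\<rho> x * f x)\<^sup>2)"
    by (intro Bochner_Integration.integrable_bound[OF i2(1)]) (auto intro!: AE_I2 mult_right_mono simp: power_mult_distrib)
  then show "L2fun M (\<lambda>x. \<rho> x * f x)" by (simp add: L2fun_def)
  have le: "\<bar>\<rho> x * (f x)\<^sup>2\<bar> \<le> C * (f x)\<^sup>2" for x using assms(3)[of x] by (simp add: abs_mult mult_right_mono)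
  show i3: "integrable M (\<lambda>x. \<rho> x * (f x)\<^sup>2)"
    by (rule Bochner_Integration.integrable_bound[OF i2(2)]) (use le C in \<open>auto intro!: AE_I2 simp: abs_mult\<close>)
  have "\<bar>\<integral>x. \<rho> x * (f x)\<^sup>2 \<partial>M\<bar> \<le> (\<integral>x. \<bar>\<rho> x * (f x)\<^sup>2\<bar> \<partial>M)" by (rule integral_abs_bound)
  also have "\<dots> \<le> (\<integral>x. C * (f x)\<^sup>2 \<partial>M)" by (rule integral_mono[OF integrable_abs[OF i3] i2(2) le])
  finally show "\<bar>\<integral>x. \<rho> x * (f x)\<^sup>2 \<partial>M\<bar> \<le> C * (\<integral>x. (f x)\<^sup>2 \<partial>M)" by simp
qed

text \<open>Write h = g - (g - h) and expand the square: the cross term tends to 0 by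
  \<open>L2null_mult_tendsto\<close>, the last term because the weight is bounded.\<close>

lemma L2_weighted_square_tendsto:
  assumes g: "L2fun M g" and X: "L2null M (\<lambda>k x. g x - h k x)"
    and \<rho>: "\<rho> \<in> borel_measurable M" "\<And>x. \<bar>\<rho> x\<bar> \<le> C"
  shows "(\<lambda>k. \<integral>x. \<rho> x * (h k x)\<^sup>2 \<partial>M) \<longlonglongrightarrow> (\<integral>x. \<rho> x * (g x)\<^sup>2 \<partial>M)"
proof -
  have Xk: "L2fun M (\<lambda>x. g x - h k x)" for k using X by (simp add: L2null_def)
  note rg = L2fun_weight[OF g \<rho>] and rX = L2fun_weight[OF Xk \<rho>]
  have "(\<integral>x. \<rho> x * (h k x)\<^sup>2 \<partial>M) = (\<integral>x. \<rho> x * (g x)\<^sup>2 \<partial>M) - 2 * (\<integral>x. (g x - h k x) * (\<rho> x * g x) \<partial>M)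
      + (\<integral>x. \<rho> x * (g x - h k x)\<^sup>2 \<partial>M)" for k
  proof -
    have "(\<lambda>x. \<rho> x * (h k x)\<^sup>2) = (\<lambda>x. \<rho> x * (g x)\<^sup>2 - 2 * ((g x - h k x) * (\<rho> x * g x)) + \<rho> x * (g x - h k x)\<^sup>2)"
      by (simp add: fun_eq_iff power2_eq_square algebra_simps)
    then show ?thesis using rg(2) rX(2)[of k] L2fun_mult(1)[OF Xk rg(1), of k] by simp
  qed
  moreover have "(\<lambda>k. \<integral>x. \<rho> x * (g x - h k x)\<^sup>2 \<partial>M) \<longlonglongrightarrow> 0"
  proof (rule Lim_null_comparison)
    show "\<forall>\<^sub>F k in sequentially. norm (\<integral>x. \<rho> x * (g x - h k x)\<^sup>2 \<partial>M) \<le> C * (\<integral>x. (g x - h k x)\<^sup>2 \<partial>M)"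
      using rX(3) by simp
    show "(\<lambda>k. C * (\<integral>x. (g x - h k x)\<^sup>2 \<partial>M)) \<longlonglongrightarrow> 0"
      using X by (auto simp: L2null_def intro!: tendsto_mult_right_zero)
  qed
  moreover have "(\<lambda>k. \<integral>x. (g x - h k x) * (\<rho> x * g x) \<partial>M) \<longlonglongrightarrow> 0"
    by (rule L2null_mult_tendsto[OF X rg(1)])
  ultimately have "(\<lambda>k. \<integral>x. \<rho> x * (h k x)\<^sup>2 \<partial>M) \<longlonglongrightarrow> (\<integral>x. \<rho> x * (g x)\<^sup>2 \<partial>M) - 2 * 0 + 0"
    by (simp only:) (intro tendsto_intros)
  then show ?thesis by simp
qed

text \<open>Turns integrals over a set into integrals over the plane, so that the statements about
  \<open>L2fun\<close> apply with the single measure \<open>lborel\<close>.\<close>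

definition zero_ext :: "(real \<times> real) set \<Rightarrow> (real \<times> real \<Rightarrow> real) \<Rightarrow> real \<times> real \<Rightarrow> real" where
  "zero_ext S f p = indicator S p * f p"

lemma L2_on_iff: "f \<in> L2_on S \<longleftrightarrow> L2fun lborel (zero_ext S f)"
proof -
  have "(\<lambda>p. (zero_ext S f p)\<^sup>2) = (\<lambda>p. indicator S p *\<^sub>R (f p)\<^sup>2)" by (auto simp: zero_ext_def indicator_def)
  then show ?thesis
    by (simp add: L2_on_def L2fun_def set_borel_measurable_def set_integrable_def zero_ext_def[abs_def])
qed

lemma zero_ext_square: "(LINT p:S|lborel. (f p)\<^sup>2) = (LINT p|lborel. (zero_ext S f p)\<^sup>2)"
  unfolding set_lebesgue_integral_def by (rule Bochner_Integration.integral_cong) (auto simp: zero_ext_def indicator_def)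

text \<open>Local integrability gives measurability on each compact box, and countably many such
  boxes cover \<open>S\<close>. For the chosen function \<open>weak_pd\<close> this is the source of
  measurability.\<close>

lemma locally_integrable_measurable:
  assumes "open S" "locally_integrable S g"
  shows "zero_ext S g \<in> borel_measurable lborel"
proof -
  obtain D where D: "countable D" "D \<subseteq> Pow S" "\<And>X. X \<in> D \<Longrightarrow> \<exists>a b. X = cbox a b" "\<Union>D = S"
    using open_countable_Union_open_cbox[OF \<open>open S\<close>] by metis
  show ?thesis
  proof (rule measurable_piecewise_restrict[of "insert (- S) D"])
    show "countable (insert (- S) D)" using D(1) by simp
    show "space lborel \<subseteq> \<Union> (insert (- S) D)" using D(4) by auto
    fix X assume X: "X \<in> insert (- S) D"
    then show Xb: "X \<inter> space lborel \<in> sets lborel" using D(3)[of X] assms(1) by auto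
    show "zero_ext S g \<in> borel_measurable (restrict_space lborel X)"
    proof (cases "X = - S")
      case True
      have "(\<lambda>x. indicator X x *\<^sub>R zero_ext S g x) = (\<lambda>_. 0)" using True by (auto simp: zero_ext_def indicator_def)
      then show ?thesis using Xb by (subst borel_measurable_restrict_space_iff) auto
    next
      case False
      then obtain a b where ab: "X = cbox a b" "X \<subseteq> S" using D X by blast
      then have "set_integrable lborel X g" using assms(2) by (auto simp: locally_integrable_def)
      moreover have "(\<lambda>x. indicator X x *\<^sub>R zero_ext S g x) = (\<lambda>x. indicator X x *\<^sub>R g x)"
      proof
        fix x show "indicator X x *\<^sub>R zero_ext S g x = indicator X x *\<^sub>R g x"
          using ab by (cases "x \<in> X"; cases "x \<in> S") (auto simp: zero_ext_def)
      qed
      ultimately show ?thesis using Xb by (subst borel_measurable_restrict_space_iff) (auto simp: set_integrable_def)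
    qed
  qed
qed

lemma weak_pd_measurable:
  assumes "open S" "is_weak_pd i S f g"
  shows "zero_ext S (weak_pd i S f) \<in> borel_measurable lborel"
proof -
  have "is_weak_pd i S f (weak_pd i S f)" unfolding weak_pd_def by (rule someI[of "is_weak_pd i S f", OF assms(2)])
  then show ?thesis using locally_integrable_measurable[OF assms(1)] by (auto simp: is_weak_pd_def)
qed

section \<open>The second variation in terms of given weak derivatives\<close>

lemma strip_open [simp]: "open (strip R)" by (simp add: strip_def open_Times)
lemma disc_open [simp]: "open (disc R)" by (simp add: disc_def)

text \<open>Almost everywhere uniqueness of weak derivatives. The integrands are first rewritten
  with zero extensions, so that both are measurable on the plane and their integrals may be
  compared.\<close>

lemma second_variation_weak:
  assumes w: "is_weak_pd 1 (strip R) (f \<circ> polar) G1" "is_weak_pd 2 (strip R) (f \<circ> polar) G2"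
  shows "second_variation 5 R f = (LINT p:{0<..<R} \<times> {0..<2 * pi}|lborel.
     fst p * (G1 p)\<^sup>2 + (G2 p)\<^sup>2 / fst p - pot (fst p) * (f (polar p))\<^sup>2)"
proof -
  let ?P = "{0<..<R} \<times> {0..<2 * pi}" and ?S = "strip R"
  define T where "T a b p = indicator ?P p *\<^sub>R (fst p * (zero_ext ?S a p)\<^sup>2 + (zero_ext ?S b p)\<^sup>2 / fst p
    - pot (fst p) * (zero_ext ?S (f \<circ> polar) p)\<^sup>2)" for a b p
  have P: "?P \<subseteq> ?S" by (auto simp: strip_def)
  have T: "(LINT p:?P|lborel. fst p * (a p)\<^sup>2 + (b p)\<^sup>2 / fst p - pot (fst p) * (f (polar p))\<^sup>2) = (LINT p|lborel. T a b p)" for a b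
    unfolding set_lebesgue_integral_def T_def using P
    by (intro Bochner_Integration.integral_cong) (auto simp: zero_ext_def indicator_def)
  have m: "T a b \<in> borel_measurable lborel" if "zero_ext ?S a \<in> borel_measurable lborel" "zero_ext ?S b \<in> borel_measurable lborel" for a b
  proof -
    have [measurable]: "zero_ext ?S (f \<circ> polar) \<in> borel_measurable borel"
      using locally_integrable_measurable[of ?S "f \<circ> polar"] w(1) by (simp add: is_weak_pd_def)
    have [measurable]: "zero_ext ?S a \<in> borel_measurable borel" "zero_ext ?S b \<in> borel_measurable borel" using that by auto
    have [measurable]: "pot \<in> borel_measurable borel" by (rule borel_measurable_continuous_onI[OF continuous_on_pot])
    have [measurable]: "?P \<in> sets borel" by (simp add: borel_Times)
    have [measurable]: "fst \<in> borel_measurable (borel :: (real \<times> real) measure)"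
      by (intro borel_measurable_continuous_onI continuous_intros)
    show ?thesis unfolding T_def by measurable
  qed
  have "(LINT p|lborel. T (weak_pd 1 ?S (f \<circ> polar)) (weak_pd 2 ?S (f \<circ> polar)) p) = (LINT p|lborel. T G1 G2 p)"
  proof (rule integral_cong_AE)
    show "T (weak_pd 1 ?S (f \<circ> polar)) (weak_pd 2 ?S (f \<circ> polar)) \<in> borel_measurable lborel"
      by (intro m weak_pd_measurable[OF strip_open w(1)] weak_pd_measurable[OF strip_open w(2)])
    show "T G1 G2 \<in> borel_measurable lborel"
      using w by (intro m locally_integrable_measurable) (auto simp: is_weak_pd_def)
    show "AE p in lborel. T (weak_pd 1 ?S (f \<circ> polar)) (weak_pd 2 ?S (f \<circ> polar)) p = T G1 G2 p"
      using weak_pd_AE[OF strip_open w(1)] weak_pd_AE[OF strip_open w(2)]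
      by eventually_elim (auto simp: T_def zero_ext_def indicator_def)
  qed
  then show ?thesis
    unfolding second_variation_5 T[symmetric] by (simp add: pot_def)
qed

lemma second_variation_classical:
  assumes "Ck_on 1 (strip R) (f \<circ> polar)"
  shows "second_variation 5 R f = (LINT p:{0<..<R} \<times> {0..<2 * pi}|lborel. variation_density (f \<circ> polar) p)"
  using second_variation_weak[OF is_weak_pd_classical[OF strip_open assms, of 1] is_weak_pd_classical[OF strip_open assms, of 2]]
  by (simp add: variation_density_def)

section \<open>Square integrability through polar coordinates\<close>

lemma strip_compact:
  assumes "compact K" "K \<subseteq> strip R"
  shows "\<exists>e>0. \<exists>N::nat. \<forall>p\<in>K. e \<le> fst p \<and> fst p < R \<and> \<bar>snd p\<bar> < 2 * pi * real N"
proof (cases "K = {}")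
  case False
  obtain p0 where p0: "p0 \<in> K" "\<forall>p\<in>K. fst p0 \<le> fst p"
    using continuous_attains_inf[OF assms(1) False continuous_on_fst[OF continuous_on_id]] by blast
  obtain B where B: "\<forall>p\<in>K. \<bar>snd p\<bar> \<le> B"
    using compact_imp_bounded[OF compact_continuous_image[OF continuous_on_snd[OF continuous_on_id] assms(1)]]
    by (auto simp: bounded_iff)
  obtain N :: nat where N: "B / (2 * pi) < real N" using reals_Archimedean2 by blast
  then have "B < 2 * pi * real N" by (simp add: divide_less_eq mult.commute)
  moreover have "0 < fst p0" "\<And>p. p \<in> K \<Longrightarrow> fst p < R" using assms(2) p0(1) by (auto simp: strip_def)
  ultimately have "\<forall>p\<in>K. fst p0 \<le> fst p \<and> fst p < R \<and> \<bar>snd p\<bar> < 2 * pi * real N"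
    using p0(2) B by (meson le_less_trans)
  with \<open>0 < fst p0\<close> show ?thesis by blast
qed (auto intro: exI[of _ 1])

lemma polar_measurable [measurable]: "polar \<in> borel_measurable borel"
  unfolding polar_def case_prod_beta by (intro borel_measurable_continuous_onI continuous_intros)

lemma polar_strip: "p \<in> strip R \<Longrightarrow> polar p \<in> disc R"
  by (cases p) (auto simp: strip_def polar_mem_disc)

text \<open>On the compact set the Jacobian \<open>u\<close> is at least some e > 0, and the set
  meets only finitely many periods, each of which contributes one integral over the disc; hence C is
  their number divided by \<open>e\<close>. It does not depend on \<open>X\<close>, so null
  sequences are preserved.\<close>

lemma L2fun_polar:
  assumes K: "compact K" "K \<subseteq> strip R"
  shows "\<exists>C. \<forall>X. L2fun lborel (zero_ext (disc R) X) \<longrightarrow> L2fun lborel (zero_ext K (X \<circ> polar)) \<and>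
    (LINT p|lborel. (zero_ext K (X \<circ> polar) p)\<^sup>2) \<le> C * (LINT p|lborel. (zero_ext (disc R) X p)\<^sup>2)"
proof -
  obtain e N where e: "0 < e" and eN: "\<And>p. p \<in> K \<Longrightarrow> e \<le> fst p \<and> fst p < R \<and> \<bar>snd p\<bar> < 2 * pi * real N"
    using strip_compact[OF K] by blast
  let ?J = "{- int N..<int N}"
  let ?P = "\<lambda>j::int. {0<..<R} \<times> {2 * pi * of_int j..<2 * pi * of_int j + 2 * pi}"
  have "L2fun lborel (zero_ext K (X \<circ> polar)) \<and>
    (LINT p|lborel. (zero_ext K (X \<circ> polar) p)\<^sup>2) \<le> (real (card ?J) / e) * (LINT p|lborel. (zero_ext (disc R) X p)\<^sup>2)"
    if X: "L2fun lborel (zero_ext (disc R) X)" for X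
  proof -
    have m: "zero_ext (disc R) X \<in> borel_measurable borel" using X by (simp add: L2fun_def)
    have sq: "(zero_ext (disc R) X p)\<^sup>2 = indicator (disc R) p *\<^sub>R (X p)\<^sup>2" for p by (auto simp: zero_ext_def indicator_def)
    have H: "set_integrable lborel (disc R) (\<lambda>p. (X p)\<^sup>2)"
      using X unfolding L2fun_def sq by (simp add: set_integrable_def)
    define T where "T p = (\<Sum>j\<in>?J. (1 / e) * (indicator (?P j) p *\<^sub>R (fst p * (X (polar p))\<^sup>2)))" for p
    have iT: "integrable lborel (\<lambda>p. indicator (?P j) p *\<^sub>R (fst p * (X (polar p))\<^sup>2))"
      "(LINT p|lborel. indicator (?P j) p *\<^sub>R (fst p * (X (polar p))\<^sup>2)) = (LINT p|lborel. (zero_ext (disc R) X p)\<^sup>2)" for j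
      using polar_integral[OF H, of "2 * pi * of_int j"] unfolding sq
      by (simp_all add: set_integrable_def set_lebesgue_integral_def)
    have T: "integrable lborel T" "(LINT p|lborel. T p) = (real (card ?J) / e) * (LINT p|lborel. (zero_ext (disc R) X p)\<^sup>2)"
      unfolding T_def using iT by (auto simp: Bochner_Integration.integral_sum)
    have le: "(zero_ext K (X \<circ> polar) p)\<^sup>2 \<le> T p" for p
    proof (cases "p \<in> K")
      case True
      obtain u v where p: "p = (u, v)" by (cases p)
      have uv: "e \<le> u" "u < R" "\<bar>v\<bar> < 2 * pi * real N" using eN[OF True] by (auto simp: p)
      define j where "j = \<lfloor>v / (2 * pi)\<rfloor>"
      have "of_int j \<le> v / (2 * pi)" "v / (2 * pi) < of_int j + 1" unfolding j_def by linarith+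
      then have j: "2 * pi * of_int j \<le> v" "v < 2 * pi * of_int j + 2 * pi" by (auto simp: field_simps)
      have "- real N \<le> v / (2 * pi)" "v / (2 * pi) < real N" using uv(3) by (auto simp: field_simps)
      then have "j \<in> ?J" unfolding j_def by (simp add: le_floor_iff floor_less_iff)
      moreover have "p \<in> ?P j" using uv j e by (simp add: p)
      ultimately have "(1 / e) * (u * (X (polar p))\<^sup>2) \<le> T p" unfolding T_def
        using e by (intro order_trans[OF _ member_le_sum[of j]]) (auto simp: p)
      moreover have "1 * (X (polar p))\<^sup>2 \<le> (u / e) * (X (polar p))\<^sup>2"
        using uv e by (intro mult_right_mono) auto
      ultimately show ?thesis using True by (simp add: zero_ext_def)
    next
      case False
      then show ?thesis using e unfolding T_def by (auto simp: zero_ext_def indicator_def intro!: sum_nonneg)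
    qed
    have eq: "zero_ext K (X \<circ> polar) = (\<lambda>p. indicator K p * zero_ext (disc R) X (polar p))"
      using K(2) polar_strip by (auto simp: fun_eq_iff zero_ext_def indicator_def simp del: split_paired_All)
    have "K \<in> sets borel" using K(1) by (simp add: compact_imp_closed)
    then have mK: "zero_ext K (X \<circ> polar) \<in> borel_measurable lborel"
      unfolding eq using measurable_compose[OF polar_measurable m] by simp
    then have iK: "integrable lborel (\<lambda>p. (zero_ext K (X \<circ> polar) p)\<^sup>2)"
      by (intro Bochner_Integration.integrable_bound[OF T(1)]) (use le in \<open>auto intro!: AE_I2 order_trans[OF le] simp del: split_paired_All\<close>)
    have "(LINT p|lborel. (zero_ext K (X \<circ> polar) p)\<^sup>2) \<le> (LINT p|lborel. T p)"
      by (rule integral_mono[OF iK T(1) le])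
    then show ?thesis using mK iK T(2) by (simp add: L2fun_def)
  qed
  then show ?thesis by blast
qed

lemma L2fun_compact_support:
  fixes b :: "real \<times> real \<Rightarrow> real"
  assumes "compact K" "continuous_on K b" "\<And>p. p \<notin> K \<Longrightarrow> b p = 0"
  shows "L2fun lborel b"
proof -
  have "set_integrable lborel UNIV b" "set_integrable lborel UNIV (\<lambda>p. (b p)\<^sup>2)"
    using assms by (auto intro!: set_integrable_compact_support[of K] continuous_intros)
  then show ?thesis by (auto simp: L2fun_def set_integrable_def)
qed

lemma L2fun_zero_ext_continuous:
  fixes b :: "real \<times> real \<Rightarrow> real"
  assumes "compact K" "continuous_on K b"
  shows "L2fun lborel (zero_ext K b)"
proof (rule L2fun_compact_support[OF assms(1)])
  show "continuous_on K (zero_ext K b)"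
    by (rule continuous_on_eq[OF assms(2)]) (simp add: zero_ext_def)
qed (simp add: zero_ext_def)

text \<open>The pairing through which the identity defining weak derivatives is passed to the limit.
  The function \<open>b\<close> will be the derivative of a test function, or a test function times
  a coefficient of the polar chain rule.\<close>

definition pair_strip :: "real \<Rightarrow> (real \<times> real \<Rightarrow> real) \<Rightarrow> (real \<times> real \<Rightarrow> real) \<Rightarrow> real" where
  "pair_strip R X b = (LINT p:strip R|lborel. X (polar p) * b p)"

context
  fixes R :: real and K :: "(real \<times> real) set" and b :: "real \<times> real \<Rightarrow> real"
  assumes K: "compact K" "K \<subseteq> strip R" and b: "continuous_on UNIV b" "\<And>p. p \<notin> K \<Longrightarrow> b p = 0"
begin

lemma zero_ext_pair: "indicator (strip R) p *\<^sub>R (X (polar p) * b p) = zero_ext K (X \<circ> polar) p * b p"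
  using K(2) b(2)[of p] by (cases "p \<in> K") (auto simp: zero_ext_def)

lemma L2_b: "L2fun lborel b"
  by (rule L2fun_compact_support[OF K(1) continuous_on_subset[OF b(1)]]) (auto simp: b(2))

lemma pair_integrable:
  assumes "L2fun lborel (zero_ext (disc R) X)"
  shows "set_integrable lborel (strip R) (\<lambda>p. X (polar p) * b p)"
  unfolding set_integrable_def zero_ext_pair
  using L2fun_polar[OF K] assms by (intro L2fun_mult(1) L2_b) blast

lemma pair_diff:
  assumes "L2fun lborel (zero_ext (disc R) X)" "L2fun lborel (zero_ext (disc R) Y)"
  shows "pair_strip R (\<lambda>p. X p - Y p) b = pair_strip R X b - pair_strip R Y b"
  unfolding pair_strip_def left_diff_distrib by (rule set_integral_diff(2)) (intro pair_integrable assms)+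

lemma pair_tendsto_0:
  assumes "L2null lborel (\<lambda>k. zero_ext (disc R) (X k))"
  shows "(\<lambda>k. pair_strip R (X k) b) \<longlonglongrightarrow> 0"
proof -
  obtain C where C: "\<And>X. L2fun lborel (zero_ext (disc R) X) \<Longrightarrow> L2fun lborel (zero_ext K (X \<circ> polar)) \<and>
    (LINT p|lborel. (zero_ext K (X \<circ> polar) p)\<^sup>2) \<le> C * (LINT p|lborel. (zero_ext (disc R) X p)\<^sup>2)"
    using L2fun_polar[OF K] by blast
  have X: "L2fun lborel (zero_ext (disc R) (X k))" for k using assms by (simp add: L2null_def)
  have "(\<lambda>k. C * (LINT p|lborel. (zero_ext (disc R) (X k) p)\<^sup>2)) \<longlonglongrightarrow> C * 0"
    using assms unfolding L2null_def by (intro tendsto_intros) auto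
  then have "(\<lambda>k. C * (LINT p|lborel. (zero_ext (disc R) (X k) p)\<^sup>2)) \<longlonglongrightarrow> 0" by simp
  moreover have "0 \<le> (LINT p|lborel. (zero_ext K (X k \<circ> polar) p)\<^sup>2)" for k
    by (rule Bochner_Integration.integral_nonneg) simp
  ultimately have "(\<lambda>k. LINT p|lborel. (zero_ext K (X k \<circ> polar) p)\<^sup>2) \<longlonglongrightarrow> 0"
    using C[OF X] by (intro Lim_null_comparison[of "\<lambda>k. LINT p|lborel. (zero_ext K (X k \<circ> polar) p)\<^sup>2"]) auto
  then have "L2null lborel (\<lambda>k. zero_ext K (X k \<circ> polar))" using C[OF X] by (simp add: L2null_def)
  from L2null_mult_tendsto[OF this L2_b] show ?thesis
    unfolding pair_strip_def set_lebesgue_integral_def zero_ext_pair .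
qed

end

section \<open>Approximation by test functions\<close>

lemma locally_integrable_polar:
  assumes X: "L2fun lborel (zero_ext (disc R) X)" and w: "continuous_on UNIV w"
  shows "locally_integrable (strip R) (\<lambda>p. w p * X (polar p))"
  unfolding locally_integrable_def
proof (intro allI impI)
  fix K assume "compact K \<and> K \<subseteq> strip R"
  then have K: "compact K" "K \<subseteq> strip R" by auto
  have "L2fun lborel (zero_ext K (X \<circ> polar))" using L2fun_polar[OF K] X by blast
  moreover have "L2fun lborel (zero_ext K w)"
    by (rule L2fun_zero_ext_continuous[OF K(1) continuous_on_subset[OF w]]) simp
  ultimately have "integrable lborel (\<lambda>p. zero_ext K (X \<circ> polar) p * zero_ext K w p)" by (rule L2fun_mult(1))
  moreover have "(\<lambda>p. zero_ext K (X \<circ> polar) p * zero_ext K w p) = (\<lambda>p. indicator K p *\<^sub>R (w p * X (polar p)))"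
    by (auto simp: zero_ext_def indicator_def)
  ultimately show "set_integrable lborel K (\<lambda>p. w p * X (polar p))" by (simp add: set_integrable_def)
qed

text \<open>Membership in \<open>H10\<close> with its witnesses made explicit, a form that is linear
  in the three arguments and stable under subsequences. That \<open>G\<close> yields the weak
  derivatives in polar coordinates is not stated here but follows by approximation.\<close>

definition H1_approx :: "real \<Rightarrow> (real \<times> real \<Rightarrow> real) \<Rightarrow> (2 \<Rightarrow> real \<times> real \<Rightarrow> real) \<Rightarrow> (nat \<Rightarrow> real \<times> real \<Rightarrow> real) \<Rightarrow> bool" where
  "H1_approx R f G h \<longleftrightarrow> L2fun lborel (zero_ext (disc R) f) \<and> (\<forall>i. L2fun lborel (zero_ext (disc R) (G i))) \<and>
     (\<forall>k. h k \<in> test_fun (disc R)) \<and> L2null lborel (\<lambda>k. zero_ext (disc R) (\<lambda>p. f p - h k p)) \<and>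
     (\<forall>i. L2null lborel (\<lambda>k. zero_ext (disc R) (\<lambda>p. G i p - pd i (h k) p)))"

lemma test_fun_polar: "h \<in> test_fun S \<Longrightarrow> smooth_on T (h \<circ> polar)"
  using smooth_on_polar[OF test_fun_smooth open_UNIV, of h S UNIV] smooth_on_subset by blast

lemma zero_ext_diff: "zero_ext S (\<lambda>p. f p - g p) = (\<lambda>p. zero_ext S f p - zero_ext S g p)"
  by (rule ext) (simp add: zero_ext_def right_diff_distrib)

lemma H1_approx_L2:
  assumes "H1_approx R f G h"
  shows "L2fun lborel (zero_ext (disc R) (h k))" "L2fun lborel (zero_ext (disc R) (pd i (h k)))"
proof -
  have 1: "L2fun lborel (zero_ext (disc R) f)" "L2fun lborel (\<lambda>p. zero_ext (disc R) f p - zero_ext (disc R) (h k) p)"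
    using assms unfolding H1_approx_def L2null_def zero_ext_diff by blast+
  have 2: "L2fun lborel (zero_ext (disc R) (G i))" "L2fun lborel (\<lambda>p. zero_ext (disc R) (G i) p - zero_ext (disc R) (pd i (h k)) p)"
    using assms unfolding H1_approx_def L2null_def zero_ext_diff by blast+
  show "L2fun lborel (zero_ext (disc R) (h k))" "L2fun lborel (zero_ext (disc R) (pd i (h k)))"
    using L2fun_diff[OF 1] L2fun_diff[OF 2] by simp_all
qed

text \<open>For the smooth \<open>h k\<close> the identity is the classical chain rule and
  integration by parts; all pairings converge as \<open>k\<close> grows. The functions
  \<open>w 1\<close> and \<open>w 2\<close> are the coefficients of that chain rule.\<close>

lemma H1_approx_weak_pd:
  fixes w :: "2 \<Rightarrow> real \<times> real \<Rightarrow> real"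
  assumes A: "H1_approx R f G h" and w: "\<And>j. continuous_on UNIV (w j)"
    and pd: "\<And>k p. pd i (h k \<circ> polar) p = w 1 p * pd 1 (h k) (polar p) + w 2 p * pd 2 (h k) (polar p)"
  shows "is_weak_pd i (strip R) (f \<circ> polar) (\<lambda>p. w 1 p * G 1 (polar p) + w 2 p * G 2 (polar p))"
  unfolding is_weak_pd_def
proof (intro conjI ballI)
  have f: "L2fun lborel (zero_ext (disc R) f)" and G: "\<And>i. L2fun lborel (zero_ext (disc R) (G i))"
    using A by (auto simp: H1_approx_def)
  show "locally_integrable (strip R) (f \<circ> polar)"
    using locally_integrable_polar[OF f, of "\<lambda>_. 1"] by (simp add: comp_def)
  show "locally_integrable (strip R) (\<lambda>p. w 1 p * G 1 (polar p) + w 2 p * G 2 (polar p))"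
    using locally_integrable_polar[OF G w] unfolding locally_integrable_def by (auto intro: set_integral_add)
  fix \<theta> assume \<theta>: "\<theta> \<in> test_fun (strip R)"
  obtain K where K: "compact K" "K \<subseteq> strip R" "\<And>p. p \<notin> K \<Longrightarrow> \<theta> p = 0" "\<And>p i. p \<notin> K \<Longrightarrow> pd i \<theta> p = 0"
    using test_fun_compact_support[OF \<theta>] by metis
  let ?d = "pd i \<theta>" and ?b = "\<lambda>j p. w j p * \<theta> p"
  have d: "continuous_on UNIV ?d" by (rule test_fun_pd_continuous[OF \<theta>])
  have b: "continuous_on UNIV (?b j)" "p \<notin> K \<Longrightarrow> ?b j p = 0" for j p
    using w test_fun_continuous[OF \<theta>] K(3) by (auto intro: continuous_intros)
  note hL = H1_approx_L2[OF A]
  have "(\<lambda>k. pair_strip R (\<lambda>p. f p - h k p) ?d + (pair_strip R (\<lambda>p. G 1 p - pd 1 (h k) p) (?b 1)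
      + pair_strip R (\<lambda>p. G 2 p - pd 2 (h k) p) (?b 2))) \<longlonglongrightarrow> 0 + (0 + 0)"
    using A unfolding H1_approx_def
    by (intro tendsto_add pair_tendsto_0[OF K(1,2) d K(4)] pair_tendsto_0[OF K(1,2) b]) auto
  moreover have "pair_strip R (\<lambda>p. f p - h k p) ?d + (pair_strip R (\<lambda>p. G 1 p - pd 1 (h k) p) (?b 1)
      + pair_strip R (\<lambda>p. G 2 p - pd 2 (h k) p) (?b 2)) =
      pair_strip R f ?d + (pair_strip R (G 1) (?b 1) + pair_strip R (G 2) (?b 2))" for k
  proof -
    have "h k \<in> test_fun (disc R)" using A by (simp add: H1_approx_def)
    then have "Ck_on 1 (strip R) (h k \<circ> polar)" using test_fun_polar unfolding smooth_on_def by blast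
    from is_weak_pd_classical[OF strip_open this, of i]
    have "pair_strip R (h k) ?d = - (LINT p:strip R|lborel. pd i (h k \<circ> polar) p * \<theta> p)"
      using \<theta> by (simp add: is_weak_pd_def pair_strip_def comp_def)
    also have "(LINT p:strip R|lborel. pd i (h k \<circ> polar) p * \<theta> p) = pair_strip R (pd 1 (h k)) (?b 1) + pair_strip R (pd 2 (h k)) (?b 2)"
    proof -
      have "(\<lambda>p. pd i (h k \<circ> polar) p * \<theta> p) = (\<lambda>p. pd 1 (h k) (polar p) * ?b 1 p + pd 2 (h k) (polar p) * ?b 2 p)"
        by (rule ext, subst pd) (simp add: algebra_simps)
      moreover have "set_integrable lborel (strip R) (\<lambda>p. pd j (h k) (polar p) * ?b j p)" for j
        by (rule pair_integrable[OF K(1,2) b hL(2)])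
      ultimately show ?thesis unfolding pair_strip_def by (simp only: set_integral_add(2))
    qed
    finally have e: "pair_strip R (h k) ?d = - (pair_strip R (pd 1 (h k)) (?b 1) + pair_strip R (pd 2 (h k)) (?b 2))" .
    have e0: "pair_strip R (\<lambda>p. f p - h k p) ?d = pair_strip R f ?d - pair_strip R (h k) ?d"
      by (rule pair_diff[OF K(1,2) d K(4) f hL(1)])
    have ej: "pair_strip R (\<lambda>p. G j p - pd j (h k) p) (?b j) = pair_strip R (G j) (?b j) - pair_strip R (pd j (h k)) (?b j)" for j
      by (rule pair_diff[OF K(1,2) b G hL(2)])
    show ?thesis unfolding e0 ej e by simp
  qed
  ultimately have 0: "pair_strip R f ?d + (pair_strip R (G 1) (?b 1) + pair_strip R (G 2) (?b 2)) = 0"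
    by (simp add: LIMSEQ_const_iff)
  have "(LINT p:strip R|lborel. (w 1 p * G 1 (polar p) + w 2 p * G 2 (polar p)) * \<theta> p) = pair_strip R (G 1) (?b 1) + pair_strip R (G 2) (?b 2)"
  proof -
    have "(\<lambda>p. (w 1 p * G 1 (polar p) + w 2 p * G 2 (polar p)) * \<theta> p) = (\<lambda>p. G 1 (polar p) * ?b 1 p + G 2 (polar p) * ?b 2 p)"
      by (simp add: algebra_simps)
    moreover have "set_integrable lborel (strip R) (\<lambda>p. G j (polar p) * ?b j p)" for j
      by (rule pair_integrable[OF K(1,2) b G])
    ultimately show ?thesis unfolding pair_strip_def by (simp only: set_integral_add(2))
  qed
  with 0 show "(LINT p:strip R|lborel. (f \<circ> polar) p * pd i \<theta> p) = - (LINT p:strip R|lborel. (w 1 p * G 1 (polar p) + w 2 p * G 2 (polar p)) * \<theta> p)"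
    by (simp add: pair_strip_def)
qed

text \<open>The potential as a density with respect to Lebesgue measure of the disc. In contrast to
  curvature and metric separately, it enters as one bounded weight.\<close>

definition disc_pot :: "real \<times> real \<Rightarrow> real" where
  "disc_pot p = 200 * norm p ^ 8 / (1 + norm p ^ 10)\<^sup>2"

lemma disc_pot_polar: "0 \<le> u \<Longrightarrow> u * disc_pot (polar (u, v)) = pot u"
proof -
  assume u: "0 \<le> u"
  have "norm (polar (u, v)) = u"
    using u by (simp add: polar_def norm_Pair power_mult_distrib flip: distrib_left)
  then show ?thesis by (simp add: disc_pot_def pot_def mult_ac flip: power_Suc)
qed

lemma disc_pot_measurable [measurable]: "disc_pot \<in> borel_measurable borel"
  unfolding disc_pot_def by measurable

lemma disc_pot_bound: "\<bar>disc_pot p\<bar> \<le> 200"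
proof -
  define r where "r = norm p"
  have r: "0 \<le> r" by (simp add: r_def)
  have "r ^ 8 \<le> 1 + r ^ 10"
  proof (cases "r \<le> 1")
    case True
    then have "r ^ 8 \<le> 1" using r by (simp add: power_le_one)
    moreover have "0 \<le> r ^ 10" using r by simp
    ultimately show ?thesis by linarith
  next
    case False
    then have "r ^ 8 \<le> r ^ 10" by (intro power_increasing) auto
    then show ?thesis by linarith
  qed
  also have "\<dots> \<le> (1 + r ^ 10)\<^sup>2" using r by (intro self_le_power) auto
  finally have "200 * r ^ 8 / (1 + r ^ 10)\<^sup>2 \<le> 200" using r
    by (subst pos_divide_le_eq) (auto simp: zero_less_power add_pos_nonneg)
  then show ?thesis using r by (simp add: disc_pot_def r_def)
qed

text \<open>The polar frame is a rotation of the Cartesian one, so the gradient term is the flat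
  Dirichlet integral. In this form continuity with respect to the Sobolev norm is visible.\<close>

lemma second_variation_disc:
  assumes A: "H1_approx R f G h"
  shows "second_variation 5 R f = (LINT p|lborel. (zero_ext (disc R) (G 1) p)\<^sup>2) + (LINT p|lborel. (zero_ext (disc R) (G 2) p)\<^sup>2)
    - (LINT p|lborel. disc_pot p * (zero_ext (disc R) f p)\<^sup>2)"
proof -
  let ?w1 = "\<lambda>j::2. if j = 1 then \<lambda>p::real \<times> real. cos (snd p) else (\<lambda>p. sin (snd p))"
  let ?w2 = "\<lambda>j::2. if j = 1 then \<lambda>p::real \<times> real. - (fst p * sin (snd p)) else (\<lambda>p. fst p * cos (snd p))"
  have d: "h k differentiable (at p)" for k p
    using A smooth_on_differentiable[OF test_fun_smooth] unfolding H1_approx_def by blast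
  have w1: "is_weak_pd 1 (strip R) (f \<circ> polar) (\<lambda>p. ?w1 1 p * G 1 (polar p) + ?w1 2 p * G 2 (polar p))"
    by (rule H1_approx_weak_pd[OF A]) (auto intro!: continuous_intros simp: pd_polar(1)[OF d])
  have w2: "is_weak_pd 2 (strip R) (f \<circ> polar) (\<lambda>p. ?w2 1 p * G 1 (polar p) + ?w2 2 p * G 2 (polar p))"
    by (rule H1_approx_weak_pd[OF A]) (auto intro!: continuous_intros simp: pd_polar(2)[OF d] algebra_simps)
  define H where "H p = (G 1 p)\<^sup>2 + (G 2 p)\<^sup>2 - disc_pot p * (f p)\<^sup>2" for p
  have cH: "indicator (disc R) p *\<^sub>R H p = (zero_ext (disc R) (G 1) p)\<^sup>2 + (zero_ext (disc R) (G 2) p)\<^sup>2 - disc_pot p * (zero_ext (disc R) f p)\<^sup>2" for p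
    by (auto simp: H_def zero_ext_def indicator_def)
  have i: "integrable lborel (\<lambda>p. (zero_ext (disc R) (G j) p)\<^sup>2)" for j using A by (simp add: H1_approx_def L2fun_def)
  have ip: "integrable lborel (\<lambda>p. disc_pot p * (zero_ext (disc R) f p)\<^sup>2)"
    by (rule L2fun_weight(2)[where C=200]) (use A disc_pot_bound in \<open>auto simp: H1_approx_def\<close>)
  have sH: "set_integrable lborel (disc R) H" unfolding set_integrable_def cH using i ip by auto
  have "second_variation 5 R f = (LINT p:{0<..<R} \<times> {0..<2 * pi}|lborel.
     fst p * (?w1 1 p * G 1 (polar p) + ?w1 2 p * G 2 (polar p))\<^sup>2 + (?w2 1 p * G 1 (polar p) + ?w2 2 p * G 2 (polar p))\<^sup>2 / fst p
     - pot (fst p) * (f (polar p))\<^sup>2)"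
    by (rule second_variation_weak[OF w1 w2])
  also have "\<dots> = (LINT p:{0<..<R} \<times> {0..<2 * pi}|lborel. fst p * H (polar p))"
  proof (rule set_lebesgue_integral_cong)
    show "{0<..<R} \<times> {0..<2 * pi} \<in> sets lborel" by (simp add: borel_Times)
    have e: "u * (c * a + s * b)\<^sup>2 + (- (u * s) * a + u * c * b)\<^sup>2 / u - P * u = u * (a\<^sup>2 + b\<^sup>2 - P)"
      if "0 < u" "c\<^sup>2 + s\<^sup>2 = 1" for u c s a b P :: real
    proof -
      have "- (u * s) * a + u * c * b = u * (c * b - s * a)" by (simp add: algebra_simps)
      then have 1: "(- (u * s) * a + u * c * b)\<^sup>2 / u = u * (c * b - s * a)\<^sup>2"
        using that(1) by (simp add: power_mult_distrib power2_eq_square)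
      have "(c * a + s * b)\<^sup>2 + (c * b - s * a)\<^sup>2 = (c\<^sup>2 + s\<^sup>2) * (a\<^sup>2 + b\<^sup>2)"
        by (simp add: power2_eq_square algebra_simps)
      then have "u * (c * a + s * b)\<^sup>2 + u * (c * b - s * a)\<^sup>2 = u * (a\<^sup>2 + b\<^sup>2)"
        unfolding that(2) distrib_left[symmetric] by simp
      then show ?thesis unfolding 1 right_diff_distrib by (simp add: mult.commute)
    qed
    show "\<forall>p. p \<in> {0<..<R} \<times> {0..<2 * pi} \<longrightarrow> fst p * (?w1 1 p * G 1 (polar p) + ?w1 2 p * G 2 (polar p))\<^sup>2
        + (?w2 1 p * G 1 (polar p) + ?w2 2 p * G 2 (polar p))\<^sup>2 / fst p - pot (fst p) * (f (polar p))\<^sup>2 = fst p * H (polar p)"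
    proof safe
      fix u v assume "u \<in> {0<..<R}"
      then show "fst (u, v) * (?w1 1 (u, v) * G 1 (polar (u, v)) + ?w1 2 (u, v) * G 2 (polar (u, v)))\<^sup>2
        + (?w2 1 (u, v) * G 1 (polar (u, v)) + ?w2 2 (u, v) * G 2 (polar (u, v)))\<^sup>2 / fst (u, v) - pot (fst (u, v)) * (f (polar (u, v)))\<^sup>2
        = fst (u, v) * H (polar (u, v))"
        using e[of u "cos v" "sin v" "G 1 (polar (u, v))" "G 2 (polar (u, v))" "disc_pot (polar (u, v)) * (f (polar (u, v)))\<^sup>2"]
          disc_pot_polar[of u v, symmetric] by (simp add: H_def mult_ac)
    qed
  qed
  also have "\<dots> = (LINT p:disc R|lborel. H p)" using polar_integral(2)[OF sH, of 0] by simp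
  also have "\<dots> = (LINT p|lborel. (zero_ext (disc R) (G 1) p)\<^sup>2) + (LINT p|lborel. (zero_ext (disc R) (G 2) p)\<^sup>2)
    - (LINT p|lborel. disc_pot p * (zero_ext (disc R) f p)\<^sup>2)"
    unfolding set_lebesgue_integral_def cH using i ip by simp
  finally show ?thesis .
qed

lemma H1_approx_const:
  assumes "h \<in> test_fun (disc R)"
  shows "H1_approx R h (\<lambda>i. pd i h) (\<lambda>_. h)"
proof -
  have L: "L2fun lborel (zero_ext (disc R) b)" if "continuous_on UNIV b" "compact K" "\<And>p. p \<notin> K \<Longrightarrow> b p = 0" "K \<subseteq> disc R" for b K
  proof -
    have "zero_ext (disc R) b = b"
    proof
      fix p show "zero_ext (disc R) b p = b p" using that(3)[of p] that(4) by (cases "p \<in> disc R") (auto simp: zero_ext_def)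
    qed
    then show ?thesis
      using L2fun_compact_support[OF that(2) continuous_on_subset[OF that(1)] that(3)] by simp
  qed
  obtain K where K: "compact K" "K \<subseteq> disc R" "\<And>p. p \<notin> K \<Longrightarrow> h p = 0" "\<And>p i. p \<notin> K \<Longrightarrow> pd i h p = 0"
    using test_fun_compact_support[OF assms] by metis
  have "L2fun lborel (zero_ext (disc R) h)" by (rule L[OF test_fun_continuous[OF assms] K(1,3,2)])
  moreover have "L2fun lborel (zero_ext (disc R) (pd i h))" for i
    by (rule L[OF test_fun_pd_continuous[OF assms] K(1,4,2)])
  moreover have "zero_ext (disc R) (\<lambda>p. 0) = (\<lambda>p. 0)" by (simp add: zero_ext_def fun_eq_iff)
  ultimately show ?thesis using assms by (simp add: H1_approx_def L2null_def L2fun_def)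
qed

lemma second_variation_limit:
  assumes A: "H1_approx R f G h"
  shows "(\<lambda>k. second_variation 5 R (h k)) \<longlonglongrightarrow> second_variation 5 R f"
proof -
  have hk: "h k \<in> test_fun (disc R)" for k using A by (simp add: H1_approx_def)
  have d: "zero_ext (disc R) (\<lambda>p. a p - b p) = (\<lambda>p. zero_ext (disc R) a p - zero_ext (disc R) b p)" for a b by (rule zero_ext_diff)
  have G: "(\<lambda>k. LINT p|lborel. 1 * (zero_ext (disc R) (pd i (h k)) p)\<^sup>2) \<longlonglongrightarrow> (LINT p|lborel. 1 * (zero_ext (disc R) (G i) p)\<^sup>2)" for i
    by (rule L2_weighted_square_tendsto[where C=1]) (use A in \<open>auto simp: H1_approx_def d\<close>)
  have f: "(\<lambda>k. LINT p|lborel. disc_pot p * (zero_ext (disc R) (h k) p)\<^sup>2) \<longlonglongrightarrow> (LINT p|lborel. disc_pot p * (zero_ext (disc R) f p)\<^sup>2)"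
    by (rule L2_weighted_square_tendsto[where C=200]) (use A disc_pot_bound in \<open>auto simp: H1_approx_def d\<close>)
  show ?thesis
    unfolding second_variation_disc[OF A] second_variation_disc[OF H1_approx_const[OF hk]]
    using G f by (intro tendsto_intros) auto
qed

text \<open>\<open>H1_norm\<close> is defined through the chosen \<open>weak_pd\<close>. It is first
  identified, almost everywhere, with the difference of a fixed weak derivative of \<open>f\<close>
  and the classical derivative of the test function; then each summand under the root is squeezed to
  0.\<close>

lemma H10_approx:
  assumes "f \<in> H10 (disc R)"
  shows "\<exists>G h. H1_approx R f G h"
proof -
  let ?D = "disc R"
  obtain h where h: "\<And>k. h k \<in> test_fun ?D" "(\<lambda>k. H1_norm ?D (f - h k)) \<longlonglongrightarrow> 0"
    and f: "f \<in> L2_on ?D" "\<forall>i. \<exists>g\<in>L2_on ?D. is_weak_pd i ?D f g"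
    using assms by (auto simp: H10_def H1_def)
  obtain G where G: "\<And>i. G i \<in> L2_on ?D" "\<And>i. is_weak_pd i ?D f (G i)" using f(2) by metis
  have fL: "L2fun lborel (zero_ext ?D f)" and GL: "L2fun lborel (zero_ext ?D (G i))" for i using f(1) G(1) by (auto simp: L2_on_iff)
  have hL: "L2fun lborel (zero_ext ?D (h k))" "L2fun lborel (zero_ext ?D (pd i (h k)))" for k i
    using H1_approx_const[OF h(1)] by (auto simp: H1_approx_def)
  have X: "L2fun lborel (zero_ext ?D (\<lambda>p. f p - h k p))" "L2fun lborel (zero_ext ?D (\<lambda>p. G i p - pd i (h k) p))" for k i
    unfolding zero_ext_diff by (intro L2fun_diff fL GL hL)+
  have w: "is_weak_pd i ?D (f - h k) (\<lambda>p. G i p - pd i (h k) p)" for i k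
  proof -
    have "Ck_on 1 ?D (h k)" using test_fun_smooth[OF h(1)] smooth_on_subset[of UNIV] unfolding smooth_on_def by blast
    from is_weak_pd_classical[OF disc_open this, of i] G(2)[of i]
    have l: "locally_integrable ?D f" "locally_integrable ?D (h k)" "locally_integrable ?D (G i)" "locally_integrable ?D (pd i (h k))"
      and e: "\<And>\<psi>. \<psi> \<in> test_fun ?D \<Longrightarrow> (LINT p:?D|lborel. h k p * pd i \<psi> p) = - (LINT p:?D|lborel. pd i (h k) p * \<psi> p)"
        "\<And>\<psi>. \<psi> \<in> test_fun ?D \<Longrightarrow> (LINT p:?D|lborel. f p * pd i \<psi> p) = - (LINT p:?D|lborel. G i p * \<psi> p)"
      by (auto simp: is_weak_pd_def)
    show ?thesis unfolding is_weak_pd_def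
    proof (intro conjI ballI)
      show "locally_integrable ?D (f - h k)" "locally_integrable ?D (\<lambda>p. G i p - pd i (h k) p)"
        using l unfolding locally_integrable_def by (auto intro: set_integral_diff simp: fun_diff_def)
      fix \<psi> assume t: "\<psi> \<in> test_fun ?D"
      show "(LINT p:?D|lborel. (f - h k) p * pd i \<psi> p) = - (LINT p:?D|lborel. (G i p - pd i (h k) p) * \<psi> p)"
        using e[OF t] locally_integrable_test_fun[OF l(1) t] locally_integrable_test_fun[OF l(2) t]
          locally_integrable_test_fun[OF l(3) t] locally_integrable_test_fun[OF l(4) t]
        by (simp add: left_diff_distrib set_integral_diff)
    qed
  qed
  define a where "a k = (LINT p|lborel. (zero_ext ?D (\<lambda>p. f p - h k p) p)\<^sup>2)" for k
  define b where "b i k = (LINT p|lborel. (zero_ext ?D (\<lambda>p. G i p - pd i (h k) p) p)\<^sup>2)" for i k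
  have nn: "0 \<le> a k" "0 \<le> b i k" for k i unfolding a_def b_def by (rule Bochner_Integration.integral_nonneg, simp)+
  have norm: "H1_norm ?D (f - h k) = sqrt (a k + (\<Sum>i\<in>UNIV. b i k))" for k
  proof -
    have "(LINT p:?D|lborel. (weak_pd i ?D (f - h k) p)\<^sup>2) = b i k" for i
      unfolding zero_ext_square b_def
    proof (rule integral_cong_AE)
      have "zero_ext ?D (weak_pd i ?D (f - h k)) \<in> borel_measurable lborel" by (rule weak_pd_measurable[OF disc_open w])
      then show "(\<lambda>p. (zero_ext ?D (weak_pd i ?D (f - h k)) p)\<^sup>2) \<in> borel_measurable lborel" by simp
      show "(\<lambda>p. (zero_ext ?D (\<lambda>p. G i p - pd i (h k) p) p)\<^sup>2) \<in> borel_measurable lborel" using X(2)[of i k]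
        unfolding L2fun_def by (intro borel_measurable_power) blast
      show "AE p in lborel. (zero_ext ?D (weak_pd i ?D (f - h k)) p)\<^sup>2 = (zero_ext ?D (\<lambda>p. G i p - pd i (h k) p) p)\<^sup>2"
        using weak_pd_AE[OF disc_open w[of i k]] by eventually_elim (auto simp: zero_ext_def indicator_def)
    qed
    moreover have "(LINT p:?D|lborel. ((f - h k) p)\<^sup>2) = a k" unfolding zero_ext_square a_def by (simp add: fun_diff_def)
    ultimately show ?thesis by (simp add: H1_norm_def)
  qed
  have "(\<lambda>k. (H1_norm ?D (f - h k))\<^sup>2) \<longlonglongrightarrow> 0\<^sup>2" by (intro tendsto_intros h(2))
  then have t: "(\<lambda>k. a k + (\<Sum>i\<in>UNIV. b i k)) \<longlonglongrightarrow> 0"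
    unfolding norm using nn by (simp add: sum_nonneg)
  have le: "a k \<le> a k + (\<Sum>i\<in>UNIV. b i k)" "b i k \<le> a k + (\<Sum>i\<in>UNIV. b i k)" for i k
    using nn member_le_sum[of i UNIV "\<lambda>i. b i k"] by (auto simp: sum_nonneg add_increasing)
  have "a \<longlonglongrightarrow> 0" "b i \<longlonglongrightarrow> 0" for i
    by (rule Lim_null_comparison[OF _ t], use le nn in auto)+
  then have "L2null lborel (\<lambda>k. zero_ext ?D (\<lambda>p. f p - h k p))" "L2null lborel (\<lambda>k. zero_ext ?D (\<lambda>p. G i p - pd i (h k) p))" for i
    using X unfolding L2null_def a_def[abs_def] b_def[abs_def] by auto
  then show ?thesis using fL GL h(1) unfolding H1_approx_def by blast
qed

lemma test_fun_cmult: "h \<in> test_fun S \<Longrightarrow> (\<lambda>p. c * h p) \<in> test_fun S"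
  and test_fun_add: "h \<in> test_fun S \<Longrightarrow> g \<in> test_fun S \<Longrightarrow> (\<lambda>p. h p + g p) \<in> test_fun S"
proof -
  have *: "f \<in> test_fun S" if s: "smooth_on UNIV f" and K: "compact K" "K \<subseteq> S" and z: "{p. f p \<noteq> 0} \<subseteq> K" for f K
  proof -
    have "closure {p. f p \<noteq> 0} \<subseteq> K" by (rule closure_minimal[OF z compact_imp_closed[OF K(1)]])
    moreover from this have "compact (closure {p. f p \<noteq> 0})"
      using compact_Int_closed[OF K(1), of "closure {p. f p \<noteq> 0}"] by (simp add: Int_absorb1)
    ultimately show ?thesis using s K(2) unfolding test_fun_def by blast
  qed
  have cl: "compact (closure {p. h p \<noteq> 0})" "closure {p. h p \<noteq> 0} \<subseteq> S" if "h \<in> test_fun S" for h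
    using that unfolding test_fun_def by blast+
  have sub: "{p. h p \<noteq> 0} \<subseteq> closure {p. h p \<noteq> 0}" for h :: "real \<times> real \<Rightarrow> real" by (rule closure_subset)
  show "(\<lambda>p. c * h p) \<in> test_fun S" if h: "h \<in> test_fun S"
  proof (rule *[OF _ cl(1)[OF h] cl(2)[OF h]])
    show "smooth_on UNIV (\<lambda>p. c * h p)" by (intro smooth_on_mult smooth_on_const test_fun_smooth[OF h] open_UNIV)
    show "{p. c * h p \<noteq> 0} \<subseteq> closure {p. h p \<noteq> 0}" using sub[of h] by (rule order_trans[rotated]) auto
  qed
  show "(\<lambda>p. h p + g p) \<in> test_fun S" if h: "h \<in> test_fun S" and g: "g \<in> test_fun S"
  proof (rule *[OF _ compact_Un[OF cl(1)[OF h] cl(1)[OF g]]])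
    show "smooth_on UNIV (\<lambda>p. h p + g p)" by (intro smooth_on_add test_fun_smooth[OF h] test_fun_smooth[OF g] open_UNIV)
    show "closure {p. h p \<noteq> 0} \<union> closure {p. g p \<noteq> 0} \<subseteq> S" using cl(2)[OF h] cl(2)[OF g] by simp
    have "{p. h p + g p \<noteq> 0} \<subseteq> {p. h p \<noteq> 0} \<union> {p. g p \<noteq> 0}" by auto
    also have "\<dots> \<subseteq> closure {p. h p \<noteq> 0} \<union> closure {p. g p \<noteq> 0}" using sub[of h] sub[of g] by (rule Un_mono)
    finally show "{p. h p + g p \<noteq> 0} \<subseteq> closure {p. h p \<noteq> 0} \<union> closure {p. g p \<noteq> 0}" .
  qed
qed

lemma test_fun_zero: "(\<lambda>_. 0) \<in> test_fun S"
  by (simp add: test_fun_def smooth_on_const)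

lemma test_fun_sum: "(\<And>i. i \<in> I \<Longrightarrow> h i \<in> test_fun S) \<Longrightarrow> (\<lambda>p. \<Sum>i\<in>I. h i p) \<in> test_fun S"
  by (induction I rule: infinite_finite_induct) (auto intro: test_fun_zero test_fun_add)

lemma pd_sum:
  fixes f :: "'i \<Rightarrow> real \<times> real \<Rightarrow> real"
  assumes "finite I" "\<And>j. j \<in> I \<Longrightarrow> f j differentiable (at p)"
  shows "pd i (\<lambda>p. \<Sum>j\<in>I. c j * f j p) p = (\<Sum>j\<in>I. c j * pd i (f j) p)"
  using assms
proof (induction I rule: finite_induct)
  case empty
  then show ?case using pd_has_derivative[of "\<lambda>_. 0::real" "\<lambda>_. 0" p i] by simp
next
  case (insert j I)
  then show ?case by (simp add: pd_add pd_cmult differentiable_sum)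
qed

text \<open>The coefficients may vary along the sequence: each error splits as (l - c) g + c (g -
  y), where the first part is small because the coefficients converge and the second because the
  functions do.\<close>

lemma H1_approx_sum:
  assumes A: "\<And>j. j \<in> I \<Longrightarrow> H1_approx R (f j) (G j) (h j)" and I: "finite I"
    and c: "\<And>j. j \<in> I \<Longrightarrow> (\<lambda>k. c k j) \<longlonglongrightarrow> l j"
  shows "H1_approx R (\<lambda>p. \<Sum>j\<in>I. l j * f j p) (\<lambda>i p. \<Sum>j\<in>I. l j * G j i p) (\<lambda>k p. \<Sum>j\<in>I. c k j * h j k p)"
proof -
  have cs: "zero_ext (disc R) (\<lambda>p. \<Sum>j\<in>I. l j * g j p) = (\<lambda>p. \<Sum>j\<in>I. l j * zero_ext (disc R) (g j) p)" for g
    by (rule ext) (simp add: zero_ext_def sum_distrib_left mult_ac)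
  have N: "L2null lborel (\<lambda>k. zero_ext (disc R) (\<lambda>p. (\<Sum>j\<in>I. l j * g j p) - (\<Sum>j\<in>I. c k j * y j k p)))"
    if g: "\<And>j. j \<in> I \<Longrightarrow> L2fun lborel (zero_ext (disc R) (g j))"
      and y: "\<And>j. j \<in> I \<Longrightarrow> L2null lborel (\<lambda>k. zero_ext (disc R) (\<lambda>p. g j p - y j k p))" for g y
  proof -
    have "L2null lborel (\<lambda>k p. \<Sum>j\<in>I. ((l j - c k j) * zero_ext (disc R) (g j) p + c k j * zero_ext (disc R) (\<lambda>p. g j p - y j k p) p))"
    proof (rule L2null_sum)
      fix j assume j: "j \<in> I"
      have "(\<lambda>k. l j - c k j) \<longlonglongrightarrow> 0"
        using tendsto_diff[OF tendsto_const c[OF j], of "l j"] by simp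
      then show "L2null lborel (\<lambda>k p. (l j - c k j) * zero_ext (disc R) (g j) p + c k j * zero_ext (disc R) (\<lambda>p. g j p - y j k p) p)"
        by (intro L2null_add L2null_const g j L2null_cmult[OF y[OF j] c[OF j]])
    qed
    moreover have "zero_ext (disc R) (\<lambda>p. (\<Sum>j\<in>I. l j * g j p) - (\<Sum>j\<in>I. c k j * y j k p)) =
        (\<lambda>p. \<Sum>j\<in>I. ((l j - c k j) * zero_ext (disc R) (g j) p + c k j * zero_ext (disc R) (\<lambda>p. g j p - y j k p) p))" for k
      by (rule ext) (simp add: zero_ext_def sum_distrib_left sum_subtractf[symmetric] algebra_simps)
    ultimately show ?thesis by simp
  qed
  have pd: "pd i (\<lambda>p. \<Sum>j\<in>I. c k j * h j k p) p = (\<Sum>j\<in>I. c k j * pd i (h j k) p)" for i k p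
  proof (rule pd_sum[OF I])
    fix j assume "j \<in> I"
    then have "h j k \<in> test_fun (disc R)" using A by (simp add: H1_approx_def)
    then show "h j k differentiable (at p)" using smooth_on_differentiable[OF test_fun_smooth] by blast
  qed
  show ?thesis unfolding H1_approx_def pd
    using A by (intro conjI allI N test_fun_sum test_fun_cmult)
      (auto simp: H1_approx_def cs intro!: L2fun_sum L2fun_cmult)
qed

section \<open>Upper bounds for the indices\<close>

text \<open>A homogeneous linear system with more unknowns than equations has a nontrivial
  solution.\<close>

lemma exists_kernel_vector:
  fixes a :: "'j \<Rightarrow> 'b \<Rightarrow> real"
  assumes "finite J" "finite B" "card J < card B"
  shows "\<exists>c. (\<exists>b\<in>B. c b \<noteq> 0) \<and> (\<forall>j\<in>J. (\<Sum>b\<in>B. c b * a j b) = 0)"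
  using assms
proof (induction J arbitrary: B a rule: finite_induct)
  case empty
  then obtain b where "b \<in> B" by (metis card.empty card_gt_0_iff ex_in_conv)
  then show ?case by (intro exI[of _ "\<lambda>_. 1"]) auto
next
  case (insert j J)
  show ?case
  proof (cases "\<forall>b\<in>B. a j b = 0")
    case True
    have "card J < card B" using insert by simp
    from insert.IH[OF insert.prems(1) this, of a] True show ?thesis by auto
  next
    case False
    then obtain b0 where b0: "b0 \<in> B" "a j b0 \<noteq> 0" by blast
    \<comment> \<open>Gaussian elimination: the equation \<open>j\<close> is solved for the unknown
      \<open>b0\<close> and substituted into the others.\<close>
    let ?B = "B - {b0}" and ?a = "\<lambda>i b. a i b - a i b0 * a j b / a j b0"
    have "card J < card ?B" using insert b0 by simp
    then obtain c where c: "\<exists>b\<in>?B. c b \<noteq> 0" "\<forall>i\<in>J. (\<Sum>b\<in>?B. c b * ?a i b) = 0"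
      using insert.IH[of ?B ?a] insert.prems by auto
    define s where "s = (\<Sum>b\<in>?B. c b * a j b) / a j b0"
    define d where "d b = (if b = b0 then - s else c b)" for b
    have sum: "(\<Sum>b\<in>B. d b * a i b) = (\<Sum>b\<in>?B. c b * a i b) - s * a i b0" for i
      using insert.prems(1) b0(1) by (subst sum.remove[of B b0]) (auto simp: d_def intro!: sum.cong)
    have "(\<Sum>b\<in>B. d b * a j b) = 0" unfolding sum using b0(2) by (simp add: s_def)
    moreover have "(\<Sum>b\<in>B. d b * a i b) = 0" if "i \<in> J" for i
    proof -
      have "(\<Sum>b\<in>?B. c b * ?a i b) = (\<Sum>b\<in>?B. c b * a i b) - s * a i b0"
      proof -
        have "s * a i b0 = (\<Sum>b\<in>?B. c b * (a i b0 * a j b / a j b0))"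
          unfolding s_def sum_divide_distrib sum_distrib_right by (intro sum.cong) simp_all
        then show ?thesis unfolding right_diff_distrib sum_subtractf by simp
      qed
      then show ?thesis unfolding sum using c(2) that by simp
    qed
    moreover have "\<exists>b\<in>B. d b \<noteq> 0" using c(1) by (auto simp: d_def)
    ultimately show ?thesis by (intro exI[of _ d]) auto
  qed
qed

lemma sum_fun_eq: "(\<Sum>i\<in>I. f i) = (\<lambda>p. \<Sum>i\<in>I. f i p :: real)"
  by (induction I rule: infinite_finite_induct) (auto simp: zero_fun_def plus_fun_def)

text \<open>A negative definite subspace of dimension at least \<open>CARD('n)\<close> contains that
  many independent functions, and a nontrivial combination of them with nonnegative value
  contradicts definiteness.\<close>

lemma neg_index_le:
  assumes "\<And>b :: 'n::finite \<Rightarrow> real \<times> real \<Rightarrow> real.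
      (\<And>c. (\<lambda>p. \<Sum>i\<in>UNIV. c i * b i p) \<in> V) \<Longrightarrow>
      \<exists>c. (\<exists>i. c i \<noteq> 0) \<and> 0 \<le> Q (\<lambda>p. \<Sum>i\<in>UNIV. c i * b i p)"
  shows "neg_index V Q \<le> enat (CARD('n) - 1)"
  unfolding neg_index_def
proof (rule Sup_least, clarify)
  fix W B assume B: "finite B" "fun_vs.independent B"
    and W: "fun_vs.span B \<subseteq> V" "negative_definite_on (fun_vs.span B) Q"
  show "enat (fun_vs.dim (fun_vs.span B)) \<le> enat (CARD('n) - 1)"
  proof (rule ccontr)
    assume "\<not> ?thesis"
    then have "CARD('n) \<le> card B" using fun_vs.dim_span_eq_card_independent[OF B(2)] by auto
    then obtain b :: "'n \<Rightarrow> real \<times> real \<Rightarrow> real" where b: "inj b" "range b \<subseteq> B"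
      using card_le_inj[of "UNIV :: 'n set" B] B(1) by auto
    have sp: "(\<lambda>p. \<Sum>i\<in>UNIV. c i * b i p) \<in> fun_vs.span B" for c
    proof -
      have "(\<Sum>i\<in>UNIV. (\<lambda>p. c i * b i p)) \<in> fun_vs.span B"
        using b(2) by (intro fun_vs.span_sum fun_vs.span_scale fun_vs.span_base) auto
      then show ?thesis by (simp add: sum_fun_eq)
    qed
    obtain c i where c: "c i \<noteq> 0" "0 \<le> Q (\<lambda>p. \<Sum>i\<in>UNIV. c i * b i p)"
      using assms[of b] sp W(1) by blast
    have "(\<lambda>p. \<Sum>i\<in>UNIV. c i * b i p) \<noteq> 0"
    proof
      assume z: "(\<lambda>p. \<Sum>i\<in>UNIV. c i * b i p) = 0"
      have ind: "fun_vs.independent (range b)" using B(2) b(2) fun_vs.independent_mono by blast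
      have "(\<Sum>v\<in>range b. (\<lambda>p. c (the_inv b v) * v p)) = 0"
      proof -
        have "(\<Sum>v\<in>range b. (\<lambda>p. c (the_inv b v) * v p)) = (\<Sum>i\<in>UNIV. (\<lambda>p. c i * b i p))"
          using b(1) by (subst sum.reindex) (auto simp: the_inv_f_f)
        then show ?thesis using z by (simp add: sum_fun_eq)
      qed
      then have "c (the_inv b (b i)) = 0"
        using fun_vs.independentD[OF ind, of "range b" "\<lambda>v. c (the_inv b v)" "b i"] by simp
      then show False using c(1) b(1) by (simp add: the_inv_f_f)
    qed
    then have "Q (\<lambda>p. \<Sum>i\<in>UNIV. c i * b i p) < 0"
      using W(2) sp[of c] unfolding negative_definite_on_def by blast
    then show False using c(2) by simp
  qed
qed

text \<open>Independence is a consequence: a vanishing nontrivial combination would have a negative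
  value, against \<open>Q0\<close>.\<close>

lemma neg_index_ge:
  fixes b :: "'n::finite \<Rightarrow> real \<times> real \<Rightarrow> real"
  assumes V: "\<And>c. (\<lambda>p. \<Sum>i\<in>UNIV. c i * b i p) \<in> V"
    and Q: "\<And>c. (\<exists>i. c i \<noteq> 0) \<Longrightarrow> Q (\<lambda>p. \<Sum>i\<in>UNIV. c i * b i p) < 0" and Q0: "0 \<le> Q 0"
  shows "enat CARD('n) \<le> neg_index V Q"
proof -
  have z: "c i = 0" if "(\<lambda>p. \<Sum>i\<in>UNIV. c i * b i p) = 0" for c i using Q[of c] Q0 that by force
  have inj: "inj b"
  proof (rule injI, rule ccontr)
    fix i j assume ij: "b i = b j" "i \<noteq> j"
    have "(\<lambda>p. \<Sum>l\<in>UNIV. (if l = i then 1 else if l = j then -1 else 0) * b l p) = 0"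
    proof
      fix p
      have "(\<Sum>l\<in>UNIV. (if l = i then 1 else if l = j then -1 else 0) * b l p)
        = (\<Sum>l\<in>{i, j}. (if l = i then 1 else if l = j then -1 else 0) * b l p)"
        by (rule sum.mono_neutral_right) auto
      then show "(\<Sum>l\<in>UNIV. (if l = i then 1 else if l = j then -1 else 0) * b l p) = 0 p" using ij by simp
    qed
    from z[OF this, of i] show False by simp
  qed
  have re: "(\<Sum>v\<in>range b. (\<lambda>p. u v * v p)) = (\<lambda>p. \<Sum>i\<in>UNIV. u (b i) * b i p)" for u
    using inj by (subst sum.reindex) (auto simp: sum_fun_eq)
  have ind: "fun_vs.independent (range b)"
  proof (rule fun_vs.independent_if_scalars_zero)
    fix u v assume "(\<Sum>v\<in>range b. (\<lambda>p. u v * v p)) = 0" "v \<in> range b"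
    then show "u v = 0" unfolding re using z[of "\<lambda>i. u (b i)"] by auto
  qed simp
  have span: "\<exists>c. f = (\<lambda>p. \<Sum>i\<in>UNIV. c i * b i p)" if "f \<in> fun_vs.span (range b)" for f
    using that unfolding fun_vs.span_finite[OF finite_imageI[OF finite_class.finite_UNIV]] by (auto simp: re)
  have "fun_vs.dim (fun_vs.span (range b)) = CARD('n)"
    using fun_vs.dim_span_eq_card_independent[OF ind] card_image[OF inj] by simp
  moreover have "fun_vs.span (range b) \<subseteq> V" using span V by blast
  moreover have "negative_definite_on (fun_vs.span (range b)) Q"
    unfolding negative_definite_on_def
  proof (intro ballI impI)
    fix f assume "f \<in> fun_vs.span (range b)" "f \<noteq> 0"
    then obtain c where c: "f = (\<lambda>p. \<Sum>i\<in>UNIV. c i * b i p)" using span by blast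
    have "\<exists>i. c i \<noteq> 0"
    proof (rule ccontr)
      assume "\<not> ?thesis"
      then show False using \<open>f \<noteq> 0\<close> by (simp add: c zero_fun_def)
    qed
    then show "Q f < 0" unfolding c by (rule Q)
  qed
  moreover have "\<exists>B. finite B \<and> fun_vs.independent B \<and> fun_vs.span B = fun_vs.span (range b)"
    using ind by (intro exI[of _ "range b"]) simp
  ultimately have P: "fun_vs.subspace (fun_vs.span (range b)) \<and> (\<exists>B. finite B \<and> fun_vs.independent B \<and>
      fun_vs.span B = fun_vs.span (range b)) \<and> fun_vs.span (range b) \<subseteq> V \<and> negative_definite_on (fun_vs.span (range b)) Q"
    using fun_vs.subspace_span by blast
  have "enat (fun_vs.dim (fun_vs.span (range b))) \<le> neg_index V Q" unfolding neg_index_def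
    by (rule Sup_upper, rule CollectI, rule exI[of _ "fun_vs.span (range b)"], rule conjI[OF refl P])
  with \<open>fun_vs.dim (fun_vs.span (range b)) = CARD('n)\<close> show ?thesis by simp
qed

section \<open>Upper bound for compactly supported variations\<close>

lemma fourier_sum:
  assumes "finite I" "\<And>i. i \<in> I \<Longrightarrow> continuous_on {0..2 * pi} (f i)"
  shows "fourier (\<lambda>v. \<Sum>i\<in>I. c i * f i v) k = (\<Sum>i\<in>I. c i * fourier (f i) k)"
proof -
  have "((\<lambda>v. \<Sum>i\<in>I. c i * (f i v * trig k v)) has_integral (\<Sum>i\<in>I. c i * fourier (f i) k)) {0..2 * pi}"
    using assms by (intro has_integral_sum has_integral_mult_right has_integral_fourier)
  moreover have "(\<lambda>v. (\<Sum>i\<in>I. c i * f i v) * trig k v) = (\<lambda>v. \<Sum>i\<in>I. c i * (f i v * trig k v))"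
    by (simp only: sum_distrib_right mult.assoc)
  ultimately show ?thesis unfolding fourier_def[of "\<lambda>v. \<Sum>i\<in>I. c i * f i v"] by (simp only: integral_unique)
qed

lemma polar_periodic: "polar (u, v + 2 * pi) = polar (u, v)"
  by (simp add: polar_def)

lemma strip_function_test_fun:
  assumes "g \<in> test_fun S"
  shows "strip_function R (g \<circ> polar)"
proof
  show "Ck_on 1 (strip R) (g \<circ> polar)" using test_fun_polar[OF assms, of "strip R"] by (simp add: smooth_on_def)
qed (simp add: polar_periodic)

lemma test_fun_second_variation_nonneg:
  assumes R: "3 / 2 < R" and g: "g \<in> test_fun (disc R)"
    and z: "\<And>k. \<bar>k\<bar> \<le> 4 \<Longrightarrow> fourier (\<lambda>v. g (polar (root_radius k, v))) k = 0"
  shows "0 \<le> second_variation 5 R g"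
proof -
  interpret strip_function R "g \<circ> polar" by (rule strip_function_test_fun[OF g])
  obtain K where K: "compact K" "K \<subseteq> disc R" "\<And>p. p \<notin> K \<Longrightarrow> g p = 0"
    using test_fun_compact_support[OF g] by metis
  have "bounded (g ` K)"
    by (intro compact_imp_bounded compact_continuous_image K(1) continuous_on_subset[OF test_fun_continuous[OF g]]) simp
  then obtain M where "\<And>p. p \<in> K \<Longrightarrow> \<bar>g p\<bar> \<le> M" by (auto simp: bounded_iff)
  then have le: "\<bar>g p\<bar> \<le> \<bar>M\<bar>" for p using K(3)[of p] by (cases "p \<in> K") fastforce+
  have bd: "bounded ((g \<circ> polar) ` strip R)"
  proof (rule boundedI)
    fix x assume "x \<in> (g \<circ> polar) ` strip R"
    then obtain p where "x = g (polar p)" unfolding comp_def by blast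
    then show "norm x \<le> \<bar>M\<bar>" using le by simp
  qed
  \<comment> \<open>The support keeps a distance from the boundary circle, so every Fourier
    coefficient vanishes for radii near R.\<close>
  have "\<exists>r<R. \<forall>p\<in>K. norm p \<le> r"
  proof (cases "K = {}")
    case True
    then show ?thesis by (auto intro: exI[of _ "R - 1"])
  next
    case False
    then obtain p0 where "p0 \<in> K" "\<forall>p\<in>K. norm p \<le> norm p0"
      using continuous_attains_sup[OF K(1) False continuous_on_norm[OF continuous_on_id]] by blast
    moreover have "norm p0 < R" if "p0 \<in> K"
    proof -
      have "p0 \<in> ball (0, 0) R" using K(2) that by (auto simp: disc_def)
      then show ?thesis by (simp add: dist_norm flip: zero_prod_def)
    qed
    ultimately show ?thesis by blast
  qed
  then obtain r where r: "r < R" "\<forall>p\<in>K. norm p \<le> r" by blast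
  have lim: "(coef k \<longlongrightarrow> 0) (at_left R)" for k
  proof (rule tendsto_eventually)
    have "eventually (\<lambda>u. u \<in> {max r 0<..<R}) (at_left R)" using r(1) R by (intro eventually_at_left_real) auto
    then show "\<forall>\<^sub>F u in at_left R. coef k u = 0"
    proof eventually_elim
      case (elim u)
      have "g (polar (u, v)) = 0" for v
      proof -
        have "norm (polar (u, v)) = u"
          using elim by (simp add: polar_def norm_Pair power_mult_distrib flip: distrib_left)
        then have "polar (u, v) \<notin> K" using r(2) elim by force
        then show ?thesis by (rule K(3))
      qed
      then show ?case by (simp add: coef_def fourier_def)
    qed
  qed
  have "Ck_on 1 (strip R) (g \<circ> polar)" by (rule C1)
  from second_variation_classical[OF this] show ?thesis
    using variation_nonneg[OF R bd _ lim lim] z by (simp add: coef_def)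
qed

lemma L2null_subseq:
  assumes "L2null M X" "strict_mono r"
  shows "L2null M (\<lambda>k. X (r k))"
  using assms LIMSEQ_subseq_LIMSEQ[of "\<lambda>k. \<integral>x. (X k x)\<^sup>2 \<partial>M" 0 r]
  by (simp add: L2null_def comp_def)

lemma H1_approx_subseq:
  assumes A: "H1_approx R f G h" and r: "strict_mono r"
  shows "H1_approx R f G (\<lambda>k. h (r k))"
proof -
  have "L2null lborel (\<lambda>k. zero_ext (disc R) (\<lambda>p. f p - h (r k) p))"
    by (rule L2null_subseq[OF _ r, of _ "\<lambda>k. zero_ext (disc R) (\<lambda>p. f p - h k p)"]) (use A in \<open>simp add: H1_approx_def\<close>)
  moreover have "L2null lborel (\<lambda>k. zero_ext (disc R) (\<lambda>p. G i p - pd i (h (r k)) p))" for i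
    by (rule L2null_subseq[OF _ r, of _ "\<lambda>k. zero_ext (disc R) (\<lambda>p. G i p - pd i (h k) p)"]) (use A in \<open>simp add: H1_approx_def\<close>)
  ultimately show ?thesis using A by (simp add: H1_approx_def)
qed

lemma ind_c_le:
  assumes R: "3 / 2 < R"
  shows "ind_c 5 R \<le> 9"
proof -
  have "ind_c 5 R \<le> enat (CARD(10) - 1)"
    unfolding ind_c_def
  proof (rule neg_index_le)
    fix b :: "10 \<Rightarrow> real \<times> real \<Rightarrow> real"
    assume V: "\<And>c. (\<lambda>p. \<Sum>i\<in>UNIV. c i * b i p) \<in> H10 (disc R)"
    have "b i \<in> H10 (disc R)" for i
    proof -
      have "(\<Sum>j\<in>UNIV. (if j = i then 1 else 0) * b j p) = b i p" for p
        by (simp add: if_distrib[of "\<lambda>x. x * _"] cong: if_cong)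
      then show ?thesis using V[of "\<lambda>j. if j = i then 1 else 0"] by simp
    qed
    then have "\<forall>i. \<exists>q. H1_approx R (b i) (fst q) (snd q)" using H10_approx by (metis fst_conv snd_conv)
    from choice[OF this] obtain q where "\<forall>i. H1_approx R (b i) (fst (q i)) (snd (q i))" by blast
    define G where "G i = fst (q i)" for i
    define h where "h i = snd (q i)" for i
    have A: "H1_approx R (b i) (G i) (h i)" for i
      using \<open>\<forall>i. H1_approx R (b i) (fst (q i)) (snd (q i))\<close> by (simp add: G_def h_def)
    have ht: "h i k \<in> test_fun (disc R)" for i k using A by (simp add: H1_approx_def)
    define L where "L j g = fourier (\<lambda>v. g (polar (root_radius j, v))) j" for j and g :: "real \<times> real \<Rightarrow> real"
    have Lsum: "L j (\<lambda>p. \<Sum>i\<in>UNIV. c i * h i k p) = (\<Sum>i\<in>UNIV. c i * L j (h i k))" for j c k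
      unfolding L_def
    proof (rule fourier_sum[OF finite_class.finite_UNIV])
      fix i show "continuous_on {0..2 * pi} (\<lambda>v. h i k (polar (root_radius j, v)))"
        unfolding polar_def by (intro continuous_on_compose2[OF test_fun_continuous[OF ht]]) (auto intro!: continuous_intros)
    qed
    \<comment> \<open>Nine equations for ten unknowns at each stage \<open>k\<close>. The solution
      is normalised so that a limit of a subsequence is again nonzero.\<close>
    have "\<exists>c :: real^10. norm c = 1 \<and> (\<forall>j\<in>{-4..4}. (\<Sum>i\<in>UNIV. c $ i * L j (h i k)) = 0)" for k
    proof -
      have "\<exists>c. (\<exists>i\<in>UNIV. c i \<noteq> 0) \<and> (\<forall>j\<in>{-4..4}. (\<Sum>i\<in>(UNIV :: 10 set). c i * L j (h i k)) = 0)"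
        by (rule exists_kernel_vector) auto
      then obtain c i where c: "c i \<noteq> 0" "\<And>j. j \<in> {-4..4} \<Longrightarrow> (\<Sum>i\<in>(UNIV :: 10 set). c i * L j (h i k)) = 0" by auto
      define x :: "real^10" where "x = (\<chi> i. c i)"
      have "x \<noteq> 0" using c(1) by (auto simp: x_def vec_eq_iff)
      moreover have "(\<Sum>i\<in>UNIV. (x /\<^sub>R norm x) $ i * L j (h i k)) = 0" if "j \<in> {-4..4}" for j
      proof -
        have "(\<Sum>i\<in>UNIV. (x /\<^sub>R norm x) $ i * L j (h i k)) = inverse (norm x) * (\<Sum>i\<in>UNIV. c i * L j (h i k))"
          unfolding sum_distrib_left by (intro sum.cong refl) (simp add: x_def)
        then show ?thesis using c(2)[OF that] by simp
      qed
      ultimately show ?thesis by (intro exI[of _ "x /\<^sub>R norm x"]) auto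
    qed
    then obtain c :: "nat \<Rightarrow> real^10" where c: "\<And>k. norm (c k) = 1"
      "\<And>k j. j \<in> {-4..4} \<Longrightarrow> (\<Sum>i\<in>UNIV. c k $ i * L j (h i k)) = 0" by metis
    have "seq_compact (sphere (0 :: real^10) 1)" by (intro compact_imp_seq_compact compact_sphere)
    moreover have "\<forall>k. c k \<in> sphere 0 1" using c(1) by simp
    ultimately obtain l r where l: "l \<in> sphere 0 1" "strict_mono r" "(c \<circ> r) \<longlonglongrightarrow> l"
      unfolding seq_compact_def by blast
    let ?f = "\<lambda>p. \<Sum>i\<in>UNIV. l $ i * b i p" and ?g = "\<lambda>k p. \<Sum>i\<in>UNIV. c (r k) $ i * h i (r k) p"
    have AA: "H1_approx R ?f (\<lambda>i p. \<Sum>j\<in>UNIV. l $ j * G j i p) ?g"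
      using l(3) by (intro H1_approx_sum[where h="\<lambda>i k. h i (r k)"] H1_approx_subseq[OF A l(2)])
        (auto simp: comp_def intro: tendsto_vec_nth)
    have "0 \<le> second_variation 5 R (?g k)" for k
    proof (rule test_fun_second_variation_nonneg[OF R])
      show "?g k \<in> test_fun (disc R)" by (intro test_fun_sum test_fun_cmult ht)
      fix j :: int assume "\<bar>j\<bar> \<le> 4"
      then have "j \<in> {-4..4}" by auto
      then show "fourier (\<lambda>v. ?g k (polar (root_radius j, v))) j = 0"
        using c(2)[of j "r k"] Lsum[of j "\<lambda>i. c (r k) $ i" "r k"] by (simp add: L_def)
    qed
    then have "0 \<le> second_variation 5 R ?f"
      by (intro LIMSEQ_le_const[OF second_variation_limit[OF AA]]) auto
    moreover have "\<exists>i. l $ i \<noteq> 0"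
    proof (rule ccontr)
      assume "\<not> ?thesis"
      then have "l = 0" by (simp add: vec_eq_iff)
      then show False using l(1) by simp
    qed
    ultimately show "\<exists>c. (\<exists>i. c i \<noteq> 0) \<and> 0 \<le> second_variation 5 R (\<lambda>p. \<Sum>i\<in>UNIV. c i * b i p)"
      by (intro exI[of _ "\<lambda>i. l $ i"]) auto
  qed
  then show ?thesis by (simp add: numeral_eq_enat)
qed

section \<open>Upper bound for the bounded class\<close>

lemma abs_trig_le: "\<bar>trig k v\<bar> \<le> 1"
proof -
  have 1: "\<bar>x / c\<bar> \<le> 1" if "\<bar>x\<bar> \<le> 1" "1 \<le> c" for x c :: real
    using that by (simp add: abs_divide divide_le_eq)
  have "1 \<le> sqrt pi" "1 \<le> sqrt (2 * pi)" using pi_gt3 by auto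
  then show ?thesis
    unfolding trig_def by (simp only: split: if_split) (intro conjI impI 1 abs_cos_le_one abs_sin_le_one, simp_all)
qed

text \<open>A bounded radial derivative makes the coefficients Lipschitz in \<open>u\<close>, hence
  they extend continuously to the boundary radius. This gives a meaning to the two boundary
  conditions.\<close>

lemma (in strip_function) coef_limit:
  assumes bd: "bounded (pd 1 \<phi> ` strip R)" and R: "0 < R"
  shows "\<exists>l. (coef k \<longlongrightarrow> l) (at_left R)"
proof -
  obtain M where M: "\<And>p. p \<in> strip R \<Longrightarrow> \<bar>pd 1 \<phi> p\<bar> \<le> M" using bd by (auto simp: bounded_iff)
  define C where "C = \<bar>M\<bar> * (2 * pi)"
  have d: "\<bar>coef' k u\<bar> \<le> C" if u: "u \<in> {0<..<R}" for u
  proof -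
    have "norm (pd 1 \<phi> (u, v) * trig k v) \<le> \<bar>M\<bar>" for v
    proof -
      have "\<bar>pd 1 \<phi> (u, v)\<bar> \<le> \<bar>M\<bar>" using M[of "(u, v)"] u by (auto simp: mem_strip)
      then show ?thesis using mult_mono[OF _ abs_trig_le[of k v], of _ "\<bar>M\<bar>"] by (simp add: abs_mult)
    qed
    then have "norm (integral {0..2 * pi} (\<lambda>v. pd 1 \<phi> (u, v) * trig k v)) \<le> integral {0..2 * pi} (\<lambda>_. \<bar>M\<bar>)"
      by (intro integral_norm_bound_integral integrable_continuous_interval continuous_intros slices u) auto
    then show ?thesis by (simp add: coef'_def fourier_def C_def mult.commute)
  qed
  have "C-lipschitz_on {0<..<R} (coef k)"
  proof (rule bounded_derivative_imp_lipschitz)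
    show "(coef k has_derivative (\<lambda>h. coef' k x * h)) (at x within {0<..<R})" if "x \<in> {0<..<R}" for x
      using deriv_coef[OF that, of k] by (auto simp: has_field_derivative_def intro: has_derivative_at_withinI)
    show "onorm (\<lambda>h. coef' k x * h) \<le> C" if "x \<in> {0<..<R}" for x
      using d[OF that] by (intro onorm_le) (simp add: abs_mult mult_right_mono)
  qed (auto simp: C_def)
  then have "uniformly_continuous_on {0<..<R} (coef k)" by (rule lipschitz_on_uniformly_continuous)
  then obtain g where g: "uniformly_continuous_on (closure {0<..<R}) g" "\<And>x. x \<in> {0<..<R} \<Longrightarrow> coef k x = g x"
    by (rule uniformly_continuous_on_extension_on_closure) blast
  have "continuous_on {0..R} g" using uniformly_continuous_imp_continuous[OF g(1)] R by simp
  then have "(g \<longlongrightarrow> g R) (at R within {0..R})" using R by (simp add: continuous_on)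
  then have "(g \<longlongrightarrow> g R) (at_left R)" using R by (simp add: at_within_Icc_at_left)
  moreover have "\<forall>\<^sub>F x in at_left R. g x = coef k x"
    using eventually_at_left_real[OF R] by eventually_elim (simp add: g(2))
  ultimately show ?thesis using Lim_transform_eventually by blast
qed

lemma ind_b_le:
  assumes R: "3 / 2 < R"
  shows "ind_b 5 R \<le> 11"
proof -
  have "ind_b 5 R \<le> enat (CARD(12) - 1)"
    unfolding ind_b_def
  proof (rule neg_index_le)
    fix b :: "12 \<Rightarrow> real \<times> real \<Rightarrow> real"
    assume V: "\<And>c. (\<lambda>p. \<Sum>i\<in>UNIV. c i * b i p) \<in> bounded_class R"
    have b: "b i \<in> bounded_class R" for i
    proof -
      have "(\<Sum>j\<in>UNIV. (if j = i then 1 else 0) * b j p) = b i p" for p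
        by (simp add: if_distrib[of "\<lambda>x. x * _"] cong: if_cong)
      then show ?thesis using V[of "\<lambda>j. if j = i then 1 else 0"] by simp
    qed
    have sf: "strip_function R (g \<circ> polar)" if "g \<in> bounded_class R" for g
    proof
      show "Ck_on 1 (strip R) (g \<circ> polar)" using that by (simp add: bounded_class_def Let_def smooth_on_def)
    qed (simp add: polar_periodic)
    have bd: "bounded ((g \<circ> polar) ` strip R)" "bounded (pd 1 (g \<circ> polar) ` strip R)" if "g \<in> bounded_class R" for g
      using that by (auto simp: bounded_class_def Let_def)
    have "\<exists>l. (strip_function.coef (b i \<circ> polar) k \<longlongrightarrow> l) (at_left R)" for i k
      using strip_function.coef_limit[OF sf[OF b] bd(2)[OF b]] R by simp
    then obtain l where l: "\<And>i k. (strip_function.coef (b i \<circ> polar) k \<longlongrightarrow> l i k) (at_left R)" by metis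
    \<comment> \<open>The eleven linear conditions in one matrix: nine values at the zeros of the
      Jacobi fields and two boundary limits.\<close>
    define L where "L k i = (if \<bar>k\<bar> \<le> 4 then strip_function.coef (b i \<circ> polar) k (root_radius k) else l i k)" for k i
    have "\<exists>c. (\<exists>i\<in>UNIV. c i \<noteq> 0) \<and> (\<forall>k\<in>{-5..5}. (\<Sum>i\<in>(UNIV :: 12 set). c i * L k i) = 0)"
      by (rule exists_kernel_vector) auto
    then obtain c i0 where c: "c i0 \<noteq> 0" "\<And>k. k \<in> {-5..5} \<Longrightarrow> (\<Sum>i\<in>(UNIV :: 12 set). c i * L k i) = 0" by auto
    let ?f = "\<lambda>p. \<Sum>i\<in>UNIV. c i * b i p"
    interpret strip_function R "?f \<circ> polar" by (rule sf[OF V])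
    have csum: "coef k u = (\<Sum>i\<in>UNIV. c i * strip_function.coef (b i \<circ> polar) k u)" if u: "u \<in> {0<..<R}" for k u
    proof -
      have "fourier (\<lambda>v. \<Sum>i\<in>UNIV. c i * (b i \<circ> polar) (u, v)) k = (\<Sum>i\<in>UNIV. c i * fourier (\<lambda>v. (b i \<circ> polar) (u, v)) k)"
        by (rule fourier_sum[OF finite_class.finite_UNIV]) (rule strip_function.slices(1)[OF sf[OF b] u])
      then show ?thesis by (simp add: coef_def strip_function.coef_def[OF sf[OF b]])
    qed
    have z: "coef k (root_radius k) = 0" if k: "\<bar>k\<bar> \<le> 4" for k
    proof -
      have "root_radius k \<in> {0<..<R}" using root_radius(1,2)[OF k] R by auto
      moreover have "k \<in> {-5..5}" using k by auto
      ultimately show ?thesis using c(2)[of k] k by (simp add: csum L_def)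
    qed
    have lim: "(coef k \<longlongrightarrow> 0) (at_left R)" if k: "\<bar>k\<bar> = 5" for k
    proof -
      have "((\<lambda>u. \<Sum>i\<in>UNIV. c i * strip_function.coef (b i \<circ> polar) k u) \<longlongrightarrow> (\<Sum>i\<in>UNIV. c i * l i k)) (at_left R)"
        by (intro tendsto_intros l)
      moreover have "(\<Sum>i\<in>UNIV. c i * l i k) = 0"
      proof -
        have "k \<in> {-5..5}" using k by auto
        from c(2)[OF this] k show ?thesis by (simp add: L_def)
      qed
      moreover have "\<forall>\<^sub>F u in at_left R. (\<Sum>i\<in>UNIV. c i * strip_function.coef (b i \<circ> polar) k u) = coef k u"
      proof -
        have "0 < R" using R by simp
        from eventually_at_left_real[OF this] show ?thesis by eventually_elim (simp add: csum)
      qed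
      ultimately show ?thesis using Lim_transform_eventually by fastforce
    qed
    have "0 \<le> second_variation 5 R ?f"
      unfolding second_variation_classical[OF C1]
      by (rule variation_nonneg[OF R bd(1)[OF V] z]) (auto intro: lim)
    then show "\<exists>c. (\<exists>i. c i \<noteq> 0) \<and> 0 \<le> second_variation 5 R (\<lambda>p. \<Sum>i\<in>UNIV. c i * b i p)"
      using c(1) by (intro exI[of _ c]) auto
  qed
  then show ?thesis by (simp add: numeral_eq_enat)
qed

section \<open>Lower bounds for the indices\<close>

primrec cpow :: "nat \<Rightarrow> real \<times> real \<Rightarrow> real \<times> real" where
  "cpow 0 p = (1, 0)"
| "cpow (Suc m) p = (fst p * fst (cpow m p) - snd p * snd (cpow m p), fst p * snd (cpow m p) + snd p * fst (cpow m p))"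

lemma cpow_polar: "cpow m (polar (u, v)) = (u ^ m * cos (real m * v), u ^ m * sin (real m * v))"
proof (induction m)
  case (Suc m)
  have "real (Suc m) * v = v + real m * v" by (simp add: algebra_simps)
  then show ?case using Suc by (simp only: cpow.simps cos_add sin_add) (simp add: polar_def algebra_simps)
qed simp

lemma smooth_on_cpow: "smooth_on UNIV (\<lambda>p. fst (cpow m p))" "smooth_on UNIV (\<lambda>p. snd (cpow m p))"
  by (induction m) (auto intro!: smooth_on_add smooth_on_diff smooth_on_mult smooth_on_fst smooth_on_snd simp: smooth_on_const)

text \<open>Real and imaginary parts of \<open>(x + i y)^\<bar>k\<bar>\<close>, normalised as in \<open>trig\<close>.\<close>

definition harm :: "int \<Rightarrow> real \<times> real \<Rightarrow> real" where
  "harm k p = (if k = 0 then 1 / sqrt (2 * pi) else if k > 0 then fst (cpow (nat k) p) * (1 / sqrt pi)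
     else snd (cpow (nat (- k)) p) * (1 / sqrt pi))"

lemma harm_polar: "harm k (polar (u, v)) = u ^ nat \<bar>k\<bar> * trig k v"
  by (simp add: harm_def trig_def cpow_polar)

lemma smooth_on_harm: "smooth_on UNIV (harm k)"
proof -
  have s: "smooth_on UNIV (\<lambda>p. fst (cpow m p) * (1 / sqrt pi))" "smooth_on UNIV (\<lambda>p. snd (cpow m p) * (1 / sqrt pi))"
    "smooth_on UNIV (\<lambda>_. 1 / sqrt (2 * pi))" for m
    by (intro smooth_on_mult smooth_on_cpow smooth_on_const open_UNIV)+
  consider "k = 0" | "k > 0" | "k < 0" by linarith
  then show ?thesis
  proof cases
    case 1
    then have "harm k = (\<lambda>_. 1 / sqrt (2 * pi))" by (simp add: harm_def fun_eq_iff)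
    then show ?thesis using s(3) by (simp only:)
  next
    case 2
    then have "harm k = (\<lambda>p. fst (cpow (nat k) p) * (1 / sqrt pi))" by (simp add: harm_def fun_eq_iff)
    then show ?thesis using s(1) by (simp only:)
  next
    case 3
    then have "harm k = (\<lambda>p. snd (cpow (nat (- k)) p) * (1 / sqrt pi))" by (simp add: harm_def fun_eq_iff)
    then show ?thesis using s(2) by (simp only:)
  qed
qed

definition sq :: "real \<times> real \<Rightarrow> real" where "sq p = (fst p)\<^sup>2 + (snd p)\<^sup>2"

lemma sq_polar: "sq (polar (u, v)) = u\<^sup>2"
proof -
  have "u\<^sup>2 * (cos v)\<^sup>2 + u\<^sup>2 * (sin v)\<^sup>2 = u\<^sup>2" by (simp flip: distrib_left)
  then show ?thesis by (simp add: sq_def polar_def power_mult_distrib)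
qed

lemma smooth_on_sq: "smooth_on UNIV sq"
proof -
  have "smooth_on UNIV (\<lambda>p. sq p)" unfolding sq_def
    by (intro smooth_on_add smooth_on_power smooth_on_fst smooth_on_snd open_UNIV)
  then show ?thesis by simp
qed

text \<open>For k = 5 this is one tenth of the Jacobi field of that mode. Times the trigonometric
  function of frequency \<open>k\<close> it is a harmonic polynomial divided by 1 + u^10, hence
  smooth at the centre.\<close>

definition profile :: "nat \<Rightarrow> real \<Rightarrow> real" where
  "profile k u = u ^ k / (1 + u ^ 10)"

text \<open>The Riccati function of \<open>profile k\<close>. By \<open>profile_log_deriv\<close> it solves the Jacobi equation up to the term
  \<open>20 (5 - k) u^9 / (1 + u^10)\<close>, which is the gain in the modes \<open>k \<le> 4\<close>.\<close>

definition profile_log :: "nat \<Rightarrow> real \<Rightarrow> real" where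
  "profile_log k u = real k - 10 * u ^ 10 / (1 + u ^ 10)"

lemma u10_deriv: "((\<lambda>u. 1 + u ^ 10) has_real_derivative 10 * u ^ 9) (at (u::real))"
  by (auto intro!: derivative_eq_intros)

lemma profile_deriv:
  assumes "0 < u"
  shows "(profile k has_real_derivative profile k u * profile_log k u / u) (at u)"
proof -
  have pos: "1 + u ^ 10 \<noteq> 0" using one_plus_u10[of u] by simp
  have "(profile k has_real_derivative (real k * u ^ (k - 1) * (1 + u ^ 10) - u ^ k * (10 * u ^ 9)) / ((1 + u ^ 10) * (1 + u ^ 10))) (at u)"
    unfolding profile_def[abs_def] by (rule DERIV_divide[OF _ u10_deriv pos]) (auto intro!: derivative_eq_intros)
  moreover have 1: "real k * u ^ (k - 1) = real k * u ^ k / u" using assms by (cases k) auto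
  moreover have 2: "u ^ 9 = u ^ 10 / u" using assms power_Suc[of u 9] by (simp add: eq_divide_eq mult.commute)
  moreover have 3: "(real k * u ^ k / u * A - u ^ k * (10 * (t / u))) / (A * A) = u ^ k / A * (real k - 10 * t / A) / u"
    if "A \<noteq> 0" for A t :: real using that assms by (simp add: field_simps)
  ultimately show ?thesis unfolding profile_def profile_log_def 1 2 3[OF pos] by (simp only: 3[OF pos])
qed

lemma profile_log_deriv:
  assumes "0 < u"
  shows "(profile_log k has_real_derivative
    ((real k)\<^sup>2 / u - pot u + 20 * (5 - real k) * u ^ 9 / (1 + u ^ 10)) - (profile_log k u)\<^sup>2 / u) (at u)"
proof -
  define A where "A = 1 + u ^ 10"
  define t where "t = u ^ 10"
  define w where "w = u ^ 9"
  have A: "A \<noteq> 0" "A = 1 + t" using one_plus_u10[of u] by (auto simp: A_def t_def)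
  have t: "t = u * w" by (simp add: t_def w_def flip: power_Suc)
  have t': "((\<lambda>u. 10 * u ^ 10) has_real_derivative 10 * (10 * w)) (at u)"
    unfolding w_def by (auto intro!: derivative_eq_intros)
  have d: "(profile_log k has_real_derivative 0 - (10 * (10 * w) * A - 10 * t * (10 * w)) / (A * A)) (at u)"
    unfolding profile_log_def[abs_def]
    using DERIV_diff[OF DERIV_const[of "real k"] DERIV_divide[OF t' u10_deriv[of u]]] A(1) by (simp add: A_def t_def w_def)
  moreover have e1: "0 - (10 * (10 * w) * A - 10 * t * (10 * w)) / (A * A) = - 100 * w / (A * A)"
    unfolding A(2) by (simp add: algebra_simps)
  moreover have e2: "((real k)\<^sup>2 / u - 200 * w / (A * A) + 20 * (5 - real k) * w / A) - (real k - 10 * t / A)\<^sup>2 / u = - 100 * w / (A * A)"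
  proof -
    have "u * (((real k)\<^sup>2 / u - 200 * w / (A * A) + 20 * (5 - real k) * w / A) - (real k - 10 * t / A)\<^sup>2 / u)
      = (real k)\<^sup>2 - 200 * t / (A * A) + 20 * (5 - real k) * t / A - (real k - 10 * t / A)\<^sup>2"
      using assms by (simp add: right_diff_distrib distrib_left t mult_ac)
    also have "\<dots> = (- 200 * t + 100 * t * A - 100 * t * t) / (A * A)"
      using A(1) by (simp add: field_simps power2_eq_square)
    also have "\<dots> = u * (- 100 * w / (A * A))" unfolding A(2) t by (simp add: algebra_simps)
    finally show ?thesis using assms by (metis less_irrefl mult_left_cancel)
  qed
  moreover have "pot u = 200 * w / (A * A)" "profile_log k u = real k - 10 * t / A"
    by (simp_all add: profile_log_def pot_def A_def t_def w_def power2_eq_square)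
  ultimately show ?thesis by (simp only: A_def[symmetric] w_def[symmetric])
qed

section \<open>The radial energy of one mode\<close>

definition radial_density :: "nat \<Rightarrow> (real \<Rightarrow> real) \<Rightarrow> (real \<Rightarrow> real) \<Rightarrow> real \<Rightarrow> real" where
  "radial_density k \<rho> \<rho>' u = u * (\<rho>' u)\<^sup>2 + ((real k)\<^sup>2 / u - pot u) * (\<rho> u)\<^sup>2"

text \<open>Substituting the profile times a factor \<open>e\<close> turns the density into the
  derivative of \<open>H\<close> plus the term \<open>s\<close>, in which the square of
  \<open>e'\<close> is the cost of the factor and the subtracted part is the gain of the
  profile.\<close>

lemma radial_density_has_integral:
  assumes ab: "0 \<le> a" "a \<le> b"
    and e: "\<And>u. (e has_real_derivative e' u) (at u)" and e': "continuous_on UNIV e'"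
    and \<rho>': "\<And>u. ((\<lambda>u. profile k u * e u) has_real_derivative \<rho>' u) (at u)"
  defines "H \<equiv> \<lambda>u. profile_log k u * (profile k u)\<^sup>2 * (e u)\<^sup>2"
    and "s \<equiv> \<lambda>u. u * (profile k u)\<^sup>2 * (e' u)\<^sup>2 - 20 * (5 - real k) * u ^ 9 / (1 + u ^ 10) * ((profile k u)\<^sup>2 * (e u)\<^sup>2)"
  shows "(radial_density k (\<lambda>u. profile k u * e u) \<rho>' has_integral H b - H a + integral {a..b} s) {a..b}"
    "continuous_on S s"
proof -
  have pos: "1 + u ^ 10 \<noteq> 0" for u :: real using one_plus_u10[of u] by simp
  have ec: "continuous_on S e" for S using e by (intro continuous_at_imp_continuous_on) (auto intro: DERIV_isCont)
  have pc: "continuous_on S (profile k)" "continuous_on S (profile_log k)" for S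
    unfolding profile_def[abs_def] profile_log_def[abs_def] using pos by (auto intro!: continuous_intros)
  have e'c: "continuous_on S e'" for S using continuous_on_subset[OF e'] by simp
  show sc: "continuous_on S s" for S unfolding s_def using pos by (intro continuous_intros ec pc e'c) auto
  have "((\<lambda>u. radial_density k (\<lambda>u. profile k u * e u) \<rho>' u - s u) has_integral H b - H a) {a..b}"
  \<comment> \<open>Derivatives are taken only in the interior, since the formulas divide by
    \<open>u\<close> while \<open>a = 0\<close> is allowed; continuity of \<open>H\<close> takes
    care of the endpoint.\<close>
  proof (rule fundamental_theorem_of_calculus_interior[OF ab(2)])
    show "continuous_on {a..b} H" unfolding H_def by (intro continuous_intros ec pc)
    fix u assume "u \<in> {a<..<b}"
    then have u: "0 < u" using ab by auto
    let ?f = "profile k u" and ?W = "profile_log k u" and ?X = "(real k)\<^sup>2 / u - pot u + 20 * (5 - real k) * u ^ 9 / (1 + u ^ 10)"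
    have f2: "((\<lambda>u. (profile k u)\<^sup>2) has_real_derivative 2 * ?f * (?f * ?W / u)) (at u)"
      using DERIV_power[OF profile_deriv[OF u], where n=2] by (simp add: mult_ac)
    have e2: "((\<lambda>u. (e u)\<^sup>2) has_real_derivative 2 * e u * e' u) (at u)"
      using DERIV_power[OF e, where n=2] by (simp add: mult_ac)
    have "(H has_real_derivative ((?X - ?W\<^sup>2 / u) * ?f\<^sup>2 + 2 * ?f * (?f * ?W / u) * ?W) * (e u)\<^sup>2 + 2 * e u * e' u * (?W * ?f\<^sup>2)) (at u)"
      unfolding H_def by (rule DERIV_mult[OF DERIV_mult[OF profile_log_deriv[OF u] f2] e2])
    moreover have "\<rho>' u = ?f * ?W / u * e u + e' u * ?f"
      by (rule DERIV_unique[OF \<rho>' DERIV_mult[OF profile_deriv[OF u] e]])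
    moreover have "((X + z - W\<^sup>2 / u) * f\<^sup>2 + 2 * f * (f * W / u) * W) * E\<^sup>2 + 2 * E * E' * (W * f\<^sup>2)
        = (u * (f * W / u * E + E' * f)\<^sup>2 + X * (f * E)\<^sup>2) - (u * f\<^sup>2 * E'\<^sup>2 - z * (f\<^sup>2 * E\<^sup>2))" for X z W f E E' :: real
      using u by (simp add: field_simps power2_eq_square)
    ultimately have "(H has_real_derivative radial_density k (\<lambda>u. profile k u * e u) \<rho>' u - s u) (at u)"
      unfolding radial_density_def s_def by simp
    then show "(H has_vector_derivative radial_density k (\<lambda>u. profile k u * e u) \<rho>' u - s u) (at u)"
      by (simp add: has_real_derivative_iff_has_vector_derivative)
  qed
  moreover have "(s has_integral integral {a..b} s) {a..b}"
    by (intro integrable_integral integrable_continuous_interval sc)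
  ultimately have "((\<lambda>u. (radial_density k (\<lambda>u. profile k u * e u) \<rho>' u - s u) + s u) has_integral H b - H a + integral {a..b} s) {a..b}"
    by (rule has_integral_add)
  then show "(radial_density k (\<lambda>u. profile k u * e u) \<rho>' has_integral H b - H a + integral {a..b} s) {a..b}" by simp
qed

text \<open>Without a cut-off the boundary term at R decides: for R > 1 the fraction in
  \<open>profile_log\<close> exceeds 5, so the term is negative for all k up to 5, and the interior
  contributes nothing positive.\<close>

lemma radial_density_negative_free:
  assumes k: "k \<le> 5" and R: "1 < R"
    and \<rho>': "\<And>u. ((\<lambda>u. profile k u * 1) has_real_derivative \<rho>' u) (at u)"
  shows "\<exists>I. (radial_density k (\<lambda>u. profile k u * 1) \<rho>' has_integral I) {0..R} \<and> I < 0"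
proof -
  let ?H = "\<lambda>u. profile_log k u * (profile k u)\<^sup>2 * 1\<^sup>2"
  let ?s = "\<lambda>u. u * (profile k u)\<^sup>2 * 0\<^sup>2 - 20 * (5 - real k) * u ^ 9 / (1 + u ^ 10) * ((profile k u)\<^sup>2 * 1\<^sup>2)"
  have I: "(radial_density k (\<lambda>u. profile k u * 1) \<rho>' has_integral ?H R - ?H 0 + integral {0..R} ?s) {0..R}"
    and c: "continuous_on {0..R} ?s"
    using radial_density_has_integral[of 0 R "\<lambda>_. 1" "\<lambda>_. 0" k \<rho>'] R \<rho>' by (auto intro!: derivative_eq_intros)
  have "?H 0 = 0" by (cases k) (auto simp: profile_def profile_log_def)
  moreover have "?H R < 0"
  proof -
    have t: "1 < R ^ 10" using R by (simp add: one_less_power)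
    have "5 < 10 * R ^ 10 / (1 + R ^ 10)" using t by (simp add: less_divide_eq)
    then have "profile_log k R < 0" using k by (simp add: profile_log_def)
    moreover have "0 < profile k R" using R one_plus_u10[of R] by (simp add: profile_def)
    ultimately show ?thesis by (simp add: mult_neg_pos)
  qed
  moreover have "integral {0..R} ?s \<le> integral {0..R} (\<lambda>_. 0)"
  proof (rule integral_le[OF integrable_continuous_interval[OF c]])
    fix u assume u: "u \<in> {0..R}"
    have "0 \<le> 20 * (5 - real k) * u ^ 9 / (1 + u ^ 10) * ((profile k u)\<^sup>2 * 1\<^sup>2)"
      using u k one_plus_u10[of u] by (intro mult_nonneg_nonneg divide_nonneg_pos) auto
    then show "?s u \<le> 0" by simp
  qed auto
  moreover have "integral {0..R} (\<lambda>_. 0 :: real) = 0" by simp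
  ultimately have "?H R - ?H 0 + integral {0..R} ?s < 0" by linarith
  with I show ?thesis by blast
qed

text \<open>The cut-off \<open>bump (1 - d u\<^sup>2)\<close> costs at most \<open>2 d\<close>, to be compared with the gain on \<open>[0, 1]\<close>.\<close>

definition cut_rate :: real where "cut_rate = exp (- 4) / 100"

lemma cut_rate: "0 < cut_rate" "cut_rate \<le> 1 / 2"
proof -
  have "exp (- 4) \<le> (1::real)" by simp
  then show "cut_rate \<le> 1 / 2" unfolding cut_rate_def by linarith
qed (simp add: cut_rate_def)

lemma bump_has_derivative: "(bump has_real_derivative bump_deriv 1 t) (at t)"
  using bump_deriv_has_derivative[of 0 t] by (simp add: bump_eq)

text \<open>With s = 1/t the derivative is s^2 exp(-s), and s is at most exp(s/2).\<close>

lemma bump_deriv_1_bound: "0 \<le> bump_deriv 1 t" "bump_deriv 1 t \<le> 1"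
proof -
  have e: "bump_deriv 1 t = (if t > 0 then (1 / t)\<^sup>2 * exp (- (1 / t)) else 0)"
    by (simp add: bump_deriv_def power2_eq_square)
  show "0 \<le> bump_deriv 1 t" unfolding e by simp
  have "s\<^sup>2 * exp (- s) \<le> 1" if "0 < s" for s :: real
  proof -
    have "1 + s / 2 \<le> exp (s / 2)" by (rule exp_ge_add_one_self)
    have "s \<le> exp (s / 2)"
    proof (cases "s \<le> 2")
      case True
      then show ?thesis using \<open>1 + s / 2 \<le> exp (s / 2)\<close> by linarith
    next
      case False
      have "1 + (s / 2 - 1) \<le> exp (s / 2 - 1)" by (rule exp_ge_add_one_self)
      then have "s / 2 * exp 1 \<le> exp (s / 2 - 1) * exp 1" by (intro mult_right_mono) auto
      also have "\<dots> = exp (s / 2)" by (simp flip: exp_add)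
      finally have "s / 2 * exp 1 \<le> exp (s / 2)" .
      moreover have "s / 2 * 2 \<le> s / 2 * exp 1" using that exp_ge_add_one_self[of "1::real"] by (intro mult_left_mono) auto
      ultimately show ?thesis by simp
    qed
    then have "s\<^sup>2 \<le> (exp (s / 2))\<^sup>2" using that by (intro power_mono) auto
    also have "\<dots> = exp s" by (simp add: power2_eq_square flip: exp_add)
    finally show ?thesis by (simp add: exp_minus divide_inverse[symmetric] divide_le_eq)
  qed
  then show "bump_deriv 1 t \<le> 1" unfolding e by simp
qed

lemma radial_density_negative_cut:
  assumes k: "k \<le> 4" and R: "1 / sqrt cut_rate \<le> R"
    and \<rho>': "\<And>u. ((\<lambda>u. profile k u * bump (1 - cut_rate * u\<^sup>2)) has_real_derivative \<rho>' u) (at u)"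
  shows "\<exists>I. (radial_density k (\<lambda>u. profile k u * bump (1 - cut_rate * u\<^sup>2)) \<rho>' has_integral I) {0..R} \<and> I < 0"
proof -
  let ?d = cut_rate
  define e where "e u = bump (1 - ?d * u\<^sup>2)" for u
  define e' where "e' u = bump_deriv 1 (1 - ?d * u\<^sup>2) * (- (?d * (2 * u)))" for u
  define H where "H u = profile_log k u * (profile k u)\<^sup>2 * (e u)\<^sup>2" for u
  define s where "s u = u * (profile k u)\<^sup>2 * (e' u)\<^sup>2 - 20 * (5 - real k) * u ^ 9 / (1 + u ^ 10) * ((profile k u)\<^sup>2 * (e u)\<^sup>2)" for u
  define r where "r = 1 / sqrt ?d"
  have d: "0 < ?d" "?d \<le> 1 / 2" by (rule cut_rate)+
  have r2: "r\<^sup>2 = 1 / ?d" using d by (simp add: r_def power_divide)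
  have r0: "0 < r" using d by (simp add: r_def)
  have "1\<^sup>2 \<le> r\<^sup>2" unfolding r2 using d by (simp add: field_simps)
  then have r1: "1 \<le> r" using r0 by (metis less_imp_le power2_le_imp_le)
  have rR: "r \<le> R" using R by (simp add: r_def)
  have de: "(e has_real_derivative e' u) (at u)" for u
    unfolding e_def[abs_def] e'_def
    by (rule DERIV_chain2[OF bump_has_derivative]) (auto intro!: derivative_eq_intros)
  have cb: "continuous_on UNIV (bump_deriv 1)"
    using bump_deriv_has_derivative[of 1] by (intro continuous_at_imp_continuous_on) (auto intro: DERIV_isCont)
  have "continuous_on UNIV (\<lambda>u. bump_deriv 1 (1 - ?d * u\<^sup>2))"
    by (rule continuous_on_compose2[OF cb]) (auto intro!: continuous_intros)
  then have ce': "continuous_on UNIV e'" unfolding e'_def[abs_def]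
    by (rule continuous_on_mult) (auto intro!: continuous_intros)
  have \<rho>e: "((\<lambda>u. profile k u * e u) has_real_derivative \<rho>' u) (at u)" for u unfolding e_def by (rule \<rho>')
  have "0 \<le> R" using rR r0 by simp
  then have I: "(radial_density k (\<lambda>u. profile k u * e u) \<rho>' has_integral H R - H 0 + integral {0..R} s) {0..R}"
    unfolding H_def s_def[abs_def] by (rule radial_density_has_integral(1)[OF order_refl _ de ce' \<rho>e])
  have c: "continuous_on S s" for S
    unfolding s_def[abs_def] by (rule radial_density_has_integral(2)[OF order_refl \<open>0 \<le> R\<close> de ce' \<rho>e])
  have z: "e u = 0" "e' u = 0" if "r \<le> u" for u
  proof -
    have "r\<^sup>2 \<le> u\<^sup>2" using that r0 by (intro power_mono) auto
    then have "1 \<le> ?d * u\<^sup>2" unfolding r2 using d by (simp add: field_simps)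
    then show "e u = 0" "e' u = 0" by (auto simp: e_def e'_def bump_0 bump_deriv_def)
  qed
  have H0: "H 0 = 0" by (cases k) (auto simp: H_def profile_def profile_log_def)
  have HR: "H R = 0" using z(1)[OF rR] by (simp add: H_def)
  have split: "integral {0..R} s = integral {0..1} s + integral {1..r} s + integral {r..R} s"
  proof -
    have i: "s integrable_on {a..b}" for a b by (intro integrable_continuous_interval c)
    have "integral {0..1} s + integral {1..r} s = integral {0..r} s"
      by (rule Henstock_Kurzweil_Integration.integral_combine[OF _ r1 i]) simp
    moreover have "integral {0..r} s + integral {r..R} s = integral {0..R} s"
      by (rule Henstock_Kurzweil_Integration.integral_combine[OF _ rR i]) (use r0 in simp)
    ultimately show ?thesis by simp
  qed
  have zr: "integral {r..R} s = 0"
  proof -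
    have "integral {r..R} s = integral {r..R} (\<lambda>_. 0)"
      by (rule Henstock_Kurzweil_Integration.integral_cong) (use z in \<open>auto simp: s_def\<close>)
    then show ?thesis by simp
  qed
  \<comment> \<open>The derivative of the cut-off is -2 d u times a factor in [0, 1], and
    \<open>u\<close> times the profile is at most 1 for these k. Integrated up to the radius r = 1 /
    sqrt d this costs at most 2 d^2 r^2 = 2 d.\<close>
  have first: "u * (profile k u)\<^sup>2 * (e' u)\<^sup>2 \<le> 4 * ?d\<^sup>2 * u" if u: "0 \<le> u" for u
  proof -
    have "profile k u * u \<le> 1"
    proof -
      have "u ^ Suc k \<le> 1 + u ^ 10"
      proof (cases "u \<le> 1")
        case True
        then have "u ^ Suc k \<le> 1" using u by (intro power_le_one) auto
        moreover have "0 \<le> u ^ 10" using u by simp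
        ultimately show ?thesis by linarith
      next
        case False
        then have "u ^ Suc k \<le> u ^ 10" using k by (intro power_increasing) auto
        then show ?thesis by linarith
      qed
      then show ?thesis using one_plus_u10[of u] by (simp add: profile_def divide_le_eq mult.commute)
    qed
    moreover have "0 \<le> profile k u * u" using u one_plus_u10[of u] by (simp add: profile_def)
    ultimately have p: "(profile k u * u)\<^sup>2 \<le> 1" by (simp add: power_le_one)
    have "(bump_deriv 1 (1 - ?d * u\<^sup>2))\<^sup>2 \<le> 1" using bump_deriv_1_bound by (simp add: power_le_one)
    then have "(profile k u * u)\<^sup>2 * (bump_deriv 1 (1 - ?d * u\<^sup>2))\<^sup>2 \<le> 1 * 1" by (intro mult_mono p) auto
    then have "(4 * ?d\<^sup>2 * u) * ((profile k u * u)\<^sup>2 * (bump_deriv 1 (1 - ?d * u\<^sup>2))\<^sup>2) \<le> (4 * ?d\<^sup>2 * u) * 1"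
      using u by (intro mult_left_mono) auto
    then show ?thesis by (simp add: e'_def power_mult_distrib mult_ac)
  qed
  have second: "0 \<le> 20 * (5 - real k) * u ^ 9 / (1 + u ^ 10) * ((profile k u)\<^sup>2 * (e u)\<^sup>2)" if "0 \<le> u" for u
    using that k one_plus_u10[of u] by (intro mult_nonneg_nonneg divide_nonneg_pos) auto
  have "integral {1..r} s \<le> 2 * ?d\<^sup>2 * r\<^sup>2 - 2 * ?d\<^sup>2 * 1\<^sup>2"
  proof (rule has_integral_le[OF integrable_integral[OF integrable_continuous_interval[OF c]]])
    show "((\<lambda>u. 4 * ?d\<^sup>2 * u) has_integral 2 * ?d\<^sup>2 * r\<^sup>2 - 2 * ?d\<^sup>2 * 1\<^sup>2) {1..r}"
      by (rule fundamental_theorem_of_calculus[OF r1])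
        (auto intro!: derivative_eq_intros simp flip: has_real_derivative_iff_has_vector_derivative)
    fix u assume "u \<in> {1..r}"
    then have "0 \<le> u" by simp
    from first[OF this] second[OF this] show "s u \<le> 4 * ?d\<^sup>2 * u" unfolding s_def by linarith
  qed
  \<comment> \<open>On [0, 1] the gain coefficient is at least 10 u^9, the squared profile at least
    u^8 / 4 and the squared cut-off at least exp(-4), the last because \<open>cut_rate\<close> is at
    most 1/2. The product of the three bounds is C u^17.\<close>
  moreover define C where "C = 5 / 2 * exp (- 4 :: real)"
  have "integral {0..1} s \<le> (2 * ?d\<^sup>2 * 1\<^sup>2 - C * 1 ^ 18 / 18) - (2 * ?d\<^sup>2 * 0\<^sup>2 - C * 0 ^ 18 / 18)"
  proof (rule has_integral_le[OF integrable_integral[OF integrable_continuous_interval[OF c]]])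
    show "((\<lambda>u. 4 * ?d\<^sup>2 * u - C * u ^ 17) has_integral (2 * ?d\<^sup>2 * 1\<^sup>2 - C * 1 ^ 18 / 18) - (2 * ?d\<^sup>2 * 0\<^sup>2 - C * 0 ^ 18 / 18)) {0..1}"
      by (rule fundamental_theorem_of_calculus)
        (auto intro!: derivative_eq_intros simp flip: has_real_derivative_iff_has_vector_derivative)
    fix u :: real assume "u \<in> {0..1}"
    then have u: "0 \<le> u" "u \<le> 1" by auto
    have u10: "u ^ 10 \<le> 1" using u by (simp add: power_le_one)
    have "exp (- 2) \<le> e u"
    proof -
      have "u\<^sup>2 \<le> 1" using u by (simp add: power_le_one)
      then have "?d * u\<^sup>2 \<le> 1 / 2 * 1" using d by (intro mult_mono) auto
      then have h: "1 / 2 \<le> 1 - ?d * u\<^sup>2" by simp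
      then have "1 / (1 - ?d * u\<^sup>2) \<le> 2" by (simp add: divide_le_eq)
      then show ?thesis using h by (simp add: e_def bump_def)
    qed
    then have "(exp (- 2))\<^sup>2 \<le> (e u)\<^sup>2" by (intro power_mono) auto
    then have e2: "exp (- 4) \<le> (e u)\<^sup>2" by (simp add: power2_eq_square flip: exp_add)
    have "u ^ 4 \<le> u ^ k" using u k by (intro power_decreasing) auto
    moreover have "u ^ 4 / 2 \<le> u ^ 4 / (1 + u ^ 10)" using u u10 one_plus_u10[of u]
      by (intro divide_left_mono) auto
    ultimately have "u ^ 4 / 2 \<le> profile k u" unfolding profile_def
      using one_plus_u10[of u] by (meson divide_right_mono less_imp_le order_trans mult_1)
    then have "(u ^ 4 / 2)\<^sup>2 \<le> (profile k u)\<^sup>2" using u by (intro power_mono) auto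
    then have "u ^ 8 / 4 \<le> (profile k u)\<^sup>2" by (simp add: power_divide flip: power_mult)
    then have pe: "u ^ 8 / 4 * exp (- 4) \<le> (profile k u)\<^sup>2 * (e u)\<^sup>2" using e2 u by (intro mult_mono) auto
    have le: "10 * u ^ 9 \<le> 20 * (5 - real k) * u ^ 9 / (1 + u ^ 10)"
    proof -
      have "20 * 1 * u ^ 9 \<le> 20 * (5 - real k) * u ^ 9" using k u by (intro mult_right_mono mult_left_mono) auto
      moreover have "10 * u ^ 9 * (1 + u ^ 10) \<le> 10 * u ^ 9 * 2" using u u10 by (intro mult_left_mono) auto
      ultimately show ?thesis using one_plus_u10[of u] by (simp add: le_divide_eq)
    qed
    have "0 \<le> 20 * (5 - real k) * u ^ 9 / (1 + u ^ 10)"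
      by (rule order_trans[OF _ le]) (use u in simp)
    then have "10 * u ^ 9 * (u ^ 8 / 4 * exp (- 4)) \<le> 20 * (5 - real k) * u ^ 9 / (1 + u ^ 10) * ((profile k u)\<^sup>2 * (e u)\<^sup>2)"
      by (rule mult_mono[OF le pe]) (use u in simp)
    moreover have "10 * u ^ 9 * (u ^ 8 / 4 * exp (- 4)) = C * u ^ 17"
      by (simp add: C_def flip: power_add)
    ultimately show "s u \<le> 4 * ?d\<^sup>2 * u - C * u ^ 17" using first[OF u(1)] unfolding s_def by linarith
  qed
  \<comment> \<open>The cost 2 d is exp(-4) / 50, the gain C / 18 is 5 exp(-4) / 36.\<close>
  moreover have "2 * ?d\<^sup>2 * r\<^sup>2 < C / 18"
  proof -
    have "2 * ?d\<^sup>2 * r\<^sup>2 = 2 * ?d" unfolding r2 using d by (simp add: power2_eq_square)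
    also have "\<dots> < C / 18" by (simp add: cut_rate_def C_def)
    finally show ?thesis .
  qed
  ultimately have "H R - H 0 + integral {0..R} s < 0" unfolding split zr HR H0 by simp
  then show ?thesis using I unfolding e_def by blast
qed

section \<open>The energy of a finite sum of modes\<close>

lemma integral_trig_sum_square:
  assumes "finite K"
  shows "integral {0..2 * pi} (\<lambda>v. (\<Sum>k\<in>K. c k * trig k v)\<^sup>2) = (\<Sum>k\<in>K. (c k)\<^sup>2)"
proof -
  have "fourier (\<lambda>_. 0) k = 0" for k by (simp add: fourier_def)
  then show ?thesis
    using integral_unique[OF integral_minus_trig_sum[OF continuous_on_const[of _ 0] assms, of c]] by simp
qed

text \<open>By orthonormality all cross terms vanish on each circle. The angular derivative
  exchanges k and -k, which the symmetric range \<open>K\<close> absorbs by reindexing, so the form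
  is diagonal in the coefficients \<open>c\<close>.\<close>

lemma second_variation_modes:
  fixes m :: nat and c :: "int \<Rightarrow> real" and e :: "real \<Rightarrow> real" and g :: "real \<times> real \<Rightarrow> real"
  defines "K \<equiv> {- int m..int m}"
    and "\<rho> \<equiv> \<lambda>k u. profile (nat \<bar>k\<bar>) u * e u"
    and "f \<equiv> \<lambda>p. \<Sum>k\<in>{- int m..int m}. c k * (harm k p * g p)"
  assumes R: "0 < R" and g: "smooth_on UNIV g" "\<And>u v. g (polar (u, v)) = e u / (1 + u ^ 10)"
    and \<rho>': "\<And>k u. (\<rho> k has_real_derivative \<rho>' k u) (at u)"
    and I: "\<And>k. k \<in> K \<Longrightarrow> (radial_density (nat \<bar>k\<bar>) (\<rho> k) (\<rho>' k) has_integral I k) {0..R}"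
  shows "second_variation 5 R f = (\<Sum>k\<in>K. (c k)\<^sup>2 * I k)"
proof -
  have fin: "finite K" by (simp add: K_def)
  have fs: "smooth_on UNIV f" unfolding f_def
    by (intro smooth_on_sum smooth_on_mult smooth_on_const smooth_on_harm g(1) open_UNIV)
  have fC: "Ck_on 1 (strip R) (f \<circ> polar)"
    using smooth_on_subset[OF smooth_on_polar[OF fs open_UNIV, of UNIV], of "strip R"] by (simp add: smooth_on_def)
  interpret strip_function R "f \<circ> polar"
    by unfold_locales (rule fC, simp add: polar_def)
  have val: "(f \<circ> polar) (u, v) = (\<Sum>k\<in>K. (c k * \<rho> k u) * trig k v)" for u v
    unfolding f_def comp_def K_def \<rho>_def
    by (intro sum.cong refl) (simp add: harm_polar g(2) profile_def)
  have d: "(f \<circ> polar) differentiable (at p)" for p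
    by (rule pd_polar(3), rule smooth_on_differentiable[OF fs]) simp
  have pd1: "pd 1 (f \<circ> polar) (u, v) = (\<Sum>k\<in>K. (c k * \<rho>' k u) * trig k v)" for u v
  proof (rule DERIV_unique[OF Ck_on_1_slices(1)[OF d]])
    show "((\<lambda>u. (f \<circ> polar) (u, v)) has_real_derivative (\<Sum>k\<in>K. (c k * \<rho>' k u) * trig k v)) (at u)"
      unfolding val by (intro DERIV_sum DERIV_cmult_right DERIV_cmult \<rho>')
  qed
  have pd2: "pd 2 (f \<circ> polar) (u, v) = (\<Sum>k\<in>K. (of_int k * (c (- k) * \<rho> (- k) u)) * trig k v)" for u v
  proof (rule DERIV_unique[OF Ck_on_1_slices(2)[OF d]])
    have "(\<Sum>k\<in>K. (c k * \<rho> k u) * (- of_int k * trig (- k) v)) = (\<Sum>k\<in>K. (of_int k * (c (- k) * \<rho> (- k) u)) * trig k v)"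
      by (rule sum.reindex_bij_witness[of _ uminus uminus]) (auto simp: K_def)
    moreover have "((\<lambda>v. (f \<circ> polar) (u, v)) has_real_derivative (\<Sum>k\<in>K. (c k * \<rho> k u) * (- of_int k * trig (- k) v))) (at v)"
      unfolding val by (intro DERIV_sum DERIV_cmult trig_deriv)
    ultimately show "((\<lambda>v. (f \<circ> polar) (u, v)) has_real_derivative (\<Sum>k\<in>K. (of_int k * (c (- k) * \<rho> (- k) u)) * trig k v)) (at v)"
      by simp
  qed
  have N: "nrm u = (\<Sum>k\<in>K. (c k * \<rho> k u)\<^sup>2)" "rad u = (\<Sum>k\<in>K. (c k * \<rho>' k u)\<^sup>2)" for u
    unfolding nrm_def rad_def val pd1 by (rule integral_trig_sum_square[OF fin])+
  have A: "ang u = (\<Sum>k\<in>K. (of_int k * (c k * \<rho> k u))\<^sup>2)" for u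
  proof -
    have "ang u = (\<Sum>k\<in>K. (of_int k * (c (- k) * \<rho> (- k) u))\<^sup>2)"
      unfolding ang_def pd2 by (rule integral_trig_sum_square[OF fin])
    also have "\<dots> = (\<Sum>k\<in>K. (of_int k * (c k * \<rho> k u))\<^sup>2)"
      by (rule sum.reindex_bij_witness[of _ uminus uminus]) (auto simp: K_def power_mult_distrib)
    finally show ?thesis .
  qed
  have dens: "dens u = (\<Sum>k\<in>K. (c k)\<^sup>2 * radial_density (nat \<bar>k\<bar>) (\<rho> k) (\<rho>' k) u)" for u
    unfolding dens_def N A sum_distrib_left sum_divide_distrib sum.distrib[symmetric] sum_subtractf[symmetric]
    by (intro sum.cong refl) (simp add: radial_density_def power_mult_distrib algebra_simps)
  have "((\<lambda>u. \<Sum>k\<in>K. (c k)\<^sup>2 * radial_density (nat \<bar>k\<bar>) (\<rho> k) (\<rho>' k) u) has_integral (\<Sum>k\<in>K. (c k)\<^sup>2 * I k)) {0..R}"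
    by (intro has_integral_sum fin has_integral_mult_right I)
  then have Id: "integral {0..R} dens = (\<Sum>k\<in>K. (c k)\<^sup>2 * I k)" unfolding dens by (rule integral_unique)
  have "set_integrable lborel ({0<..<R} \<times> {0..<2 * pi}) (variation_density (f \<circ> polar))"
  proof -
    \<comment> \<open>The density rewritten without division: the angular derivative carries a
      factor \<open>u\<close>, so its square over \<open>u\<close> extends continuously to u = 0.
      Integrability follows from continuity on a compact rectangle.\<close>
    define F where "F p = fst p * (pd 1 (f \<circ> polar) p)\<^sup>2
      + fst p * (cos (snd p) * pd 2 f (polar p) - sin (snd p) * pd 1 f (polar p))\<^sup>2 - pot (fst p) * (f (polar p))\<^sup>2" for p
    have cp: "continuous_on UNIV (\<lambda>p. h (polar p))" if "continuous_on UNIV h" for h :: "real \<times> real \<Rightarrow> real"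
      by (rule continuous_on_compose2[OF that]) (auto simp: polar_def case_prod_beta intro!: continuous_intros)
    have 1: "continuous_on UNIV (pd 1 (f \<circ> polar))"
      using smooth_on_continuous[OF smooth_on_pd[OF smooth_on_polar[OF fs open_UNIV, of UNIV]]] by simp
    have 2: "continuous_on UNIV (\<lambda>p. pd i f (polar p))" for i
      by (rule cp[OF smooth_on_continuous[OF smooth_on_pd[OF fs]]])
    have 3: "continuous_on UNIV (\<lambda>p. f (polar p))" by (rule cp[OF smooth_on_continuous[OF fs]])
    have 4: "continuous_on UNIV (\<lambda>p::real \<times> real. pot (fst p))"
      by (rule continuous_on_compose2[OF continuous_on_pot[of UNIV]]) (auto intro!: continuous_intros)
    have cF: "continuous_on UNIV F" unfolding F_def[abs_def]
      by (intro continuous_on_add continuous_on_diff continuous_on_mult continuous_on_power 1 2 3 4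
        continuous_on_cos continuous_on_sin continuous_on_fst continuous_on_snd continuous_on_id)
    have "set_integrable lborel (cbox (0, 0) (R, 2 * pi)) F"
      by (rule set_integrable_compact_support[OF compact_cbox subset_refl continuous_on_subset[OF cF subset_UNIV]]) simp
    then have "set_integrable lborel ({0<..<R} \<times> {0..<2 * pi}) F"
      by (rule set_integrable_subset) (auto simp: borel_Times mem_cbox_prod)
    moreover have "variation_density (f \<circ> polar) p = F p" if "p \<in> {0<..<R} \<times> {0..<2 * pi}" for p
    proof -
      have "f differentiable (at (polar p))" by (rule smooth_on_differentiable[OF fs]) simp
      then show ?thesis using that
        by (auto simp: variation_density_def F_def pd_polar(2) power_mult_distrib power2_eq_square)
    qed
    ultimately show ?thesis unfolding set_integrable_def
      by (subst Bochner_Integration.integrable_cong[OF refl, of _ _ "\<lambda>p. indicator ({0<..<R} \<times> {0..<2 * pi}) p *\<^sub>R F p"])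
        (auto simp: indicator_def)
  qed
  from integral_variation_density(2)[OF this] show ?thesis
    unfolding second_variation_classical[OF fC] Id .
qed

section \<open>Smooth functions belong to the function spaces\<close>

lemma L2_on_continuous:
  assumes "continuous_on UNIV f"
  shows "f \<in> L2_on (disc R)"
proof -
  have "L2fun lborel (zero_ext (cball 0 R) f)"
    by (rule L2fun_zero_ext_continuous[OF compact_cball continuous_on_subset[OF assms]]) simp
  then have "L2fun lborel (\<lambda>p. indicator (disc R) p * zero_ext (cball 0 R) f p)"
    by (rule L2fun_weight(1)[where C=1]) (auto simp: indicator_def disc_def)
  moreover have "(\<lambda>p. indicator (disc R) p * zero_ext (cball 0 R) f p) = zero_ext (disc R) f"
    by (rule ext) (auto simp: zero_ext_def indicator_def disc_def zero_prod_def)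
  ultimately show ?thesis by (simp add: L2_on_iff)
qed

lemma smooth_H1:
  assumes "smooth_on UNIV f"
  shows "f \<in> H1 (disc R)"
proof -
  have "Ck_on 1 (disc R) f" using smooth_on_subset[OF assms, of "disc R"] by (simp add: smooth_on_def)
  then have "is_weak_pd i (disc R) f (pd i f)" for i by (rule is_weak_pd_classical[OF disc_open])
  moreover have "pd i f \<in> L2_on (disc R)" for i
    by (intro L2_on_continuous smooth_on_continuous smooth_on_pd assms)
  ultimately show ?thesis
    using L2_on_continuous[OF smooth_on_continuous[OF assms]] by (auto simp: H1_def)
qed

lemma H1_norm_zero: "H1_norm (disc R) 0 = 0"
proof -
  have 0: "(0 :: real \<times> real \<Rightarrow> real) = (\<lambda>_. 0)" by (simp add: zero_fun_def)
  have "pd i (\<lambda>_. 0 :: real) = (\<lambda>_. 0)" for i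
    by (rule ext, rule pd_has_derivative[of _ "\<lambda>_. 0"]) simp
  then have w: "is_weak_pd i (disc R) 0 (\<lambda>_. 0)" for i
    using is_weak_pd_classical[OF disc_open Ck_on_const[of 1 "disc R" 0], of i] unfolding 0 by simp
  have "(LINT p:disc R|lborel. (weak_pd i (disc R) 0 p)\<^sup>2) = 0" for i
    unfolding set_lebesgue_integral_def
    by (rule integral_eq_zero_AE, use weak_pd_AE[OF disc_open w[of i]] in eventually_elim) (simp add: indicator_def)
  then show ?thesis by (simp add: H1_norm_def set_lebesgue_integral_def zero_fun_def)
qed

lemma test_fun_H10:
  assumes "f \<in> test_fun (disc R)"
  shows "f \<in> H10 (disc R)"
proof -
  have "(\<lambda>k::nat. H1_norm (disc R) (f - f)) \<longlonglongrightarrow> 0" by (simp add: H1_norm_zero)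
  then show ?thesis using smooth_H1[OF test_fun_smooth[OF assms]] assms
    unfolding H10_def by (intro CollectI conjI exI[of _ "\<lambda>_. f"]) auto
qed

text \<open>The strip is unbounded, but by periodicity all values are taken on one closed period, a
  compact rectangle.\<close>

lemma bounded_periodic:
  fixes g :: "real \<times> real \<Rightarrow> real"
  assumes c: "continuous_on UNIV g" and per: "\<And>p. g (p + (0, 2 * pi)) = g p"
  shows "bounded (g ` strip R)"
proof -
  have pn: "g (p + (0, 2 * pi * real n)) = g p" for p and n :: nat
  proof (induction n)
    case (Suc n)
    have "p + (0, 2 * pi * real (Suc n)) = (p + (0, 2 * pi * real n)) + (0, 2 * pi)"
      by (cases p) (simp add: algebra_simps)
    then show ?case by (simp only: per Suc)
  qed (cases p, simp)
  have pz: "g (p + (0, 2 * pi * of_int n)) = g p" for p and n :: int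
  proof (cases "0 \<le> n")
    case True
    then show ?thesis using pn[of p "nat n"] by simp
  next
    case False
    have "p + (0, 2 * pi * of_int n) + (0, 2 * pi * real (nat (- n))) = p" using False by (cases p) simp
    then show ?thesis using pn[of "p + (0, 2 * pi * of_int n)" "nat (- n)"] by (simp only:)
  qed
  have "bounded (g ` cbox (0, 0) (R, 2 * pi))"
    by (intro compact_imp_bounded compact_continuous_image compact_cbox continuous_on_subset[OF c]) simp
  moreover have "g ` strip R \<subseteq> g ` cbox (0, 0) (R, 2 * pi)"
  proof
    fix y assume "y \<in> g ` strip R"
    then obtain u v where uv: "u \<in> {0<..<R}" "y = g (u, v)" by (auto simp: strip_def)
    define n where "n = \<lfloor>v / (2 * pi)\<rfloor>"
    have "of_int n \<le> v / (2 * pi)" "v / (2 * pi) \<le> of_int n + 1" unfolding n_def by linarith+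
    then have n: "0 \<le> v - 2 * pi * of_int n" "v - 2 * pi * of_int n \<le> 2 * pi" by (auto simp: field_simps)
    have "g (u, v - 2 * pi * of_int n) = y" using pz[of "(u, v - 2 * pi * of_int n)" n] uv by simp
    moreover have "(u, v - 2 * pi * of_int n) \<in> cbox (0, 0) (R, 2 * pi)" using n uv by (auto simp: mem_cbox_prod)
    ultimately show "y \<in> g ` cbox (0, 0) (R, 2 * pi)" by blast
  qed
  ultimately show ?thesis by (rule bounded_subset)
qed

lemma pd_periodic:
  assumes "\<And>p. g (p + a) = g p"
  shows "pd i g (p + a) = pd i g p"
proof -
  have "g (p + a + t *\<^sub>R coord_dir i) = g (p + t *\<^sub>R coord_dir i)" for t
    using assms[of "p + t *\<^sub>R coord_dir i"] by (simp add: add_ac)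
  then show ?thesis by (simp add: pd_def)
qed

lemma smooth_bounded_class:
  assumes "smooth_on UNIV f"
  shows "f \<in> bounded_class R"
proof -
  have s: "smooth_on UNIV (f \<circ> polar)" by (rule smooth_on_polar[OF assms]) auto
  have per: "(f \<circ> polar) (p + (0, 2 * pi)) = (f \<circ> polar) p" for p
    by (cases p) (simp add: polar_periodic)
  note per1 = pd_periodic[of "f \<circ> polar", OF per]
  have per2: "pd i (pd j (f \<circ> polar)) (p + (0, 2 * pi)) = pd i (pd j (f \<circ> polar)) p" for i j p
    by (rule pd_periodic[of "pd j (f \<circ> polar)", OF per1])
  have "bounded ((f \<circ> polar) ` strip R)"
    by (rule bounded_periodic[OF smooth_on_continuous[OF s] per])
  moreover have "bounded (pd i (f \<circ> polar) ` strip R)" for i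
    by (rule bounded_periodic[OF smooth_on_continuous[OF smooth_on_pd[OF s]] per1])
  moreover have "bounded (pd i (pd j (f \<circ> polar)) ` strip R)" for i j
    by (rule bounded_periodic[OF smooth_on_continuous[OF smooth_on_pd[OF smooth_on_pd[OF s]]] per2])
  ultimately show ?thesis
    using smooth_H1[OF assms] smooth_on_subset[OF s, of "strip R"] by (simp add: bounded_class_def Let_def)
qed

text \<open>The diagonal form has negative entries on 2 m + 1 modes. The factor \<open>e\<close>
  covers both the plain profile and the cut-off one; the type \<open>'n\<close> only serves to index
  the modes, through a bijection with \<open>K\<close>.\<close>

lemma neg_index_ge_modes:
  fixes m :: nat and e :: "real \<Rightarrow> real" and g :: "real \<times> real \<Rightarrow> real"
  defines "K \<equiv> {- int m..int m}"
  assumes R: "0 < R" and g: "smooth_on UNIV g" "\<And>u v. g (polar (u, v)) = e u / (1 + u ^ 10)"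
    and e: "\<And>u. e differentiable (at u)"
    and I: "\<And>k \<rho>'. k \<le> m \<Longrightarrow> (\<And>u. ((\<lambda>u. profile k u * e u) has_real_derivative \<rho>' u) (at u)) \<Longrightarrow>
        \<exists>I. (radial_density k (\<lambda>u. profile k u * e u) \<rho>' has_integral I) {0..R} \<and> I < 0"
    and V: "\<And>c. (\<lambda>p. \<Sum>k\<in>K. c k * (harm k p * g p)) \<in> V"
    and n: "CARD('n::finite) = 2 * m + 1"
  shows "enat (2 * m + 1) \<le> neg_index V (second_variation 5 R)"
proof -
  have cK: "card K = 2 * m + 1" by (simp add: K_def)
  then obtain \<kappa> :: "'n \<Rightarrow> int" where \<kappa>: "bij_betw \<kappa> UNIV K"
    using n finite_same_card_bij[of "UNIV :: 'n set" K] by (auto simp: K_def)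
  have re: "(\<Sum>i\<in>UNIV. c i * h (\<kappa> i)) = (\<Sum>k\<in>K. c (inv \<kappa> k) * h k)" for c h :: "_ \<Rightarrow> real"
    using \<kappa> by (intro sum.reindex_bij_betw[of \<kappa> UNIV K "\<lambda>k. c (inv \<kappa> k) * h k", THEN trans[rotated]] sum.cong)
      (auto simp: bij_betw_def inv_f_f)
  have re': "(\<lambda>p. \<Sum>i\<in>UNIV. c i * (harm (\<kappa> i) p * g p)) = (\<lambda>p. \<Sum>k\<in>K. c (inv \<kappa> k) * (harm k p * g p))" for c
    by (rule ext, rule re[of c "\<lambda>k. harm k _ * g _"])
  define \<rho>' where "\<rho>' k u = deriv (\<lambda>u. profile (nat \<bar>k\<bar>) u * e u) u" for k :: int and u
  have pd: "profile k differentiable (at u)" for k u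
  proof -
    have "1 + u ^ 10 \<noteq> 0" using one_plus_u10[of u] by simp
    then show ?thesis unfolding profile_def[abs_def] by (intro derivative_intros) auto
  qed
  have \<rho>': "((\<lambda>u. profile (nat \<bar>k\<bar>) u * e u) has_real_derivative \<rho>' k u) (at u)" for k u
    unfolding \<rho>'_def DERIV_deriv_iff_real_differentiable by (intro differentiable_mult pd e)
  have "\<exists>I. (radial_density (nat \<bar>k\<bar>) (\<lambda>u. profile (nat \<bar>k\<bar>) u * e u) (\<rho>' k) has_integral I) {0..R} \<and> I < 0"
    if "k \<in> K" for k
    by (rule I[OF _ \<rho>']) (use that in \<open>auto simp: K_def\<close>)
  then obtain J where J: "\<And>k. k \<in> K \<Longrightarrow> (radial_density (nat \<bar>k\<bar>) (\<lambda>u. profile (nat \<bar>k\<bar>) u * e u) (\<rho>' k) has_integral J k) {0..R}"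
    "\<And>k. k \<in> K \<Longrightarrow> J k < 0" by metis
  have Q: "second_variation 5 R (\<lambda>p. \<Sum>k\<in>K. c k * (harm k p * g p)) = (\<Sum>k\<in>K. (c k)\<^sup>2 * J k)" for c
    unfolding K_def by (rule second_variation_modes[OF R g \<rho>']) (use J(1) in \<open>auto simp: K_def\<close>)
  have "enat CARD('n) \<le> neg_index V (second_variation 5 R)"
  proof (rule neg_index_ge[where b="\<lambda>i p. harm (\<kappa> i) p * g p"])
    fix c :: "'n \<Rightarrow> real"
    show "(\<lambda>p. \<Sum>i\<in>UNIV. c i * (harm (\<kappa> i) p * g p)) \<in> V" unfolding re' by (rule V)
    assume "\<exists>i. c i \<noteq> 0"
    then obtain i where i: "c i \<noteq> 0" by blast
    have ki: "\<kappa> i \<in> K" "inv \<kappa> (\<kappa> i) = i" using \<kappa> by (auto simp: bij_betw_def inv_f_f)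
    have "(\<Sum>k\<in>K. (c (inv \<kappa> k))\<^sup>2 * J k) < 0"
    proof -
      have "(\<Sum>k\<in>K. (c (inv \<kappa> k))\<^sup>2 * J k) < (\<Sum>k\<in>K. 0)"
      proof (rule sum_strict_mono_ex1)
        show "\<forall>k\<in>K. (c (inv \<kappa> k))\<^sup>2 * J k \<le> 0" 
          by (intro ballI mult_nonneg_nonpos zero_le_power2 less_imp_le[OF J(2)])
        show "\<exists>k\<in>K. (c (inv \<kappa> k))\<^sup>2 * J k < 0"
          by (rule bexI[OF _ ki(1)]) (use ki i J(2)[OF ki(1)] in \<open>simp add: mult_pos_neg\<close>)
      qed (simp add: K_def)
      then show ?thesis by simp
    qed
    then show "second_variation 5 R (\<lambda>p. \<Sum>i\<in>UNIV. c i * (harm (\<kappa> i) p * g p)) < 0" unfolding re' Q .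
  next
    have "second_variation 5 R (\<lambda>p. \<Sum>k\<in>K. 0 * (harm k p * g p)) = 0" unfolding Q by simp
    then show "0 \<le> second_variation 5 R 0" by (simp add: zero_fun_def)
  qed
  then show ?thesis using n by simp
qed

text \<open>The fifth power of \<open>sq\<close> is u^10 written as a polynomial in the Cartesian
  coordinates, so the function is smooth at the centre as well.\<close>

definition radial_free :: "real \<times> real \<Rightarrow> real" where
  "radial_free p = inverse (1 + sq p ^ 5)"

definition radial_cut :: "real \<times> real \<Rightarrow> real" where
  "radial_cut p = inverse (1 + sq p ^ 5) * bump (1 - cut_rate * sq p)"

lemma smooth_radial: "smooth_on UNIV radial_free" "smooth_on UNIV radial_cut"
proof -
  have nz: "1 + sq p ^ 5 \<noteq> 0" for p
    using zero_le_power[of "sq p" 5] by (simp add: sq_def add_nonneg_eq_0_iff)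
  have "smooth_on UNIV (\<lambda>p. inverse (1 + sq p ^ 5))"
    by (intro smooth_on_inverse smooth_on_add smooth_on_const smooth_on_power smooth_on_sq open_UNIV nz)
  moreover have "smooth_on UNIV (\<lambda>p. bump (1 - cut_rate * sq p))"
    by (intro smooth_on_bump smooth_on_diff smooth_on_mult smooth_on_const smooth_on_sq open_UNIV)
  ultimately show "smooth_on UNIV radial_free" "smooth_on UNIV radial_cut"
    using smooth_on_mult[OF open_UNIV] unfolding radial_free_def[abs_def] radial_cut_def[abs_def] by blast+
qed

lemma radial_polar: "radial_free (polar (u, v)) = 1 / (1 + u ^ 10)"
  "radial_cut (polar (u, v)) = bump (1 - cut_rate * u\<^sup>2) / (1 + u ^ 10)"
  by (simp_all add: radial_free_def radial_cut_def sq_polar divide_inverse mult.commute flip: power_mult)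

lemma ind_b_ge:
  assumes "1 < R"
  shows "11 \<le> ind_b 5 R"
proof -
  have "enat (2 * 5 + 1) \<le> ind_b 5 R" unfolding ind_b_def
  proof (rule neg_index_ge_modes[where g=radial_free and e="\<lambda>_. 1" and 'n=11])
    show "(\<lambda>p. \<Sum>k\<in>{- int 5..int 5}. c k * (harm k p * radial_free p)) \<in> bounded_class R" for c
      by (intro smooth_bounded_class smooth_on_sum smooth_on_mult smooth_on_const smooth_on_harm smooth_radial open_UNIV)
    show "\<exists>I. (radial_density k (\<lambda>u. profile k u * 1) \<rho>' has_integral I) {0..R} \<and> I < 0"
      if "k \<le> 5" "\<And>u. ((\<lambda>u. profile k u * 1) has_real_derivative \<rho>' u) (at u)" for k \<rho>'
      by (rule radial_density_negative_free[OF that(1) assms that(2)])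
  qed (use assms in \<open>simp_all add: smooth_radial radial_polar\<close>)
  then show ?thesis by (simp add: numeral_eq_enat)
qed

lemma test_fun_radial_cut:
  assumes R: "1 / sqrt cut_rate < R" and h: "smooth_on UNIV h"
  shows "(\<lambda>p. h p * radial_cut p) \<in> test_fun (disc R)"
proof -
  let ?r = "1 / sqrt cut_rate"
  have sub: "{p. h p * radial_cut p \<noteq> 0} \<subseteq> cball 0 ?r"
  proof
    fix p assume "p \<in> {p. h p * radial_cut p \<noteq> 0}"
    then have "bump (1 - cut_rate * sq p) \<noteq> 0" by (auto simp: radial_cut_def)
    then have "cut_rate * sq p < 1" using bump_0[of "1 - cut_rate * sq p"] by linarith
    then have "sq p < ?r\<^sup>2" using cut_rate(1) by (simp add: power_divide field_simps)
    moreover have "sq p = (norm p)\<^sup>2" by (cases p) (simp add: sq_def norm_Pair)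
    ultimately have "(norm p)\<^sup>2 < ?r\<^sup>2" by simp
    then have "norm p < ?r" by (rule power2_less_imp_less) (use cut_rate(1) in simp)
    then show "p \<in> cball 0 ?r" by simp
  qed
  then have c: "closure {p. h p * radial_cut p \<noteq> 0} \<subseteq> cball 0 ?r" by (intro closure_minimal closed_cball)
  have "cball 0 ?r \<subseteq> disc R" using R by (auto simp: disc_def zero_prod_def)
  moreover have "compact (closure {p. h p * radial_cut p \<noteq> 0})"
    using c compact_Int_closed[OF compact_cball[of "0 :: real \<times> real" ?r], of "closure {p. h p * radial_cut p \<noteq> 0}"]
    by (simp add: Int_absorb1)
  ultimately show ?thesis using c smooth_on_mult[OF open_UNIV h smooth_radial(2)]
    unfolding test_fun_def by blast
qed

lemma ind_c_ge:
  assumes R: "1 / sqrt cut_rate < R"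
  shows "9 \<le> ind_c 5 R"
proof -
  have "0 < R" using R cut_rate(1) by (meson less_trans real_sqrt_gt_zero zero_less_divide_1_iff)
  have "enat (2 * 4 + 1) \<le> ind_c 5 R" unfolding ind_c_def
  proof (rule neg_index_ge_modes[where g=radial_cut and e="\<lambda>u. bump (1 - cut_rate * u\<^sup>2)" and 'n=9])
    show "(\<lambda>p. \<Sum>k\<in>{- int 4..int 4}. c k * (harm k p * radial_cut p)) \<in> H10 (disc R)" for c
      by (intro test_fun_H10 test_fun_sum test_fun_cmult test_fun_radial_cut R smooth_on_harm)
    show "(\<lambda>u. bump (1 - cut_rate * u\<^sup>2)) differentiable (at u)" for u
      unfolding real_differentiable_def
      by (rule exI, rule DERIV_chain2[OF bump_has_derivative]) (auto intro!: derivative_eq_intros)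
  qed (use R \<open>0 < R\<close> in \<open>auto simp: smooth_radial radial_polar intro: radial_density_negative_cut\<close>)
  then show ?thesis by (simp add: numeral_eq_enat)
qed

text \<open>Both indices are constant once R is large: the upper bounds hold for R > 3/2, the lower
  ones for R > 1 / sqrt \<open>cut_rate\<close> and R > 1 respectively.\<close>

theorem theorem2p5:
  shows "(ind_c 5 \<longlongrightarrow> 9) at_top \<and> (ind_b 5 \<longlongrightarrow> 11) at_top"
proof
  show "(ind_c 5 \<longlongrightarrow> 9) at_top"
    by (rule tendsto_eventually, use eventually_gt_at_top[of "3 / 2"] eventually_gt_at_top[of "1 / sqrt cut_rate"] in eventually_elim)
      (intro antisym ind_c_le ind_c_ge)
  show "(ind_b 5 \<longlongrightarrow> 11) at_top"
    by (rule tendsto_eventually, use eventually_gt_at_top[of "3 / 2"] in eventually_elim)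
      (intro antisym ind_b_le ind_b_ge, simp_all)
qed

end
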